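(* Let $p$ be a prime, let $P(t) \in \mathbb{Z}_{p}[t]$ be a monic polynomial whose image in $\mathbb{F}_{p}[t]$ modulo $p$ is irreducible, and let $G$ be a finite size module over $\mathbb{Z}_{p}[t]/(P(t))$. Fix $n \in \mathbb{Z}_{\geq 1}$. For any $\bar{X} \in \mathrm{M}_{n}(\mathbb{F}_{p})$ such that $\mathrm{cok}(P(\bar{X})) \simeq G/pG$, if $X$ is a random matrix in $\mathrm{M}_{n}(\mathbb{Z}_{p})$ distributed according to the Haar probability measure, then $$\mathrm{Prob}\left(\mathrm{cok}(P(X)) \simeq G \ \text{ and } \ X \equiv \bar{X} \pmod{p}\right) = \frac{p^{\deg(P)\left(\dim_{\mathbb{F}_{p}[t]/(P(t))}(G/pG)\right)^{2}- n^{2}}}{|\mathrm{Aut}_{\mathbb{Z}_{p}[t]/(P(t))}(G)|}\prod_{i=1}^{\dim_{\mathbb{F}_{p}[t]/(P(t))}(G/pG)}(1 - p^{-i\deg(P)})^{2}.$$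
   Context: $\mathbb{Z}_{p}$ is the ring of $p$-adic integers, $\mathbb{F}_{p} = \mathbb{Z}/p\mathbb{Z}$, and $\mathrm{M}_{n}(A)$ denotes the ring of $n \times n$ matrices over a commutative ring $A$ with unity. In forming $P(\bar X)$ and $\mathbb{F}_p[t]/(P(t))$, $P$ is reduced modulo $p$. $\mathrm{cok}(P(X)) = \mathbb{Z}_{p}^{n}/P(X)\mathbb{Z}_{p}^{n}$ is a module over $\mathbb{Z}_{p}[t]/(P(t))$, with $\bar t$ acting as left multiplication by $X$; similarly $\mathrm{cok}(P(\bar{X})) = \mathbb{F}_{p}^{n}/P(\bar{X})\mathbb{F}_{p}^{n}$ is a module over the field $\mathbb{F}_{p}[t]/(P(t))$, with $\bar t$ acting by $\bar{X}$. Isomorphisms are isomorphisms of $\mathbb{Z}_{p}[t]/(P(t))$-modules. $\mathrm{Aut}_{S}(G)$ is the group of $S$-linear automorphisms of $G$. Empty products are equal to $1$. *)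

theory Defs
  imports
    "HOL-Probability.Probability"
    "HOL-Algebra.QuotRing"
    "Jordan_Normal_Form.VS_Connect"
    "Berlekamp_Zassenhaus.Finite_Field"
begin

hide_const (open) Modules.module

section \<open>The $p$-adic integers\<close>

text \<open>
  The prime \<open>p\<close> is \<open>CARD('p)\<close> for a type \<open>'p\<close> of class \<^class>\<open>prime_card\<close>; \<open>'p mod_ring\<close> is the field
  with \<open>p\<close> elements. The ring of \<open>p\<close>-adic integers is the inverse limit of the rings of integers
  modulo \<open>p ^ k\<close>, where residue classes are represented by their least nonnegative elements.
\<close>

typedef (overloaded) ('p :: prime_card) padic_int =
  "{x :: nat \<Rightarrow> int. \<forall>k. x k \<in> {0..<int CARD('p) ^ k} \<and> x (Suc k) mod int CARD('p) ^ k = x k}"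
  morphisms padic_nth Abs_padic_int
  by (rule exI[of _ "\<lambda>_. 0"]) (auto simp: prime_gt_0_nat prime_card)

setup_lifting type_definition_padic_int

lemma CARD_prime_power_pos [simp]: "0 < int CARD('p :: prime_card) ^ k"
  by (simp add: prime_gt_0_nat prime_card)

lemma mod_prime_power_Suc [simp]:
  "(a mod int CARD('p :: prime_card) ^ Suc k) mod int CARD('p) ^ k = a mod int CARD('p) ^ k"
  by (rule mod_mod_cancel) simp

lemma padic_seqI:
  assumes "\<And>k. y (Suc k) mod int CARD('p :: prime_card) ^ k = y k mod int CARD('p) ^ k"
  shows "(y k mod int CARD('p) ^ k) \<in> {0..<int CARD('p) ^ k} \<and>
    (y (Suc k) mod int CARD('p) ^ Suc k) mod int CARD('p) ^ k = y k mod int CARD('p) ^ k"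
  using assms[of k] mod_prime_power_Suc[where 'p = 'p, of "y (Suc k)" k]
  by (simp del: power_Suc)

instantiation padic_int :: (prime_card) comm_ring_1
begin

lift_definition zero_padic_int :: "'a padic_int" is "\<lambda>_. 0"
  by simp

lift_definition one_padic_int :: "'a padic_int" is "\<lambda>k. 1 mod int CARD('a) ^ k"
  using padic_seqI[where 'p = 'a and y = "\<lambda>_. 1"] by simp

lift_definition plus_padic_int :: "'a padic_int \<Rightarrow> 'a padic_int \<Rightarrow> 'a padic_int"
  is "\<lambda>x y k. (x k + y k) mod int CARD('a) ^ k"
  by (intro allI padic_seqI) (metis mod_add_eq mod_mod_trivial)

lift_definition times_padic_int :: "'a padic_int \<Rightarrow> 'a padic_int \<Rightarrow> 'a padic_int"
  is "\<lambda>x y k. (x k * y k) mod int CARD('a) ^ k"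
  by (intro allI padic_seqI) (metis mod_mult_eq mod_mod_trivial)

lift_definition uminus_padic_int :: "'a padic_int \<Rightarrow> 'a padic_int"
  is "\<lambda>x k. (- x k) mod int CARD('a) ^ k"
  by (intro allI padic_seqI) (metis mod_minus_eq mod_mod_trivial)

lift_definition minus_padic_int :: "'a padic_int \<Rightarrow> 'a padic_int \<Rightarrow> 'a padic_int"
  is "\<lambda>x y k. (x k - y k) mod int CARD('a) ^ k"
  by (intro allI padic_seqI) (metis mod_diff_eq mod_mod_trivial)

instance
proof
  fix a b c :: "'a padic_int"
  show "a * b * c = a * (b * c)"
    by transfer (simp add: fun_eq_iff mod_simps mult.assoc)
  show "a * b = b * a"
    by transfer (simp add: mult.commute)
  show "1 * a = a"
    by transfer (auto simp: fun_eq_iff mod_simps)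
  show "a + b + c = a + (b + c)"
    by transfer (simp add: fun_eq_iff mod_simps add.assoc)
  show "a + b = b + a"
    by transfer (simp add: add.commute)
  show "0 + a = a"
    by transfer (auto simp: fun_eq_iff)
  show "- a + a = 0"
    by transfer (simp add: fun_eq_iff mod_simps)
  show "a - b = a + - b"
    by transfer (simp add: fun_eq_iff mod_simps)
  show "(a + b) * c = a * c + b * c"
    by transfer (simp add: fun_eq_iff mod_simps distrib_right)
  have "1 < int CARD('a)"
    using prime_gt_1_nat[OF prime_card] by simp
  then show "(0 :: 'a padic_int) \<noteq> 1"
    by transfer (auto simp: fun_eq_iff intro!: exI[of _ 1])
qed

end

definition residue :: "('p :: prime_card) padic_int \<Rightarrow> 'p mod_ring" where
  "residue x = of_int_mod_ring (padic_nth x 1)"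

definition poly_residue :: "('p :: prime_card) padic_int poly \<Rightarrow> 'p mod_ring poly" where
  "poly_residue = map_poly residue"


section \<open>Haar measure on matrices\<close>

text \<open>The \<open>p\<close>-adic topology: the sets \<open>A + p\<^sup>k M\<^sub>n\<close> form a neighbourhood base at \<open>A\<close>.\<close>

definition mat_cong :: "nat \<Rightarrow> ('p :: prime_card) padic_int mat \<Rightarrow> 'p padic_int mat \<Rightarrow> bool" where
  "mat_cong k A B \<longleftrightarrow> (\<forall>i < dim_row A. \<forall>j < dim_col A. of_nat CARD('p) ^ k dvd B $$ (i, j) - A $$ (i, j))"

definition mat_open :: "nat \<Rightarrow> ('p :: prime_card) padic_int mat set \<Rightarrow> bool" where
  "mat_open n U \<longleftrightarrow> U \<subseteq> carrier_mat n n \<and>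
     (\<forall>A \<in> U. \<exists>k. \<forall>B \<in> carrier_mat n n. mat_cong k A B \<longrightarrow> B \<in> U)"

definition mat_topology :: "nat \<Rightarrow> ('p :: prime_card) padic_int mat topology" where
  "mat_topology n = topology (mat_open n)"

lemma mat_cong_mono: "mat_cong l A B \<Longrightarrow> k \<le> l \<Longrightarrow> mat_cong k A B"
  unfolding mat_cong_def by (meson dvd_trans le_imp_power_dvd)

lemma openin_mat_topology [simp]: "openin (mat_topology n) = mat_open n"
  unfolding mat_topology_def
proof (rule topology_inverse', unfold istopology_def, intro conjI allI impI)
  fix S T :: "'a padic_int mat set"
  assume S: "mat_open n S" and T: "mat_open n T"
  have "\<exists>k. \<forall>B \<in> carrier_mat n n. mat_cong k A B \<longrightarrow> B \<in> S \<inter> T" if "A \<in> S \<inter> T" for A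
  proof -
    obtain k l where "\<forall>B \<in> carrier_mat n n. mat_cong k A B \<longrightarrow> B \<in> S"
      and "\<forall>B \<in> carrier_mat n n. mat_cong l A B \<longrightarrow> B \<in> T"
      using S T \<open>A \<in> S \<inter> T\<close> unfolding mat_open_def by blast
    then show ?thesis
      by (intro exI[of _ "max k l"]) (meson IntI max.cobounded1 max.cobounded2 mat_cong_mono)
  qed
  then show "mat_open n (S \<inter> T)"
    using S unfolding mat_open_def by blast
next
  fix K :: "'a padic_int mat set set"
  assume "\<forall>S\<in>K. mat_open n S"
  then show "mat_open n (\<Union>K)"
    unfolding mat_open_def by (meson Sup_least UnionE UnionI)
qed

lemma topspace_mat_topology [simp]: "topspace (mat_topology n) = carrier_mat n n"
proof
  show "topspace (mat_topology n) \<subseteq> (carrier_mat n n :: 'a padic_int mat set)"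
    using openin_topspace[of "mat_topology n :: 'a padic_int mat topology"]
    unfolding openin_mat_topology mat_open_def by blast
  show "(carrier_mat n n :: 'a padic_int mat set) \<subseteq> topspace (mat_topology n)"
    by (rule openin_subset) (simp add: mat_open_def)
qed

definition mat_borel :: "nat \<Rightarrow> ('p :: prime_card) padic_int mat measure" where
  "mat_borel n = sigma (topspace (mat_topology n)) {U. openin (mat_topology n) U}"

definition haar_prob :: "nat \<Rightarrow> ('p :: prime_card) padic_int mat measure \<Rightarrow> bool" where
  "haar_prob n M \<longleftrightarrow> prob_space M \<and> space M = carrier_mat n n \<and> sets M = sets (mat_borel n) \<and>
     (\<forall>A \<in> carrier_mat n n. \<forall>U \<in> sets M. emeasure M ((\<lambda>B. A + B) ` U) = emeasure M U)"


section \<open>Modules\<close>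

text \<open>
  The module records extend ring records; their fields \<^const>\<open>mult\<close> and \<^const>\<open>one\<close> play no role.
\<close>

definition quot_module :: "('r, 'b) module \<Rightarrow> 'b set \<Rightarrow> ('r, 'b set) module" where
  "quot_module M N = \<lparr>carrier = a_rcosets\<^bsub>M\<^esub> N, mult = undefined, one = undefined,
     zero = N, add = set_add M, smult = (\<lambda>r C. \<Union>x\<in>C. N +>\<^bsub>M\<^esub> (r \<odot>\<^bsub>M\<^esub> x))\<rparr>"

text \<open>The quotient of \<open>M\<close> by \<open>mM\<close>.\<close>

definition quot_nat :: "('r, 'b) module \<Rightarrow> nat \<Rightarrow> ('r, 'b set) module" where
  "quot_nat M m = quot_module M {[m] \<cdot>\<^bsub>M\<^esub> x | x. x \<in> carrier M}"

definition module_isos ::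
  "('r, 'a) ring_scheme \<Rightarrow> ('r, 'b) module \<Rightarrow> ('r, 'c) module \<Rightarrow> ('b \<Rightarrow> 'c) set" where
  "module_isos R M N = {f \<in> module_hom R M N. bij_betw f (carrier M) (carrier N)}"

definition module_isomorphic ::
  "('r, 'a) ring_scheme \<Rightarrow> ('r, 'b) module \<Rightarrow> ('r, 'c) module \<Rightarrow> bool" where
  "module_isomorphic R M N \<longleftrightarrow> module_isos R M N \<noteq> {}"

text \<open>Extensionality makes every automorphism count exactly once.\<close>

definition module_aut :: "('r, 'a) ring_scheme \<Rightarrow> ('r, 'b) module \<Rightarrow> ('b \<Rightarrow> 'b) set" where
  "module_aut R M = module_isos R M M \<inter> extensional (carrier M)"

definition restrict_scalars :: "('r \<Rightarrow> 'k) \<Rightarrow> ('k, 'b) module \<Rightarrow> ('r, 'b) module" where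
  "restrict_scalars \<phi> M = \<lparr>carrier = carrier M, mult = mult M, one = one M,
     zero = zero M, add = add M, smult = (\<lambda>r. smult M (\<phi> r))\<rparr>"

text \<open>
  If \<open>\<phi>\<close> maps \<open>R\<close> onto \<open>K\<close> and its kernel annihilates the \<open>R\<close>-module \<open>M\<close>, then \<open>M\<close> is a \<open>K\<close>-module:
  a scalar acts through any of its preimages.
\<close>

definition descend_scalars ::
  "('r, 'a) ring_scheme \<Rightarrow> ('r \<Rightarrow> 'k) \<Rightarrow> ('r, 'b) module \<Rightarrow> ('k, 'b) module" where
  "descend_scalars R \<phi> M = \<lparr>carrier = carrier M, mult = mult M, one = one M,
     zero = zero M, add = add M, smult = (\<lambda>c. smult M (inv_into (carrier R) \<phi> c))\<rparr>"


section \<open>Cokernels of polynomials in a matrix\<close>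

text \<open>The ring \<open>A[t]/(P)\<close>; its elements are the cosets of the ideal generated by \<open>P\<close>.\<close>

definition poly_quot :: "'a :: comm_ring_1 poly \<Rightarrow> 'a poly set ring" where
  "poly_quot P = class_ring Quot (PIdl\<^bsub>class_ring\<^esub> P)"

definition poly_mat :: "'a :: comm_ring_1 poly \<Rightarrow> 'a mat \<Rightarrow> 'a mat" where
  "poly_mat f X = mat (dim_row X) (dim_row X) (\<lambda>ij. \<Sum>k\<le>degree f. Polynomial.coeff f k * (X ^\<^sub>m k) $$ ij)"

text \<open>
  The quotient of \<open>A\<^sup>n\<close> by the image of \<open>P(X)\<close> as a module over \<open>A[t]/(P)\<close>: the class of \<open>f\<close> maps
  the class of \<open>w\<close> to the class of \<open>f(X) w\<close>. The cosets united in the definition of the scalar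
  multiplication are all equal.
\<close>

definition cok :: "'a :: comm_ring_1 poly \<Rightarrow> 'a mat \<Rightarrow> ('a poly set, 'a vec set) module" where
  "cok P X = (let V = module_vec TYPE('a) (dim_row X);
                  N = {poly_mat P X *\<^sub>v v | v. v \<in> carrier V}
     in \<lparr>carrier = a_rcosets\<^bsub>V\<^esub> N, mult = undefined, one = undefined, zero = N, add = set_add V,
         smult = (\<lambda>F W. \<Union>f\<in>F. \<Union>w\<in>W. N +>\<^bsub>V\<^esub> (poly_mat f X *\<^sub>v w))\<rparr>)"

text \<open>
  Reduction modulo \<open>p\<close> maps the coset \<open>f + (P)\<close> onto the coset of the reduction of \<open>f\<close> modulo the
  reduction of \<open>P\<close>, so the surjection from \<open>\<int>\<^sub>p[t]/(P)\<close> to \<open>\<bbbF>\<^sub>p[t]/(P)\<close> is taking images.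
\<close>

definition quot_residue :: "('p :: prime_card) padic_int poly set \<Rightarrow> 'p mod_ring poly set" where
  "quot_residue F = poly_residue ` F"

text \<open>The dimension of \<open>G/pG\<close> over \<open>\<bbbF>\<^sub>p[t]/(P)\<close>.\<close>

definition residue_dim ::
  "('p :: prime_card) padic_int poly \<Rightarrow> ('p padic_int poly set, 'g) module \<Rightarrow> nat" where
  "residue_dim P G = vectorspace.dim (poly_quot (poly_residue P))
     (descend_scalars (poly_quot P) quot_residue (quot_nat G CARD('p)))"

end

theory Submission
  imports Defs "HOL-Library.Function_Algebras"
begin

text \<open>
  Write \<open>R = \<int>\<^sub>p[t]/(P)\<close>, let \<open>K = \<bbbF>\<^sub>p[t]/(P)\<close> be its residue field with \<open>q = p^d\<close> elements,
  and let \<open>r\<close> be the dimension of \<open>G/pG\<close> over \<open>K\<close>. An isomorphism from the cokernel of \<open>P(X)\<close>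
  to \<open>G\<close> is the same as a surjective \<open>\<int>\<^sub>p\<close>-linear map \<open>F\<close> from \<open>\<int>\<^sub>p^n\<close> to \<open>G\<close> with
  \<open>F(X v) = t F(v)\<close> and kernel \<open>P(X) \<int>\<^sub>p^n\<close>; such an \<open>F\<close> is called a presentation. The
  presentations that belong to one \<open>X\<close> are a torsor under \<open>Aut(G)\<close>, or there are none
  (\<open>card_pres\<close>, \<open>cok_isomorphic_iff_pres\<close>). Hence \<open>|Aut(G)|\<close> times the desired probability is
  the sum, over all \<open>F\<close>, of the probability that \<open>F\<close> is a presentation for \<open>X\<close> and \<open>X\<close> reduces
  to \<open>Xbar\<close> (\<open>measure_iso_event\<close>).

  Such an \<open>F\<close> reduces modulo \<open>p\<close> to an isomorphism from the cokernel of \<open>P(Xbar)\<close> to \<open>G/pG\<close>.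
  There are \<open>|GL\<^sub>r(K)|\<close> of these isomorphisms, and since \<open>\<int>\<^sub>p^n\<close> is free, each lifts to
  \<open>|pG|^n\<close> maps \<open>F\<close> (\<open>card_pres_lifts\<close>).

  Fix one such \<open>F\<close>. It is onto by Nakayama's lemma, and \<open>F X\<^sub>0 = t F\<close> for some \<open>X\<^sub>0\<close> that
  reduces to \<open>Xbar\<close> (\<open>pres_lifts_compat\<close>). Write \<open>X = X\<^sub>0 + p Y\<close> and \<open>Z = F \<circ> Y\<close>. For Haar
  distributed \<open>X\<close> the composite \<open>Z\<close> is uniformly distributed among the \<open>|G|^n\<close> linear maps to
  \<open>G\<close> (\<open>measure_cell\<close>), and \<open>F X = t F\<close> says that \<open>Z\<close> takes values in the \<open>p\<close>-torsion \<open>G[p]\<close>.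
  In that case \<open>F\<close> is a presentation for \<open>X\<close> if and only if the obstruction
  \<open>\<delta>\<^sub>X : ker P(Xbar) \<rightarrow> G[p], w \<mapsto> F(P(X) w / p)\<close> is bijective (\<open>pres_iff_\<delta>\<close>). This is the snake
  lemma for multiplication by \<open>p\<close> on the surjection from the cokernel of \<open>P(X)\<close> to \<open>G\<close>,
  because \<open>P(X) w / p\<close> runs through the \<open>p\<close>-torsion of the cokernel. Source and target of
  \<open>\<delta>\<^sub>X\<close> have the same size \<open>q^r\<close>.

  Expanding \<open>P(X\<^sub>0 + p Y)\<close> shows that \<open>\<delta>\<^sub>X\<close> differs from \<open>\<delta>\<close> at \<open>X\<^sub>0\<close> by a term that depends
  additively on \<open>Z\<close> alone, a noncommutative difference quotient of \<open>P\<close>. Since \<open>P\<close> is monic and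
  irreducible modulo \<open>p\<close>, every \<open>K\<close>-linear map from \<open>ker P(Xbar)\<close> to \<open>G[p]\<close> arises as some
  \<open>\<delta>\<^sub>X\<close> (\<open>obs_of_surj\<close>). So \<open>\<delta>\<^sub>X\<close> is uniformly distributed among the \<open>q^(r^2)\<close> linear maps
  (\<open>card_obs_of_injs\<close>), and is bijective with probability \<open>|GL\<^sub>r(K)| / q^(r^2)\<close>.

  Altogether the sum over \<open>F\<close> is
  \<open>|GL\<^sub>r(K)| |pG|^n |G[p]|^n |GL\<^sub>r(K)| / (p^(n^2) |G|^n q^(r^2))\<close>, where \<open>|G| = |pG| |G[p]|\<close>.
  With \<open>|GL\<^sub>r(K)| = q^(r^2) (1 - 1/q) \<dots> (1 - 1/q^r)\<close> this is the stated value.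
\<close>

(* The dollar sign and the dot denote entries and scalar products of vectors of variable length. *)
unbundle no vec_syntax
unbundle no inner_syntax

section \<open>Arithmetic of the p-adic integers\<close>

lemma padic_nth_of_nat: "padic_nth (of_nat m :: 'p :: prime_card padic_int) k = int m mod int CARD('p) ^ k"
proof (induction m)
  case 0
  then show ?case by (simp add: zero_padic_int.rep_eq)
next
  case (Suc m)
  then show ?case by (simp add: plus_padic_int.rep_eq one_padic_int.rep_eq mod_simps)
qed

lemma padic_nth_p_power:
  "padic_nth (of_nat CARD('p) ^ l :: 'p :: prime_card padic_int) k = int CARD('p) ^ l mod int CARD('p) ^ k"
  using padic_nth_of_nat[of "CARD('p) ^ l" k, where 'p = 'p] by simp

lemma padic_nth_range: "0 \<le> padic_nth x k" "padic_nth (x :: 'p :: prime_card padic_int) k < int CARD('p) ^ k"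
  using padic_nth[of x] by auto

lemma padic_nth_Suc_mod: "padic_nth (x :: 'p :: prime_card padic_int) (Suc k) mod int CARD('p) ^ k = padic_nth x k"
  using padic_nth[of x] by auto

lemma padic_nth_mod:
  "k \<le> l \<Longrightarrow> padic_nth (x :: 'p :: prime_card padic_int) l mod int CARD('p) ^ k = padic_nth x k"
proof (induction l rule: dec_induct)
  case base
  then show ?case using padic_nth_range[of x k] by simp
next
  case (step l)
  have "padic_nth x (Suc l) mod int CARD('p) ^ k = padic_nth x (Suc l) mod int CARD('p) ^ l mod int CARD('p) ^ k"
    using step by (simp add: mod_mod_cancel le_imp_power_dvd)
  then show ?case using step by (simp add: padic_nth_Suc_mod)
qed

text \<open>
  The valuation is read off from the residues, because division by \<open>p^k\<close> shifts the sequence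
  of residues by \<open>k\<close> places.
\<close>

lemma p_power_dvd_iff: "of_nat CARD('p) ^ k dvd (x :: 'p :: prime_card padic_int) \<longleftrightarrow> padic_nth x k = 0"
proof
  assume "of_nat CARD('p) ^ k dvd x"
  then obtain y where "x = of_nat CARD('p) ^ k * y" by auto
  then show "padic_nth x k = 0"
    by (simp add: times_padic_int.rep_eq padic_nth_p_power)
next
  assume 0: "padic_nth x k = 0"
  define p where "p = int CARD('p)"
  have p0: "p > 0" unfolding p_def using CARD_prime_power_pos[where 'p='p, of 1] by simp
  define y where "y = (\<lambda>i. padic_nth x (i + k) div p ^ k)"
  have dv: "p ^ k dvd padic_nth x (i + k)" for i
    using padic_nth_mod[of k "i + k" x] 0 by (simp add: p_def dvd_eq_mod_eq_0)
  have yk: "padic_nth x (i + k) = p ^ k * y i" for i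
    using dv[of i] by (simp add: y_def)
  have y1: "y i \<in> {0..<p ^ i}" for i
  proof -
    have "0 \<le> p ^ k * y i" "p ^ k * y i < p ^ k * p ^ i"
      using padic_nth_range[of x "i + k", folded p_def] unfolding yk by (simp_all add: power_add mult.commute)
    then show ?thesis using p0 by (auto simp: zero_le_mult_iff mult_less_cancel_left)
  qed
  have y2: "y (Suc i) mod p ^ i = y i" for i
  proof -
    have "(p ^ k * y (Suc i)) mod (p ^ k * p ^ i) = p ^ k * y i"
      using padic_nth_mod[of "i + k" "Suc i + k" x, folded p_def] unfolding yk
      by (simp add: power_add mult.commute)
    then show ?thesis using p0 by (simp add: mult_mod_right[symmetric])
  qed
  have mem: "y \<in> {x :: nat \<Rightarrow> int. \<forall>k. x k \<in> {0..<int CARD('p) ^ k} \<and> x (Suc k) mod int CARD('p) ^ k = x k}"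
    using y1 y2 by (simp add: p_def)
  define z where "z = (Abs_padic_int y :: 'p padic_int)"
  have z: "padic_nth z = y" unfolding z_def by (rule Abs_padic_int_inverse[OF mem])
  have "x = of_nat CARD('p) ^ k * z"
  proof (rule padic_nth_inject[THEN iffD1], rule ext)
    fix i
    have "padic_nth (of_nat CARD('p) ^ k * z) i = (p ^ k * y i) mod p ^ i"
      by (simp add: times_padic_int.rep_eq padic_nth_p_power z p_def mod_simps)
    also have "\<dots> = padic_nth x i"
      using padic_nth_mod[of i "i + k" x] by (simp add: yk p_def)
    finally show "padic_nth x i = padic_nth (of_nat CARD('p) ^ k * z) i" by simp
  qed
  then show "of_nat CARD('p) ^ k dvd x" by simp
qed

lemma padic_eqI: "(\<And>k. of_nat CARD('p) ^ k dvd x - y) \<Longrightarrow> (x :: 'p :: prime_card padic_int) = y"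
proof -
  assume "\<And>k. of_nat CARD('p) ^ k dvd x - y"
  then have "x - y = 0"
    by (intro padic_nth_inject[THEN iffD1] ext) (simp add: p_power_dvd_iff zero_padic_int.rep_eq)
  then show ?thesis by simp
qed

lemma p_mult_cancel:
  assumes "of_nat CARD('p) * x = of_nat CARD('p) * (y :: 'p :: prime_card padic_int)"
  shows "x = y"
proof -
  have "padic_nth z k = 0" if z: "of_nat CARD('p) * z = 0" for z :: "'p padic_int" and k
  proof -
    have p0: "int CARD('p) > 0" using CARD_prime_power_pos[where 'p='p, of 1] by simp
    have "padic_nth (of_nat CARD('p) * z) (Suc k) = 0" by (simp add: z zero_padic_int.rep_eq)
    then have "(int CARD('p) * padic_nth z (Suc k)) mod int CARD('p) ^ Suc k = 0"
      by (simp add: times_padic_int.rep_eq padic_nth_of_nat mod_simps del: power_Suc)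
    then have "padic_nth z (Suc k) mod int CARD('p) ^ k = 0"
      using p0 by (simp add: mult_mod_right[symmetric])
    then show ?thesis by (simp add: padic_nth_Suc_mod)
  qed
  from this[of "x - y"] assms have "x - y = 0"
    by (intro padic_nth_inject[THEN iffD1] ext) (simp add: zero_padic_int.rep_eq algebra_simps)
  then show ?thesis by simp
qed

text \<open>
  Later terms do not change a partial sum modulo \<open>p^k\<close>, so the residues of the partial sums
  form a compatible sequence.
\<close>

lemma padic_series:
  fixes a :: "nat \<Rightarrow> 'p :: prime_card padic_int"
  shows "\<exists>x. \<forall>k. of_nat CARD('p) ^ k dvd x - (\<Sum>i<k. of_nat CARD('p) ^ i * a i)"
proof -
  define s where "s = (\<lambda>k. \<Sum>i<k. of_nat CARD('p) ^ i * a i)"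
  define y where "y = (\<lambda>k. padic_nth (s k) k)"
  have dn: "padic_nth u k = padic_nth v k" if "of_nat CARD('p) ^ k dvd u - v" for u v :: "'p padic_int" and k
  proof -
    have "(padic_nth u k - padic_nth v k) mod int CARD('p) ^ k = 0"
      using that by (simp add: p_power_dvd_iff minus_padic_int.rep_eq)
    then have "padic_nth u k mod int CARD('p) ^ k = padic_nth v k mod int CARD('p) ^ k"
      by (simp add: mod_eq_dvd_iff dvd_eq_mod_eq_0)
    then show ?thesis using padic_nth_range[of u k] padic_nth_range[of v k] by simp
  qed
  have step: "padic_nth (s (Suc k)) k = y k" for k
    unfolding y_def by (rule dn) (simp add: s_def)
  have mem: "y \<in> {x :: nat \<Rightarrow> int. \<forall>k. x k \<in> {0..<int CARD('p) ^ k} \<and> x (Suc k) mod int CARD('p) ^ k = x k}"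
    using padic_nth_range step by (auto simp: y_def padic_nth_Suc_mod)
  define x where "x = (Abs_padic_int y :: 'p padic_int)"
  have x: "padic_nth x = y" unfolding x_def by (rule Abs_padic_int_inverse[OF mem])
  have "of_nat CARD('p) ^ k dvd x - s k" for k
    by (simp add: p_power_dvd_iff minus_padic_int.rep_eq x y_def)
  then show ?thesis unfolding s_def by blast
qed

text \<open>
  The inverse is the geometric series. This is the reason why some power of \<open>p\<close> annihilates
  any finite module.
\<close>

lemma one_minus_p_mult_unit: "\<exists>x. (1 - of_nat CARD('p) * c) * x = (1 :: 'p :: prime_card padic_int)"
proof -
  obtain x where x: "\<And>k. of_nat CARD('p) ^ k dvd x - (\<Sum>i<k. of_nat CARD('p) ^ i * c ^ i)"
    using padic_series[of "\<lambda>i. c ^ i"] by blast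
  have "(1 - of_nat CARD('p) * c) * x = 1"
  proof (rule padic_eqI)
    fix k
    define q :: "'p padic_int" where "q = of_nat CARD('p)"
    define s where "s = (\<Sum>i<k. q ^ i * c ^ i)"
    have "(1 - q * c) * s = 1 - (q * c) ^ k"
      using one_diff_power_eq[of "q * c" k] by (simp add: s_def power_mult_distrib)
    then have "(1 - q * c) * x - 1 = (1 - q * c) * (x - s) - q ^ k * c ^ k"
      by (simp add: algebra_simps power_mult_distrib)
    then show "q ^ k dvd (1 - q * c) * x - 1"
      using x[of k] by (simp add: q_def s_def)
  qed
  then show ?thesis by blast
qed

lemma residue_0 [simp]: "residue (0 :: 'p :: prime_card padic_int) = 0"
  by (simp add: residue_def zero_padic_int.rep_eq)

lemma of_int_mod_ring_mod: "of_int_mod_ring (a mod int CARD('p)) = (of_int_mod_ring a :: 'p :: prime_card mod_ring)"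
  by transfer simp

lemma residue_hom:
  fixes x y :: "'p :: prime_card padic_int"
  shows "residue (x + y) = residue x + residue y" "residue (x * y) = residue x * residue y"
    "residue (1 :: 'p padic_int) = 1"
proof -
  show "residue (x + y) = residue x + residue y"
    by (simp add: residue_def plus_padic_int.rep_eq of_int_mod_ring_mod) (transfer, simp add: mod_simps)
  show "residue (x * y) = residue x * residue y"
    by (simp add: residue_def times_padic_int.rep_eq of_int_mod_ring_mod) (transfer, simp add: mod_simps)
  show "residue (1 :: 'p padic_int) = 1"
    by (simp add: residue_def one_padic_int.rep_eq of_int_mod_ring_mod) (transfer, simp)
qed

interpretation residue: comm_ring_hom "residue :: 'p :: prime_card padic_int \<Rightarrow> 'p mod_ring"
  by standard (simp_all add: residue_hom)

lemma residue_eq_0_iff: "residue x = 0 \<longleftrightarrow> of_nat CARD('p) dvd (x :: 'p :: prime_card padic_int)"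
proof -
  have "residue x = 0 \<longleftrightarrow> padic_nth x 1 = 0"
    using padic_nth_range[of x 1] unfolding residue_def by (transfer, simp)
  then show ?thesis using p_power_dvd_iff[of 1 x] by simp
qed

lemma residue_of_nat [simp]: "residue (of_nat m :: 'p :: prime_card padic_int) = of_nat m"
  by (induction m) (simp_all add: residue_hom)

definition lift_res :: "'p :: prime_card mod_ring \<Rightarrow> 'p padic_int" where
  "lift_res c = of_nat (nat (to_int_mod_ring c))"

lemma residue_lift_res [simp]: "residue (lift_res c) = c"
proof -
  have "residue (lift_res c) = of_nat (nat (to_int_mod_ring c))"
    by (simp add: lift_res_def)
  also have "\<dots> = of_int_mod_ring (to_int_mod_ring c)"
    using rangeI[of to_int_mod_ring c] unfolding range_to_int_mod_ring
    by (simp add: of_nat_of_int_mod_ring)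
  finally show ?thesis by simp
qed

section \<open>Polynomials in a matrix\<close>

lemma poly_mat_carrier [simp]: "X \<in> carrier_mat n n \<Longrightarrow> poly_mat f X \<in> carrier_mat n n"
  by (simp add: poly_mat_def)

lemma dim_poly_mat [simp]: "dim_row (poly_mat f X) = dim_row X" "dim_col (poly_mat f X) = dim_row X"
  by (simp_all add: poly_mat_def)

lemma mat_vec_smult:
  assumes A: "(A :: 'a :: comm_ring_1 mat) \<in> carrier_mat n m" and v: "v \<in> carrier_vec m"
  shows "A *\<^sub>v (a \<cdot>\<^sub>v v) = a \<cdot>\<^sub>v (A *\<^sub>v v)"
  using assms by (intro eq_vecI) (auto simp: scalar_prod_def sum_distrib_left ac_simps)

lemma zero_mat_vec: "v \<in> carrier_vec m \<Longrightarrow> 0\<^sub>m n m *\<^sub>v (v :: 'a :: comm_ring_1 vec) = 0\<^sub>v n"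
  by (intro eq_vecI) (auto simp: scalar_prod_def)

lemma mat_vec_zero: "A \<in> carrier_mat n m \<Longrightarrow> A *\<^sub>v 0\<^sub>v m = (0\<^sub>v n :: 'a :: comm_ring_1 vec)"
  by (intro eq_vecI) (auto simp: scalar_prod_def)

lemma smult_zero_vec_left: "v \<in> carrier_vec n \<Longrightarrow> (0 :: 'a :: comm_ring_1) \<cdot>\<^sub>v v = 0\<^sub>v n"
  by (intro eq_vecI) auto

lemma smult_zero_vec_right: "a \<cdot>\<^sub>v 0\<^sub>v n = (0\<^sub>v n :: 'a :: comm_ring_1 vec)"
  by (intro eq_vecI) auto

lemma poly_mat_index:
  assumes X: "X \<in> carrier_mat n n" and ij: "i < n" "j < n" and N: "degree f \<le> N"
  shows "poly_mat f X $$ (i, j) = (\<Sum>k\<le>N. poly.coeff f k * (X ^\<^sub>m k) $$ (i, j))"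
proof -
  have "(\<Sum>k\<le>degree f. poly.coeff f k * (X ^\<^sub>m k) $$ (i, j)) = (\<Sum>k\<le>N. poly.coeff f k * (X ^\<^sub>m k) $$ (i, j))"
    using N by (intro sum.mono_neutral_left) (auto simp: coeff_eq_0)
  then show ?thesis using X ij by (simp add: poly_mat_def)
qed

lemma poly_mat_0: "X \<in> carrier_mat n n \<Longrightarrow> poly_mat 0 X = 0\<^sub>m n n"
  by (intro eq_matI) (auto simp: poly_mat_def)

lemma poly_mat_add:
  assumes X: "X \<in> carrier_mat n n"
  shows "poly_mat (f + g) X = poly_mat f X + poly_mat g X"
proof (rule eq_matI)
  fix i j assume "i < dim_row (poly_mat f X + poly_mat g X)" "j < dim_col (poly_mat f X + poly_mat g X)"
  then have ij: "i < n" "j < n" using X poly_mat_carrier[OF X] by auto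
  let ?N = "max (degree f) (degree g)"
  have "poly_mat (f + g) X $$ (i, j) = (\<Sum>k\<le>?N. poly.coeff (f + g) k * (X ^\<^sub>m k) $$ (i, j))"
    by (rule poly_mat_index[OF X ij]) (rule degree_add_le_max)
  also have "\<dots> = poly_mat f X $$ (i, j) + poly_mat g X $$ (i, j)"
    by (simp add: poly_mat_index[OF X ij, of _ ?N] distrib_right sum.distrib)
  finally show "poly_mat (f + g) X $$ (i, j) = (poly_mat f X + poly_mat g X) $$ (i, j)"
    using ij X poly_mat_carrier[OF X, of g] by simp
qed (use X poly_mat_carrier[OF X] in auto)

lemma poly_mat_pCons_right:
  assumes X: "X \<in> carrier_mat n n"
  shows "poly_mat (pCons a f) X = a \<cdot>\<^sub>m 1\<^sub>m n + poly_mat f X * X"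
proof (rule eq_matI)
  have c: "poly_mat f X \<in> carrier_mat n n" using X by simp
  fix i j assume "i < dim_row (a \<cdot>\<^sub>m 1\<^sub>m n + poly_mat f X * X)" "j < dim_col (a \<cdot>\<^sub>m 1\<^sub>m n + poly_mat f X * X)"
  then have ij: "i < n" "j < n" using X by auto
  have "poly_mat (pCons a f) X $$ (i, j) = (\<Sum>k\<le>Suc (degree f). poly.coeff (pCons a f) k * (X ^\<^sub>m k) $$ (i, j))"
    by (rule poly_mat_index[OF X ij]) (rule degree_pCons_le)
  also have "\<dots> = a * (1\<^sub>m n) $$ (i, j) + (\<Sum>k\<le>degree f. poly.coeff f k * (X ^\<^sub>m k * X) $$ (i, j))"
    using X by (subst sum.atMost_Suc_shift) (simp)
  also have "(\<Sum>k\<le>degree f. poly.coeff f k * (X ^\<^sub>m k * X) $$ (i, j))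
      = (\<Sum>k\<le>degree f. poly.coeff f k * (\<Sum>l<n. (X ^\<^sub>m k) $$ (i, l) * X $$ (l, j)))"
    using X ij by (intro sum.cong refl) (simp add: scalar_prod_def pow_carrier_mat[OF X] lessThan_atLeast0)
  also have "\<dots> = (\<Sum>l<n. (\<Sum>k\<le>degree f. poly.coeff f k * (X ^\<^sub>m k) $$ (i, l)) * X $$ (l, j))"
    by (simp add: sum_distrib_left sum_distrib_right mult.assoc) (rule sum.swap)
  also have "\<dots> = (\<Sum>l<n. poly_mat f X $$ (i, l) * X $$ (l, j))"
    using ij by (intro sum.cong refl) (simp add: poly_mat_index[OF X _ _ order_refl])
  also have "\<dots> = (poly_mat f X * X) $$ (i, j)"
    using X c ij by (simp add: scalar_prod_def lessThan_atLeast0)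
  finally show "poly_mat (pCons a f) X $$ (i, j) = (a \<cdot>\<^sub>m 1\<^sub>m n + poly_mat f X * X) $$ (i, j)"
    using ij X c by simp
qed (use X in auto)

lemma poly_mat_commute:
  assumes X: "X \<in> carrier_mat n n"
  shows "X * poly_mat f X = poly_mat f X * X"
proof (induction f)
  case 0
  then show ?case using X by (simp add: poly_mat_0[OF X])
next
  case (pCons a f)
  have c: "poly_mat f X \<in> carrier_mat n n" using X by simp
  have "X * (a \<cdot>\<^sub>m 1\<^sub>m n) = a \<cdot>\<^sub>m X" using X by (simp add: mult_smult_distrib[OF X one_carrier_mat])
  moreover have "(a \<cdot>\<^sub>m 1\<^sub>m n) * X = a \<cdot>\<^sub>m X" using X by (simp add: mult_smult_assoc_mat[of _ n n _ n])
  moreover have "X * (poly_mat f X * X) = poly_mat f X * X * X"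
    using pCons.IH by (metis X c assoc_mult_mat)
  moreover have m: "a \<cdot>\<^sub>m 1\<^sub>m n \<in> carrier_mat n n" "poly_mat f X * X \<in> carrier_mat n n" using X c by auto
  ultimately show ?case
    unfolding poly_mat_pCons_right[OF X] mult_add_distrib_mat[OF X m] add_mult_distrib_mat[OF m X]
    by simp
qed

text \<open>
  The action of \<open>A[t]\<close> on \<open>A^n\<close> in which \<open>t\<close> acts as \<open>X\<close>.
\<close>

abbreviation pmv :: "'a :: comm_ring_1 poly \<Rightarrow> 'a mat \<Rightarrow> 'a vec \<Rightarrow> 'a vec" where
  "pmv f X v \<equiv> poly_mat f X *\<^sub>v v"

lemma pmv_carrier [simp]: "X \<in> carrier_mat n n \<Longrightarrow> v \<in> carrier_vec n \<Longrightarrow> pmv f X v \<in> carrier_vec n"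
  using poly_mat_carrier mult_mat_vec_carrier by blast

lemma smult_one_mat_vec: "v \<in> carrier_vec n \<Longrightarrow> (a \<cdot>\<^sub>m 1\<^sub>m n) *\<^sub>v v = a \<cdot>\<^sub>v (v :: 'a :: comm_ring_1 vec)"
  by (intro eq_vecI) (auto simp: scalar_prod_def one_mat_def if_distrib[of "\<lambda>x. _ * x"] if_distrib[of "\<lambda>x. x * _"] cong: if_cong)

lemma pmv_pCons:
  assumes X: "X \<in> carrier_mat n n" and v: "v \<in> carrier_vec n"
  shows "pmv (pCons a f) X v = a \<cdot>\<^sub>v v + X *\<^sub>v pmv f X v"
proof -
  have c: "poly_mat f X \<in> carrier_mat n n" using X by simp
  have "pmv (pCons a f) X v = (a \<cdot>\<^sub>m 1\<^sub>m n + X * poly_mat f X) *\<^sub>v v"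
    by (simp add: poly_mat_pCons_right[OF X] poly_mat_commute[OF X])
  also have "\<dots> = (a \<cdot>\<^sub>m 1\<^sub>m n) *\<^sub>v v + (X * poly_mat f X) *\<^sub>v v"
    using X c v by (intro add_mult_distrib_mat_vec) auto
  finally show ?thesis using X c v by (simp add: smult_one_mat_vec assoc_mult_mat_vec[of _ n n])
qed

lemma pmv_0: "X \<in> carrier_mat n n \<Longrightarrow> v \<in> carrier_vec n \<Longrightarrow> pmv 0 X v = 0\<^sub>v n"
  by (simp add: poly_mat_0 zero_mat_vec)

lemma pmv_add_poly:
  assumes "X \<in> carrier_mat n n" "v \<in> carrier_vec n"
  shows "pmv (f + g) X v = pmv f X v + pmv g X v"
  using assms by (simp add: poly_mat_add add_mult_distrib_mat_vec[of _ n n])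

lemma pmv_add:
  assumes "X \<in> carrier_mat n n" "v \<in> carrier_vec n" "w \<in> carrier_vec n"
  shows "pmv f X (v + w) = pmv f X v + pmv f X w"
  using assms by (simp add: mult_add_distrib_mat_vec[of _ n n])

lemma pmv_smult:
  assumes "X \<in> carrier_mat n n" "v \<in> carrier_vec n"
  shows "pmv f X (a \<cdot>\<^sub>v v) = a \<cdot>\<^sub>v pmv f X v"
  using assms mat_vec_smult[of "poly_mat f X" n n v a] by simp

lemma pmv_const: "X \<in> carrier_mat n n \<Longrightarrow> v \<in> carrier_vec n \<Longrightarrow> pmv [:a:] X v = a \<cdot>\<^sub>v v"
  by (simp add: pmv_pCons pmv_0 mat_vec_zero)

lemma pmv_1: "X \<in> carrier_mat n n \<Longrightarrow> v \<in> carrier_vec n \<Longrightarrow> pmv 1 X v = v"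
  using pmv_const[of X n v 1] by (simp add: one_pCons)

lemma pmv_t: "X \<in> carrier_mat n n \<Longrightarrow> v \<in> carrier_vec n \<Longrightarrow> pmv [:0, 1:] X v = X *\<^sub>v v"
  by (subst pmv_pCons) (auto simp: pmv_const)

lemma pmv_smult_poly:
  assumes X: "X \<in> carrier_mat n n" and v: "v \<in> carrier_vec n"
  shows "pmv (Polynomial.smult a f) X v = a \<cdot>\<^sub>v pmv f X v"
proof (induction f)
  case 0
  then show ?case using X v by (simp add: pmv_0 smult_zero_vec_right)
next
  case (pCons b f)
  have c: "pmv f X v \<in> carrier_vec n" "X *\<^sub>v pmv f X v \<in> carrier_vec n"
    using X v by (auto intro: mult_mat_vec_carrier pmv_carrier)
  show ?case
    using X v c pCons.IH
    by (simp add: pmv_pCons mat_vec_smult[OF X] smult_add_distrib_vec[of _ n] smult_smult_assoc)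
qed

lemma pmv_mult:
  assumes X: "X \<in> carrier_mat n n" and v: "v \<in> carrier_vec n"
  shows "pmv (f * g) X v = pmv f X (pmv g X v)"
proof (induction f)
  case 0
  then show ?case using X v by (simp add: pmv_0)
next
  case (pCons a f)
  then show ?case
    using X v mult_mat_vec_carrier[OF X pmv_carrier[OF X pmv_carrier[OF X v]]]
    by (simp add: mult_pCons_left pmv_add_poly pmv_smult_poly pmv_pCons smult_zero_vec_left)
qed

lemma pmv_comm: "X \<in> carrier_mat n n \<Longrightarrow> v \<in> carrier_vec n \<Longrightarrow> pmv f X (pmv g X v) = pmv g X (pmv f X v)"
  by (metis mult.commute pmv_mult)

section \<open>Reduction modulo p\<close>

abbreviation rvec :: "'p :: prime_card padic_int vec \<Rightarrow> 'p mod_ring vec" where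
  "rvec \<equiv> map_vec residue"

abbreviation rmat :: "'p :: prime_card padic_int mat \<Rightarrow> 'p mod_ring mat" where
  "rmat \<equiv> map_mat residue"

interpretation residue_poly: map_poly_comm_ring_hom "residue :: 'p :: prime_card padic_int \<Rightarrow> 'p mod_ring" ..

lemma poly_residue_simps [simp]:
  "poly_residue 0 = 0" "poly_residue 1 = 1"
  "poly_residue (f + g) = poly_residue f + poly_residue g"
  "poly_residue (f - g) = poly_residue f - poly_residue g"
  "poly_residue (f * g) = poly_residue f * poly_residue g"
  "poly_residue (pCons a f) = pCons (residue a) (poly_residue f)"
  unfolding poly_residue_def
  by (simp_all add: hom_distribs)

lemma coeff_poly_residue [simp]: "poly.coeff (poly_residue f) k = residue (poly.coeff f k)"
  by (simp add: poly_residue_def coeff_map_poly)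

definition lift_poly :: "'p :: prime_card mod_ring poly \<Rightarrow> 'p padic_int poly" where
  "lift_poly = map_poly lift_res"

lemma lift_res_0 [simp]: "lift_res 0 = 0"
  by (simp add: lift_res_def)

lemma poly_residue_lift_poly [simp]: "poly_residue (lift_poly f) = f"
  by (rule poly_eqI) (simp add: lift_poly_def coeff_map_poly)

lemma rvec_pmv:
  assumes X: "X \<in> carrier_mat n n" and v: "v \<in> carrier_vec n"
  shows "rvec (pmv f X v) = pmv (poly_residue f) (rmat X) (rvec v)"
proof (induction f)
  case 0
  then show ?case using X v by (simp add: pmv_0[of _ n] residue.vec_hom_zero)
next
  case (pCons a f)
  have c: "pmv f X v \<in> carrier_vec n" "X *\<^sub>v pmv f X v \<in> carrier_vec n"
    using X v by (auto intro: mult_mat_vec_carrier pmv_carrier)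
  have s: "rvec (u + w) = rvec u + rvec w" if "u \<in> carrier_vec n" "w \<in> carrier_vec n" for u w
    using that by (intro eq_vecI) (auto simp: residue_hom)
  have m: "rvec (a \<cdot>\<^sub>v v) = residue a \<cdot>\<^sub>v rvec v"
    by (intro eq_vecI) (auto simp: residue_hom)
  show ?case using X v c pCons.IH
    by (simp add: pmv_pCons[of _ n] s m residue.mult_mat_vec_hom[OF X])
qed

lemma rvec_eq_0_iff:
  assumes v: "v \<in> carrier_vec n"
  shows "rvec v = 0\<^sub>v n \<longleftrightarrow> (\<exists>w \<in> carrier_vec n. v = of_nat CARD('p) \<cdot>\<^sub>v (w :: 'p :: prime_card padic_int vec))"
proof
  assume 0: "rvec v = 0\<^sub>v n"
  have "\<exists>y. v $ i = of_nat CARD('p) * y" if "i < n" for i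
    using arg_cong[OF 0, of "\<lambda>u. u $ i"] that v by (auto simp: residue_eq_0_iff)
  then obtain y where y: "\<And>i. i < n \<Longrightarrow> v $ i = of_nat CARD('p) * y i" by metis
  show "\<exists>w \<in> carrier_vec n. v = of_nat CARD('p) \<cdot>\<^sub>v w"
    by (rule bexI[of _ "vec n y"]) (use v y in \<open>auto intro!: eq_vecI\<close>)
next
  assume "\<exists>w \<in> carrier_vec n. v = of_nat CARD('p) \<cdot>\<^sub>v w"
  then show "rvec v = 0\<^sub>v n" by (auto intro!: eq_vecI simp: residue_eq_0_iff)
qed

lemma rvec_eq_iff:
  assumes v: "v \<in> carrier_vec n" "v' \<in> carrier_vec n"
  shows "rvec v = rvec v' \<longleftrightarrow> (\<exists>w \<in> carrier_vec n. v = v' + of_nat CARD('p) \<cdot>\<^sub>v (w :: 'p :: prime_card padic_int vec))"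
proof -
  have "rvec v = rvec v' \<longleftrightarrow> rvec (v - v') = 0\<^sub>v n"
    using v by (auto simp: vec_eq_iff hom_distribs)
  also have "\<dots> \<longleftrightarrow> (\<exists>w \<in> carrier_vec n. v - v' = of_nat CARD('p) \<cdot>\<^sub>v w)"
    using v by (intro rvec_eq_0_iff) auto
  also have "\<dots> \<longleftrightarrow> (\<exists>w \<in> carrier_vec n. v = v' + of_nat CARD('p) \<cdot>\<^sub>v w)"
  proof (intro bex_cong refl)
    fix w :: "'p padic_int vec" assume w: "w \<in> carrier_vec n"
    show "v - v' = of_nat CARD('p) \<cdot>\<^sub>v w \<longleftrightarrow> v = v' + of_nat CARD('p) \<cdot>\<^sub>v w"
      using v w by (auto simp: vec_eq_iff algebra_simps)
  qed
  finally show ?thesis .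
qed

lemma rvec_lift: "v \<in> carrier_vec n \<Longrightarrow> rvec (map_vec lift_res v) = v"
  by (intro eq_vecI) auto

lemma smult_p_vec_cancel:
  fixes v w :: "'p :: prime_card padic_int vec"
  assumes "v \<in> carrier_vec n" "w \<in> carrier_vec n"
    "of_nat CARD('p) \<cdot>\<^sub>v v = of_nat CARD('p) \<cdot>\<^sub>v w"
  shows "v = w"
proof (rule eq_vecI)
  fix i assume "i < dim_vec w"
  then show "v $ i = w $ i"
    using assms(1,2) arg_cong[OF assms(3), of "\<lambda>u. u $ i"] by (auto dest: p_mult_cancel)
qed (use assms in auto)

lemma vec_series:
  fixes w :: "nat \<Rightarrow> 'p :: prime_card padic_int vec"
  assumes "\<And>i. w i \<in> carrier_vec n"
  shows "\<exists>u \<in> carrier_vec n. \<forall>k. \<forall>j<n. of_nat CARD('p) ^ k dvd u $ j - (\<Sum>i<k. of_nat CARD('p) ^ i * w i $ j)"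
proof -
  have "\<forall>j. \<exists>x. \<forall>k. of_nat CARD('p) ^ k dvd x - (\<Sum>i<k. of_nat CARD('p) ^ i * w i $ j)"
    by (intro allI padic_series)
  then obtain x where "\<And>j k. of_nat CARD('p) ^ k dvd x j - (\<Sum>i<k. of_nat CARD('p) ^ i * w i $ j)"
    by metis
  then show ?thesis by (intro bexI[of _ "vec n x"]) auto
qed

text \<open>
  A form of Nakayama's lemma that needs no finite generation: iterating the hypothesis expands
  \<open>v\<close> into a \<open>p\<close>-adically convergent series of elements of the image of \<open>A\<close>, and the series of
  their preimages converges to a preimage of \<open>v\<close>.
\<close>

lemma matrix_nakayama:
  fixes A :: "'p :: prime_card padic_int mat"
  assumes A: "A \<in> carrier_mat n n" and K: "K \<subseteq> carrier_vec n"
    and step: "\<And>v. v \<in> K \<Longrightarrow> \<exists>w \<in> carrier_vec n. \<exists>v' \<in> K. v = A *\<^sub>v w + of_nat CARD('p) \<cdot>\<^sub>v v'"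
    and v: "v \<in> K"
  shows "\<exists>u \<in> carrier_vec n. v = A *\<^sub>v u"
proof -
  define q :: "'p padic_int" where "q = of_nat CARD('p)"
  obtain W V where WV: "\<And>v. v \<in> K \<Longrightarrow> W v \<in> carrier_vec n \<and> V v \<in> K \<and> v = A *\<^sub>v W v + q \<cdot>\<^sub>v V v"
    using step unfolding q_def by metis
  define vs where "vs = (\<lambda>i. (V ^^ i) v)"
  have vsK: "vs i \<in> K" for i
    by (induction i) (use v WV in \<open>auto simp: vs_def\<close>)
  define w where "w = (\<lambda>i. W (vs i))"
  have wc: "w i \<in> carrier_vec n" for i using vsK WV by (auto simp: w_def)
  have vc: "vs i \<in> carrier_vec n" for i using vsK K by auto
  have rec: "vs i = A *\<^sub>v w i + q \<cdot>\<^sub>v vs (Suc i)" for i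
    using WV[OF vsK[of i]] by (simp add: w_def vs_def)
  obtain u where u: "u \<in> carrier_vec n"
    and uk: "\<And>k j. j < n \<Longrightarrow> q ^ k dvd u $ j - (\<Sum>i<k. q ^ i * w i $ j)"
    using vec_series[of w n, OF wc] unfolding q_def by blast
  have Ai: "(A *\<^sub>v x) $ j = (\<Sum>l<n. A $$ (j, l) * x $ l)" if "x \<in> carrier_vec n" "j < n" for x j
    using A that by (simp add: scalar_prod_def lessThan_atLeast0)
  (* The expansion of v after k iterations, with its remainder. *)
  have ex: "v $ j = (\<Sum>i<k. q ^ i * (A *\<^sub>v w i) $ j) + q ^ k * vs k $ j" if j: "j < n" for j k
  proof (induction k)
    case 0
    then show ?case by (simp add: vs_def)
  next
    case (Suc k)
    have "vs k $ j = (A *\<^sub>v w k) $ j + q * vs (Suc k) $ j"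
      using arg_cong[OF rec[of k], of "\<lambda>x. x $ j"] j A wc[of k] vc[of "Suc k"] by simp
    then show ?case using Suc by (simp add: algebra_simps)
  qed
  have "v = A *\<^sub>v u"
  proof (rule eq_vecI)
    fix j assume "j < dim_vec (A *\<^sub>v u)"
    then have j: "j < n" using A by simp
    show "v $ j = (A *\<^sub>v u) $ j"
    proof (rule padic_eqI)
      fix k
      have "v $ j - (A *\<^sub>v u) $ j = q ^ k * vs k $ j - (\<Sum>l<n. A $$ (j, l) * (u $ l - (\<Sum>i<k. q ^ i * w i $ l)))"
      proof -
        have "(\<Sum>i<k. q ^ i * (A *\<^sub>v w i) $ j) = (\<Sum>i<k. \<Sum>l<n. A $$ (j, l) * (q ^ i * w i $ l))"
          using wc j by (simp add: Ai sum_distrib_left algebra_simps)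
        also have "\<dots> = (\<Sum>l<n. A $$ (j, l) * (\<Sum>i<k. q ^ i * w i $ l))"
          by (subst sum.swap) (simp add: sum_distrib_left)
        finally show ?thesis
          unfolding ex[OF j, of k] Ai[OF u j] by (simp add: right_diff_distrib sum_subtractf)
      qed
      then show "of_nat CARD('p) ^ k dvd v $ j - (A *\<^sub>v u) $ j"
        using uk unfolding q_def[symmetric] by (simp only:) (rule dvd_diff[OF dvd_triv_left dvd_sum], rule dvd_mult, rule uk, simp)
    qed
  qed (use A u K v in auto)
  then show ?thesis using u by blast
qed

section \<open>The ring A[t]/(P)\<close>

definition pcls :: "'a :: comm_ring_1 poly \<Rightarrow> 'a poly \<Rightarrow> 'a poly set" where
  "pcls P f = {g. P dvd g - f}"

lemma pcls_eq_iff: "pcls P f = pcls P g \<longleftrightarrow> P dvd f - g"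
proof
  assume "pcls P f = pcls P g"
  then have "f \<in> pcls P g" by (auto simp: pcls_def)
  then show "P dvd f - g" by (simp add: pcls_def)
next
  assume d: "P dvd f - g"
  have "P dvd h - f \<longleftrightarrow> P dvd h - g" for h
  proof -
    have "h - g = (h - f) + (f - g)" by simp
    then show ?thesis using d by (metis dvd_add_left_iff)
  qed
  then show "pcls P f = pcls P g" by (simp add: pcls_def)
qed

lemma mem_pcls [simp]: "g \<in> pcls P f \<longleftrightarrow> pcls P g = pcls P f"
  by (simp add: pcls_eq_iff) (simp add: pcls_def)

lemma PIdl_rcoset: "PIdl\<^bsub>class_ring\<^esub> P +>\<^bsub>class_ring\<^esub> f = pcls P f"
  unfolding cgenideal_def a_r_coset_def' pcls_def
proof (rule Set.set_eqI, rule iffI)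
  fix g assume "g \<in> {g. P dvd g - f}"
  then obtain k where "g - f = P * k" by auto
  then have "g = k * P + f" by (simp add: algebra_simps)
  then show "g \<in> (\<Union>h\<in>{x \<otimes>\<^bsub>class_ring\<^esub> P |x. x \<in> carrier class_ring}. {h \<oplus>\<^bsub>class_ring\<^esub> f})"
    by auto
qed (auto simp: algebra_simps)

lemma poly_quot_ideal: "ideal (PIdl\<^bsub>class_ring\<^esub> P) (class_ring :: 'a :: comm_ring_1 poly ring)"
  by (rule cring.cgenideal_ideal) (auto intro: class_cring.is_cring simp: class_ring_simps)

lemma cring_poly_quot: "cring (poly_quot P)"
  unfolding poly_quot_def by (rule ideal.quotient_is_cring[OF poly_quot_ideal class_cring.is_cring])

lemma carrier_poly_quot: "carrier (poly_quot P) = range (pcls P)"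
  unfolding poly_quot_def FactRing_def A_RCOSETS_def' by (auto simp: PIdl_rcoset)

lemma pcls_carrier [simp]: "pcls P f \<in> carrier (poly_quot P)"
  by (simp add: carrier_poly_quot)

lemma poly_quot_simps [simp]:
  "pcls P f \<oplus>\<^bsub>poly_quot P\<^esub> pcls P g = pcls P (f + g)"
  "pcls P f \<otimes>\<^bsub>poly_quot P\<^esub> pcls P g = pcls P (f * g)"
  "\<one>\<^bsub>poly_quot P\<^esub> = pcls P 1"
  "\<zero>\<^bsub>poly_quot P\<^esub> = pcls P 0"
proof -
  note h = ideal.rcos_ring_hom[OF poly_quot_ideal[of P], folded poly_quot_def]
  show "pcls P f \<oplus>\<^bsub>poly_quot P\<^esub> pcls P g = pcls P (f + g)"
    using ring_hom_add[OF h, of f g] by (simp add: PIdl_rcoset)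
  show "pcls P f \<otimes>\<^bsub>poly_quot P\<^esub> pcls P g = pcls P (f * g)"
    using ring_hom_mult[OF h, of f g] by (simp add: PIdl_rcoset)
  show "\<one>\<^bsub>poly_quot P\<^esub> = pcls P 1"
    using ring_hom_one[OF h] by (simp add: PIdl_rcoset)
  have "\<zero>\<^bsub>poly_quot P\<^esub> = PIdl\<^bsub>class_ring\<^esub> P"
    by (simp add: poly_quot_def FactRing_def)
  also have "\<dots> = pcls P 0" by (auto simp: cgenideal_def mem_pcls pcls_eq_iff) (simp add: dvd_def mult.commute)
  finally show "\<zero>\<^bsub>poly_quot P\<^esub> = pcls P 0" .
qed

lemma poly_quot_residue_rep:
  assumes "c \<in> carrier (poly_quot Q)"
  obtains f :: "'p :: prime_card padic_int poly" where "c = pcls Q (poly_residue f)"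
proof -
  obtain g where "c = pcls Q g" using assms by (auto simp: carrier_poly_quot)
  then show ?thesis using that[of "lift_poly g"] by simp
qed

text \<open>
  Lift the quotient by \<open>P\<close> arbitrarily; the error vanishes modulo \<open>p\<close>, so all its coefficients
  are multiples of \<open>p\<close>.
\<close>

lemma lift_poly_dvd:
  assumes "poly_residue P dvd poly_residue f"
  shows "\<exists>g h. f = P * g + Polynomial.smult (of_nat CARD('p)) (h :: 'p :: prime_card padic_int poly)"
proof -
  obtain g where "poly_residue f = poly_residue P * g" using assms by (rule dvdE)
  then have 0: "poly_residue (f - P * lift_poly g) = 0" by simp
  define d where "d = f - P * lift_poly g"
  have "\<exists>y. poly.coeff d k = of_nat CARD('p) * y" for k
  proof -
    have "residue (poly.coeff d k) = poly.coeff (poly_residue d) k" by simp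
    also have "\<dots> = 0" using 0 by (simp only: d_def coeff_0)
    finally show ?thesis by (auto simp: residue_eq_0_iff elim: dvdE)
  qed
  then obtain y where y: "\<And>k. poly.coeff d k = of_nat CARD('p) * y k" by metis
  define h where "h = (\<Sum>k\<le>degree d. Polynomial.monom (y k) k)"
  have "d = (\<Sum>k\<le>degree d. Polynomial.monom (poly.coeff d k) k)" by (simp add: poly_as_sum_of_monoms)
  also have "\<dots> = Polynomial.smult (of_nat CARD('p)) h"
    unfolding h_def y smult_sum2 by (simp add: smult_monom)
  finally show ?thesis by (intro exI[of _ "lift_poly g"] exI[of _ h]) (simp add: d_def algebra_simps)
qed

text \<open>
  The image of a coset is a full coset because every multiple of the reduction of \<open>P\<close> lifts to
  a multiple of \<open>P\<close>.
\<close>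

lemma quot_residue_pcls:
  fixes P :: "'p :: prime_card padic_int poly"
  shows "quot_residue (pcls P f) = pcls (poly_residue P) (poly_residue f)"
proof (rule equalityI; rule subsetI)
  fix g assume "g \<in> quot_residue (pcls P f)"
  then obtain h where "P dvd h - f" "g = poly_residue h" by (auto simp: quot_residue_def pcls_eq_iff)
  then show "g \<in> pcls (poly_residue P) (poly_residue f)"
    by (auto simp: pcls_eq_iff simp flip: poly_residue_simps(4) elim!: dvdE)
next
  fix g assume "g \<in> pcls (poly_residue P) (poly_residue f)"
  then obtain k where k: "g - poly_residue f = poly_residue P * k"
    unfolding mem_pcls pcls_eq_iff by (rule dvdE)
  have "g = poly_residue (f + P * lift_poly k)" using k by (simp add: algebra_simps)
  moreover have "f + P * lift_poly k \<in> pcls P f" by (simp add: pcls_eq_iff)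
  ultimately show "g \<in> quot_residue (pcls P f)" unfolding quot_residue_def by blast
qed

lemma field_poly_quot:
  fixes Q :: "'p :: prime_card mod_ring poly"
  assumes irr: "Factorial_Ring.irreducible Q"
  shows "field (poly_quot Q)"
proof -
  interpret cring "poly_quot Q" by (rule cring_poly_quot)
  have nu: "\<not> Q dvd 1" using irr by (rule irreducible_not_unit)
  show ?thesis
  proof (rule cring_fieldI2)
    show "\<zero>\<^bsub>poly_quot Q\<^esub> \<noteq> \<one>\<^bsub>poly_quot Q\<^esub>"
      using nu by (auto simp: pcls_eq_iff)
    fix a assume "a \<in> carrier (poly_quot Q)" and a0: "a \<noteq> \<zero>\<^bsub>poly_quot Q\<^esub>"
    then obtain f where f: "a = pcls Q f" by (auto simp: carrier_poly_quot)
    then have "\<not> Q dvd f" using a0 by (simp add: pcls_eq_iff)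
    then have "coprime Q f" using irr by (simp add: irreducible_imp_prime_elem prime_elem_imp_coprime)
    then obtain u v where "u * Q + v * f = 1" by (metis bezout_coefficients_fst_snd coprime_imp_gcd_eq_1)
    then have "1 - v * f = Q * u" by (simp add: algebra_simps)
    then have "pcls Q f \<otimes>\<^bsub>poly_quot Q\<^esub> pcls Q v = \<one>\<^bsub>poly_quot Q\<^esub>"
      by (simp add: pcls_eq_iff dvd_def) (metis minus_diff_eq mult_minus_right mult.commute)
    then show "\<exists>b\<in>carrier (poly_quot Q). a \<otimes>\<^bsub>poly_quot Q\<^esub> b = \<one>\<^bsub>poly_quot Q\<^esub>"
      unfolding f using pcls_carrier by blast
  qed
qed

lemma card_polys_degree_less:
  "card {f :: 'a :: {finite, comm_ring_1} poly. \<forall>k\<ge>d. poly.coeff f k = 0} = CARD('a) ^ d"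
proof -
  have "bij_betw (\<lambda>f. restrict (poly.coeff f) {..<d})
    {f :: 'a poly. \<forall>k\<ge>d. poly.coeff f k = 0} ({..<d} \<rightarrow>\<^sub>E (UNIV :: 'a set))"
  proof (rule bij_betwI')
    fix f g :: "'a poly"
    assume "f \<in> {f. \<forall>k\<ge>d. poly.coeff f k = 0}" "g \<in> {f. \<forall>k\<ge>d. poly.coeff f k = 0}"
    then show "(restrict (poly.coeff f) {..<d} = restrict (poly.coeff g) {..<d}) = (f = g)"
      by (auto simp: poly_eq_iff restrict_def fun_eq_iff) (metis lessThan_iff not_less)
  next
    fix h :: "nat \<Rightarrow> 'a" assume h: "h \<in> {..<d} \<rightarrow>\<^sub>E UNIV"
    define f where "f = (\<Sum>k<d. Polynomial.monom (h k) k)"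
    have c: "poly.coeff f k = (if k < d then h k else 0)" for k
      by (simp add: f_def coeff_sum)
    show "\<exists>f\<in>{f. \<forall>k\<ge>d. poly.coeff f k = 0}. h = restrict (poly.coeff f) {..<d}"
      by (rule bexI[of _ f]) (use h in \<open>auto simp: c PiE_def extensional_def restrict_def fun_eq_iff\<close>)
  qed auto
  then show ?thesis by (simp add: bij_betw_same_card card_PiE)
qed

lemma card_poly_quot:
  fixes Q :: "'p :: prime_card mod_ring poly"
  assumes d: "degree Q = d" "d > 0"
  shows "card (carrier (poly_quot Q)) = CARD('p) ^ d"
proof -
  have Q0: "Q \<noteq> 0" using d by auto
  have "bij_betw (pcls Q) {f. \<forall>k\<ge>d. poly.coeff f k = 0} (carrier (poly_quot Q))"
  proof (rule bij_betwI')
    fix f g :: "'p mod_ring poly"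
    assume "f \<in> {f. \<forall>k\<ge>d. poly.coeff f k = 0}" "g \<in> {f. \<forall>k\<ge>d. poly.coeff f k = 0}"
    then have z: "\<forall>k\<ge>d. poly.coeff (f - g) k = 0" by auto
    show "(pcls Q f = pcls Q g) = (f = g)"
    proof
      assume "pcls Q f = pcls Q g"
      then have "Q dvd f - g" by (simp add: pcls_eq_iff)
      then have "f - g = 0"
        using dvd_imp_degree_le[of Q "f - g"] z d by (metis leading_coeff_0_iff)
      then show "f = g" by simp
    qed simp
  next
    fix F assume "F \<in> carrier (poly_quot Q)"
    then obtain f where f: "F = pcls Q f" by (auto simp: carrier_poly_quot)
    have "degree (f mod Q) < d \<or> f mod Q = 0" using degree_mod_less[OF Q0, of f] d by auto
    then have "\<forall>k\<ge>d. poly.coeff (f mod Q) k = 0" by (auto simp: coeff_eq_0)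
    moreover have "F = pcls Q (f mod Q)" unfolding f pcls_eq_iff by (simp add: minus_mod_eq_mult_div)
    ultimately show "\<exists>g\<in>{f. \<forall>k\<ge>d. poly.coeff f k = 0}. F = pcls Q g" by blast
  qed auto
  then have "card (carrier (poly_quot Q)) = card {f :: 'p mod_ring poly. \<forall>k\<ge>d. poly.coeff f k = 0}"
    by (simp add: bij_betw_same_card)
  then show ?thesis by (simp add: card_polys_degree_less)
qed

lemma finite_poly_quot:
  fixes Q :: "'p :: prime_card mod_ring poly"
  assumes "degree Q > 0"
  shows "finite (carrier (poly_quot Q))"
  using card_poly_quot[OF refl assms] by (metis card.infinite card_ge_0_finite zero_less_card_finite zero_less_power)

section \<open>Counting linear maps between finite vector spaces\<close>

locale finite_space = K: field K + V: Module.module K V for K (structure) and V (structure) +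
  assumes finK: "finite (carrier K)" and finV: "finite (carrier V)"
begin

text \<open>
  The subspace spanned by \<open>U\<close> and \<open>e\<close>.
\<close>

definition ext :: "'c set \<Rightarrow> 'c \<Rightarrow> 'c set" where
  "ext U e = (\<lambda>(u, c). u \<oplus>\<^bsub>V\<^esub> c \<odot>\<^bsub>V\<^esub> e) ` (U \<times> carrier K)"

lemma ext_memI: "u \<in> U \<Longrightarrow> c \<in> carrier K \<Longrightarrow> u \<oplus>\<^bsub>V\<^esub> c \<odot>\<^bsub>V\<^esub> e \<in> ext U e"
  unfolding ext_def by force

lemma submodule_minus_closed:
  assumes U: "submodule K U V" and xy: "x \<in> U" "y \<in> U"
  shows "x \<ominus>\<^bsub>V\<^esub> y \<in> U"
proof -
  have c: "x \<in> carrier V" "y \<in> carrier V" using U xy by (auto simp: submodule_def)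
  have "(\<ominus> \<one>) \<odot>\<^bsub>V\<^esub> y \<in> U" using U xy by (auto simp: submodule_def)
  then have "\<ominus>\<^bsub>V\<^esub> y \<in> U" using c by (simp add: V.smult_l_minus)
  then show ?thesis using U xy by (simp add: a_minus_def submodule_def)
qed

lemma ext_unique:
  assumes U: "submodule K U V" and e: "e \<in> carrier V" "e \<notin> U"
    and u: "u \<in> U" "u' \<in> U" and c: "c \<in> carrier K" "c' \<in> carrier K"
    and eq: "u \<oplus>\<^bsub>V\<^esub> c \<odot>\<^bsub>V\<^esub> e = u' \<oplus>\<^bsub>V\<^esub> c' \<odot>\<^bsub>V\<^esub> e"
  shows "u = u' \<and> c = c'"
proof -
  have uc: "u \<in> carrier V" "u' \<in> carrier V" using U u by (auto simp: submodule_def)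
  have ce: "c \<odot>\<^bsub>V\<^esub> e \<in> carrier V" "c' \<odot>\<^bsub>V\<^esub> e \<in> carrier V" using c e by auto
  have cc: "c = c'"
  proof (rule ccontr)
    assume ne: "c \<noteq> c'"
    define d where "d = c \<ominus> c'"
    have d: "d \<in> carrier K" "d \<noteq> \<zero>" using c ne by (auto simp: d_def)
    have "d \<odot>\<^bsub>V\<^esub> e = c \<odot>\<^bsub>V\<^esub> e \<ominus>\<^bsub>V\<^esub> c' \<odot>\<^bsub>V\<^esub> e"
      using c e by (simp add: d_def a_minus_def V.smult_l_distr V.smult_l_minus)
    also have "\<dots> = u' \<ominus>\<^bsub>V\<^esub> u"
    proof -
      have "c \<odot>\<^bsub>V\<^esub> e = \<ominus>\<^bsub>V\<^esub> u \<oplus>\<^bsub>V\<^esub> (u \<oplus>\<^bsub>V\<^esub> c \<odot>\<^bsub>V\<^esub> e)"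
        using uc ce by (simp add: V.M.r_neg1)
      also have "\<dots> = (u' \<ominus>\<^bsub>V\<^esub> u) \<oplus>\<^bsub>V\<^esub> c' \<odot>\<^bsub>V\<^esub> e"
        using uc ce by (simp add: eq a_minus_def V.M.a_ac)
      finally show ?thesis using uc ce by (simp add: a_minus_def V.M.a_assoc V.M.r_neg)
    qed
    finally have "d \<odot>\<^bsub>V\<^esub> e \<in> U" using submodule_minus_closed[OF U] u by simp
    then have "inv d \<odot>\<^bsub>V\<^esub> (d \<odot>\<^bsub>V\<^esub> e) \<in> U"
      using U d K.field_Units by (auto simp: submodule_def)
    moreover have "inv d \<odot>\<^bsub>V\<^esub> (d \<odot>\<^bsub>V\<^esub> e) = e"
      using d K.field_Units e by (simp add: V.smult_assoc1[symmetric])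
    ultimately show False using e by simp
  qed
  then show ?thesis using eq uc ce by (simp add: V.M.add.right_cancel)
qed

lemma ext_inj:
  assumes "submodule K U V" "e \<in> carrier V" "e \<notin> U"
  shows "inj_on (\<lambda>(u, c). u \<oplus>\<^bsub>V\<^esub> c \<odot>\<^bsub>V\<^esub> e) (U \<times> carrier K)"
  using ext_unique[OF assms] by (auto simp: inj_on_def)

lemma card_ext:
  assumes "submodule K U V" "e \<in> carrier V" "e \<notin> U"
  shows "card (ext U e) = card U * card (carrier K)"
  unfolding ext_def by (simp add: card_image[OF ext_inj[OF assms]] card_cartesian_product)

lemma ext_submodule:
  assumes U: "submodule K U V" and e: "e \<in> carrier V"
  shows "submodule K (ext U e) V" "U \<subseteq> ext U e" "e \<in> ext U e"
proof -
  have Uc: "U \<subseteq> carrier V" "\<zero>\<^bsub>V\<^esub> \<in> U" using U by (auto simp: submodule_def)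
  have sw: "(a \<oplus>\<^bsub>V\<^esub> b) \<oplus>\<^bsub>V\<^esub> (c \<oplus>\<^bsub>V\<^esub> d) = (a \<oplus>\<^bsub>V\<^esub> c) \<oplus>\<^bsub>V\<^esub> (b \<oplus>\<^bsub>V\<^esub> d)"
    if "a \<in> carrier V" "b \<in> carrier V" "c \<in> carrier V" "d \<in> carrier V" for a b c d
    using that by (simp add: V.M.a_ac)
  show "U \<subseteq> ext U e"
  proof
    fix u assume u: "u \<in> U"
    then have "u = u \<oplus>\<^bsub>V\<^esub> \<zero> \<odot>\<^bsub>V\<^esub> e" using Uc e by auto
    then show "u \<in> ext U e" using ext_memI[OF u, of \<zero> e] by simp
  qed
  show "e \<in> ext U e" using ext_memI[OF Uc(2), of \<one> e] e by simp
  show "submodule K (ext U e) V"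
  proof (unfold submodule_def, intro conjI ballI allI impI)
    show "Module.module K V" ..
    show "ext U e \<subseteq> carrier V" using Uc e by (auto simp: ext_def)
    show "\<zero>\<^bsub>V\<^esub> \<in> ext U e" using \<open>U \<subseteq> ext U e\<close> Uc by blast
  next
    fix x y assume "x \<in> ext U e" "y \<in> ext U e"
    then obtain u c u' c' where
      h: "x = u \<oplus>\<^bsub>V\<^esub> c \<odot>\<^bsub>V\<^esub> e" "y = u' \<oplus>\<^bsub>V\<^esub> c' \<odot>\<^bsub>V\<^esub> e" "u \<in> U" "u' \<in> U" "c \<in> carrier K" "c' \<in> carrier K"
      by (auto simp: ext_def)
    have "x \<oplus>\<^bsub>V\<^esub> y = (u \<oplus>\<^bsub>V\<^esub> u') \<oplus>\<^bsub>V\<^esub> (c \<oplus> c') \<odot>\<^bsub>V\<^esub> e"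
      using h Uc e by (subst V.smult_l_distr) (auto simp: sw subset_iff)
    then show "x \<oplus>\<^bsub>V\<^esub> y \<in> ext U e" using U h by (simp add: ext_memI submodule_def)
  next
    fix a x assume a: "a \<in> carrier K" and "x \<in> ext U e"
    then obtain u c where h: "x = u \<oplus>\<^bsub>V\<^esub> c \<odot>\<^bsub>V\<^esub> e" "u \<in> U" "c \<in> carrier K"
      by (auto simp: ext_def)
    have "a \<odot>\<^bsub>V\<^esub> x = (a \<odot>\<^bsub>V\<^esub> u) \<oplus>\<^bsub>V\<^esub> (a \<otimes> c) \<odot>\<^bsub>V\<^esub> e"
      using h Uc e a by (simp add: V.smult_r_distr V.smult_assoc1 subset_iff)
    then show "a \<odot>\<^bsub>V\<^esub> x \<in> ext U e" using U h a by (simp add: ext_memI submodule_def)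
  qed
qed

lemma zero_submodule: "submodule K {\<zero>\<^bsub>V\<^esub>} V"
  by (auto simp: submodule_def intro: V.module_axioms)

lemma carrier_submodule: "submodule K (carrier V) V"
  by (auto simp: submodule_def intro: V.module_axioms)

text \<open>
  A largest subspace among those reached by the induction must be everything, since otherwise
  it could be extended by a further vector. Dimensions appear only as exponents in the number
  of elements, so no basis has to be carried along.
\<close>

lemma flag_induct:
  assumes zero: "Q {\<zero>\<^bsub>V\<^esub>} 0"
    and step: "\<And>U e k. submodule K U V \<Longrightarrow> e \<in> carrier V \<Longrightarrow> e \<notin> U \<Longrightarrow> card U = card (carrier K) ^ k \<Longrightarrow>
      Q U k \<Longrightarrow> Q (ext U e) (Suc k)"
  shows "\<exists>k. card (carrier V) = card (carrier K) ^ k \<and> Q (carrier V) k"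
proof -
  define S where "S = {U. submodule K U V \<and> (\<exists>k. card U = card (carrier K) ^ k \<and> Q U k)}"
  have sub: "S \<subseteq> Pow (carrier V)" by (auto simp: S_def submodule_def)
  then have "finite S" using finV by (meson finite_Pow_iff finite_subset)
  moreover have "{\<zero>\<^bsub>V\<^esub>} \<in> S" using zero zero_submodule by (auto simp: S_def intro!: exI[of _ 0])
  ultimately obtain U where U: "U \<in> S" and max: "\<And>U'. U' \<in> S \<Longrightarrow> U \<subseteq> U' \<Longrightarrow> U = U'"
    using finite_has_maximal[of S] by auto
  obtain k where k: "submodule K U V" "card U = card (carrier K) ^ k" "Q U k"
    using U by (auto simp: S_def)
  have "U = carrier V"
  proof (rule ccontr)
    assume "U \<noteq> carrier V"
    then obtain e where e: "e \<in> carrier V" "e \<notin> U" using sub U by blast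
    have "ext U e \<in> S"
      unfolding S_def using ext_submodule(1)[OF k(1) e(1)] step[OF k(1) e k(2,3)] card_ext[OF k(1) e] k(2)
      by (auto intro!: exI[of _ "Suc k"])
    from max[OF this ext_submodule(2)[OF k(1) e(1)]] ext_submodule(3)[OF k(1) e(1)] e show False by simp
  qed
  then show ?thesis using k by blast
qed

lemma vectorspace: "vectorspace K V"
  by (simp add: vectorspace_def K.field_axioms V.module_axioms)

end

text \<open>
  The vectors that are added along a complete flag form a basis.
\<close>

lemma (in vectorspace) card_eq_power_dim:
  assumes "finite (carrier K)" "finite (carrier V)"
  shows "card (carrier V) = card (carrier K) ^ dim"
proof -
  interpret F: finite_space K V
    by unfold_locales (use assms in auto)
  have "\<exists>k. card (carrier V) = card (carrier K) ^ k \<and>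
      (\<exists>B. finite B \<and> B \<subseteq> carrier V \<and> card B = k \<and> lin_indpt B \<and> span B = carrier V)"
  proof (rule F.flag_induct[where Q = "\<lambda>U k. \<exists>B. finite B \<and> B \<subseteq> carrier V \<and> card B = k \<and> lin_indpt B \<and> span B = U"])
    show "\<exists>B. finite B \<and> B \<subseteq> carrier V \<and> card B = 0 \<and> lin_indpt B \<and> span B = {\<zero>\<^bsub>V\<^esub>}"
      by (rule exI[of _ "{}"]) (auto simp: span_empty lindep_span)
  next
    fix U e k
    assume U: "submodule K U V" and e: "e \<in> carrier V" "e \<notin> U"
      and "\<exists>B. finite B \<and> B \<subseteq> carrier V \<and> card B = k \<and> lin_indpt B \<and> span B = U"
    then obtain B where B: "finite B" "B \<subseteq> carrier V" "card B = k" "lin_indpt B" "span B = U"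
      by blast
    have eB: "e \<notin> B" using in_own_span[OF B(2)] B(5) e by blast
    show "\<exists>B. finite B \<and> B \<subseteq> carrier V \<and> card B = Suc k \<and> lin_indpt B \<and> span B = F.ext U e"
    proof (intro exI[of _ "insert e B"] conjI)
      show "lin_indpt (insert e B)"
        using lin_dep_iff_in_span[OF B(2,4) e(1) eB] e B(5) by simp
      show "span (insert e B) = F.ext U e"
      proof
        show "span (insert e B) \<subseteq> F.ext U e"
          using F.ext_submodule[OF U e(1)] in_own_span[OF B(2)] B(5)
          by (intro span_is_subset) auto
        have se: "submodule K (span (insert e B)) V" using B e by (intro span_is_submodule) auto
        moreover have "U \<subseteq> span (insert e B)" unfolding B(5)[symmetric] by (rule span_is_monotone) auto
        moreover have "e \<in> span (insert e B)" using in_own_span[of "insert e B"] B e by auto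
        ultimately show "F.ext U e \<subseteq> span (insert e B)"
          by (auto simp: F.ext_def submodule_def subset_iff)
      qed
    qed (use B e eB in auto)
  qed
  then obtain B where B: "finite B" "B \<subseteq> carrier V" "lin_indpt B" "span B = carrier V"
    "card (carrier V) = card (carrier K) ^ card B" by blast
  have "basis B" using B by (simp add: basis_def)
  then have "dim = card B" using dim_basis B by blast
  then show ?thesis using B by simp
qed

locale two_finite_spaces = finite_space K V + W: finite_space K W
  for K (structure) and V (structure) and W (structure)
begin

text \<open>
  The maps are extensional so that each linear map on \<open>U\<close> is counted once.
\<close>

definition homs :: "'c set \<Rightarrow> ('c \<Rightarrow> 'e) set" where
  "homs U = {\<phi> \<in> U \<rightarrow>\<^sub>E carrier W. (\<forall>x\<in>U. \<forall>y\<in>U. \<phi> (x \<oplus>\<^bsub>V\<^esub> y) = \<phi> x \<oplus>\<^bsub>W\<^esub> \<phi> y) \<and>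
     (\<forall>c\<in>carrier K. \<forall>x\<in>U. \<phi> (c \<odot>\<^bsub>V\<^esub> x) = c \<odot>\<^bsub>W\<^esub> \<phi> x)}"

definition injs :: "'c set \<Rightarrow> ('c \<Rightarrow> 'e) set" where
  "injs U = {\<phi> \<in> homs U. inj_on \<phi> U}"

lemma homs_D:
  assumes "\<phi> \<in> homs U"
  shows "\<phi> \<in> U \<rightarrow> carrier W" "\<phi> \<in> extensional U"
    "x \<in> U \<Longrightarrow> y \<in> U \<Longrightarrow> \<phi> (x \<oplus>\<^bsub>V\<^esub> y) = \<phi> x \<oplus>\<^bsub>W\<^esub> \<phi> y"
    "c \<in> carrier K \<Longrightarrow> x \<in> U \<Longrightarrow> \<phi> (c \<odot>\<^bsub>V\<^esub> x) = c \<odot>\<^bsub>W\<^esub> \<phi> x"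
    "x \<in> U \<Longrightarrow> \<phi> x \<in> carrier W"
  using assms by (auto simp: homs_def PiE_def)

lemma finite_homs: "U \<subseteq> carrier V \<Longrightarrow> finite (homs U)"
  by (rule finite_subset[of _ "U \<rightarrow>\<^sub>E carrier W"])
    (auto simp: homs_def intro!: finite_PiE finV W.finV intro: finite_subset)

lemma hom_zero: "submodule K U V \<Longrightarrow> \<phi> \<in> homs U \<Longrightarrow> \<phi> \<zero>\<^bsub>V\<^esub> = \<zero>\<^bsub>W\<^esub>"
proof -
  assume U: "submodule K U V" and p: "\<phi> \<in> homs U"
  have z: "\<zero>\<^bsub>V\<^esub> \<in> U" using U by (simp add: submodule_def)
  have "\<phi> (\<zero> \<odot>\<^bsub>V\<^esub> \<zero>\<^bsub>V\<^esub>) = \<zero> \<odot>\<^bsub>W\<^esub> \<phi> \<zero>\<^bsub>V\<^esub>" using homs_D(4)[OF p _ z] by simp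
  then show ?thesis using homs_D(5)[OF p z] by simp
qed

lemma hom_inj_iff:
  assumes U: "submodule K U V" and p: "\<phi> \<in> homs U"
  shows "inj_on \<phi> U \<longleftrightarrow> (\<forall>x\<in>U. \<phi> x = \<zero>\<^bsub>W\<^esub> \<longrightarrow> x = \<zero>\<^bsub>V\<^esub>)"
proof
  assume "inj_on \<phi> U"
  then show "\<forall>x\<in>U. \<phi> x = \<zero>\<^bsub>W\<^esub> \<longrightarrow> x = \<zero>\<^bsub>V\<^esub>"
    using hom_zero[OF U p] U by (auto simp: inj_on_def submodule_def)
next
  assume z: "\<forall>x\<in>U. \<phi> x = \<zero>\<^bsub>W\<^esub> \<longrightarrow> x = \<zero>\<^bsub>V\<^esub>"
  show "inj_on \<phi> U"
  proof (rule inj_onI)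
    fix x y assume xy: "x \<in> U" "y \<in> U" "\<phi> x = \<phi> y"
    have c: "x \<in> carrier V" "y \<in> carrier V" using U xy by (auto simp: submodule_def)
    have d: "x \<ominus>\<^bsub>V\<^esub> y \<in> U" using submodule_minus_closed[OF U] xy by simp
    have "\<phi> ((x \<ominus>\<^bsub>V\<^esub> y) \<oplus>\<^bsub>V\<^esub> y) = \<phi> (x \<ominus>\<^bsub>V\<^esub> y) \<oplus>\<^bsub>W\<^esub> \<phi> y" using homs_D(3)[OF p d xy(2)] .
    moreover have "(x \<ominus>\<^bsub>V\<^esub> y) \<oplus>\<^bsub>V\<^esub> y = x" using c by (simp add: a_minus_def V.M.a_assoc V.M.l_neg)
    ultimately have "\<phi> (x \<ominus>\<^bsub>V\<^esub> y) = \<zero>\<^bsub>W\<^esub>"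
      using xy homs_D(5)[OF p] d by simp
    then have "x \<ominus>\<^bsub>V\<^esub> y = \<zero>\<^bsub>V\<^esub>" using z d by blast
    then show "x = y" using c by simp
  qed
qed

text \<open>
  Every element of \<open>U + K e\<close> is \<open>u + c e\<close> for unique \<open>u\<close> and \<open>c\<close>, so the value at \<open>e\<close> can be
  chosen freely. If \<open>\<phi> u + c \<phi> e = 0\<close> with \<open>c \<noteq> 0\<close>, then \<open>\<phi> e\<close> lies in the image of \<open>U\<close>; this
  is the only way in which an injective map on \<open>U\<close> can fail to stay injective.
\<close>

lemma ext_homs_bij:
  assumes U: "submodule K U V" and e: "e \<in> carrier V" "e \<notin> U"
  shows "bij_betw (\<lambda>\<phi>. (restrict \<phi> U, \<phi> e)) (homs (ext U e)) (homs U \<times> carrier W)" (is "bij_betw ?r _ _")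
    and "\<And>\<phi>. \<phi> \<in> homs (ext U e) \<Longrightarrow> inj_on \<phi> (ext U e) \<longleftrightarrow> inj_on \<phi> U \<and> \<phi> e \<notin> \<phi> ` U"
proof -
  note E = ext_submodule[OF U e(1)]
  have Uc: "U \<subseteq> carrier V" using U by (simp add: submodule_def)
  have val: "\<phi> (u \<oplus>\<^bsub>V\<^esub> c \<odot>\<^bsub>V\<^esub> e) = \<phi> u \<oplus>\<^bsub>W\<^esub> c \<odot>\<^bsub>W\<^esub> \<phi> e"
    if "\<phi> \<in> homs (ext U e)" "u \<in> U" "c \<in> carrier K" for \<phi> u c
  proof -
    have "c \<odot>\<^bsub>V\<^esub> e \<in> ext U e" "u \<in> ext U e" using E that by (auto simp: submodule_def)
    then show ?thesis using homs_D(3)[OF that(1)] homs_D(4)[OF that(1) that(3) E(3)] by simp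
  qed
  show "bij_betw ?r (homs (ext U e)) (homs U \<times> carrier W)"
  proof (rule bij_betwI')
    fix \<phi> \<psi> assume p: "\<phi> \<in> homs (ext U e)" "\<psi> \<in> homs (ext U e)"
    show "(?r \<phi> = ?r \<psi>) = (\<phi> = \<psi>)"
    proof
      assume eq: "?r \<phi> = ?r \<psi>"
      then have eU: "\<phi> u = \<psi> u" if "u \<in> U" for u
      proof -
        have "restrict \<phi> U u = restrict \<psi> U u" using eq by simp
        then show ?thesis using that by simp
      qed
      show "\<phi> = \<psi>"
      proof (rule extensionalityI[OF homs_D(2)[OF p(1)] homs_D(2)[OF p(2)]])
        fix x assume "x \<in> ext U e"
        then obtain u c where "x = u \<oplus>\<^bsub>V\<^esub> c \<odot>\<^bsub>V\<^esub> e" "u \<in> U" "c \<in> carrier K" by (auto simp: ext_def)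
        then show "\<phi> x = \<psi> x" using val[OF p(1)] val[OF p(2)] eU eq by auto
      qed
    qed simp
  next
    fix \<phi> assume p: "\<phi> \<in> homs (ext U e)"
    have "restrict \<phi> U \<in> homs U"
      using homs_D[OF p] E(2) U by (auto simp: homs_def submodule_def subset_iff)
    then show "?r \<phi> \<in> homs U \<times> carrier W" using homs_D(5)[OF p] E by simp
  next
    fix z assume "z \<in> homs U \<times> carrier W"
    then obtain \<psi> w where z: "z = (\<psi>, w)" and \<psi>: "\<psi> \<in> homs U" and w: "w \<in> carrier W" by auto
    define g where "g = inv_into (U \<times> carrier K) (\<lambda>(u, c). u \<oplus>\<^bsub>V\<^esub> c \<odot>\<^bsub>V\<^esub> e)"
    have g: "g (u \<oplus>\<^bsub>V\<^esub> c \<odot>\<^bsub>V\<^esub> e) = (u, c)" if "u \<in> U" "c \<in> carrier K" for u c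
      using inv_into_f_f[OF ext_inj[OF U e], of "(u, c)"] that by (simp add: g_def)
    define \<phi> where "\<phi> = restrict (\<lambda>x. \<psi> (fst (g x)) \<oplus>\<^bsub>W\<^esub> snd (g x) \<odot>\<^bsub>W\<^esub> w) (ext U e)"
    have \<phi>: "\<phi> (u \<oplus>\<^bsub>V\<^esub> c \<odot>\<^bsub>V\<^esub> e) = \<psi> u \<oplus>\<^bsub>W\<^esub> c \<odot>\<^bsub>W\<^esub> w" if "u \<in> U" "c \<in> carrier K" for u c
      using g[OF that] ext_memI[OF that] by (simp add: \<phi>_def)
    have sw: "(a \<oplus>\<^bsub>V\<^esub> b) \<oplus>\<^bsub>V\<^esub> (c \<oplus>\<^bsub>V\<^esub> d) = (a \<oplus>\<^bsub>V\<^esub> c) \<oplus>\<^bsub>V\<^esub> (b \<oplus>\<^bsub>V\<^esub> d)"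
      if "a \<in> carrier V" "b \<in> carrier V" "c \<in> carrier V" "d \<in> carrier V" for a b c d
      using that by (simp add: V.M.a_ac)
    have swW: "(a \<oplus>\<^bsub>W\<^esub> b) \<oplus>\<^bsub>W\<^esub> (c \<oplus>\<^bsub>W\<^esub> d) = (a \<oplus>\<^bsub>W\<^esub> c) \<oplus>\<^bsub>W\<^esub> (b \<oplus>\<^bsub>W\<^esub> d)"
      if "a \<in> carrier W" "b \<in> carrier W" "c \<in> carrier W" "d \<in> carrier W" for a b c d
      using that by (simp add: W.V.M.a_ac)
    have ph: "\<phi> \<in> homs (ext U e)"
      unfolding homs_def
    proof (intro CollectI conjI ballI)
      show "\<phi> \<in> ext U e \<rightarrow>\<^sub>E carrier W"
      proof (rule PiE_I)
        fix x assume "x \<in> ext U e"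
        then obtain u c where "x = u \<oplus>\<^bsub>V\<^esub> c \<odot>\<^bsub>V\<^esub> e" "u \<in> U" "c \<in> carrier K" by (auto simp: ext_def)
        then show "\<phi> x \<in> carrier W" using \<phi> homs_D(5)[OF \<psi>] w by simp
      qed (simp add: \<phi>_def)
    next
      fix x y assume "x \<in> ext U e" "y \<in> ext U e"
      then obtain u c u' c' where
        h: "x = u \<oplus>\<^bsub>V\<^esub> c \<odot>\<^bsub>V\<^esub> e" "y = u' \<oplus>\<^bsub>V\<^esub> c' \<odot>\<^bsub>V\<^esub> e" "u \<in> U" "u' \<in> U" "c \<in> carrier K" "c' \<in> carrier K"
        by (auto simp: ext_def)
      have xy: "x \<oplus>\<^bsub>V\<^esub> y = (u \<oplus>\<^bsub>V\<^esub> u') \<oplus>\<^bsub>V\<^esub> (c \<oplus> c') \<odot>\<^bsub>V\<^esub> e"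
        using h Uc e by (subst V.smult_l_distr) (auto simp: sw subset_iff)
      have "u \<oplus>\<^bsub>V\<^esub> u' \<in> U" using U h by (simp add: submodule_def)
      then show "\<phi> (x \<oplus>\<^bsub>V\<^esub> y) = \<phi> x \<oplus>\<^bsub>W\<^esub> \<phi> y"
        unfolding xy using h \<phi> homs_D[OF \<psi>] w
        by (simp add: W.V.smult_l_distr swW Pi_iff)
    next
      fix a x assume a: "a \<in> carrier K" and "x \<in> ext U e"
      then obtain u c where h: "x = u \<oplus>\<^bsub>V\<^esub> c \<odot>\<^bsub>V\<^esub> e" "u \<in> U" "c \<in> carrier K"
        by (auto simp: ext_def)
      have ax: "a \<odot>\<^bsub>V\<^esub> x = (a \<odot>\<^bsub>V\<^esub> u) \<oplus>\<^bsub>V\<^esub> (a \<otimes> c) \<odot>\<^bsub>V\<^esub> e"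
        using h Uc e a by (simp add: V.smult_r_distr V.smult_assoc1 subset_iff)
      have "a \<odot>\<^bsub>V\<^esub> u \<in> U" using U h a by (simp add: submodule_def)
      then show "\<phi> (a \<odot>\<^bsub>V\<^esub> x) = a \<odot>\<^bsub>W\<^esub> \<phi> x"
        unfolding ax using h a \<phi> homs_D[OF \<psi>] w
        by (simp add: W.V.smult_r_distr W.V.smult_assoc1 Pi_iff)
    qed
    have "restrict \<phi> U = \<psi>"
    proof (rule extensionalityI[OF restrict_extensional homs_D(2)[OF \<psi>]])
      fix u assume u: "u \<in> U"
      have "u = u \<oplus>\<^bsub>V\<^esub> \<zero> \<odot>\<^bsub>V\<^esub> e" using u Uc e by auto
      then have "\<phi> u = \<psi> u \<oplus>\<^bsub>W\<^esub> \<zero> \<odot>\<^bsub>W\<^esub> w" using \<phi>[OF u K.zero_closed] by simp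
      then show "restrict \<phi> U u = \<psi> u" using u homs_D(5)[OF \<psi> u] w by simp
    qed
    moreover have "\<phi> e = w"
    proof -
      have z: "\<zero>\<^bsub>V\<^esub> \<in> U" using U by (simp add: submodule_def)
      show ?thesis using \<phi>[OF z K.one_closed] e w hom_zero[OF U \<psi>] by simp
    qed
    ultimately show "\<exists>\<phi>\<in>homs (ext U e). z = ?r \<phi>" using ph z by auto
  qed
  fix \<phi> assume p: "\<phi> \<in> homs (ext U e)"
  show "inj_on \<phi> (ext U e) \<longleftrightarrow> inj_on \<phi> U \<and> \<phi> e \<notin> \<phi> ` U"
  proof (intro iffI conjI)
    assume i: "inj_on \<phi> (ext U e)"
    then show "inj_on \<phi> U" using E(2) by (rule inj_on_subset)
    show "\<phi> e \<notin> \<phi> ` U"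
    proof
      assume "\<phi> e \<in> \<phi> ` U"
      then obtain u where "u \<in> U" "\<phi> e = \<phi> u" by auto
      then show False using inj_onD[OF i, of e u] E e by auto
    qed
  next
    assume i: "inj_on \<phi> U \<and> \<phi> e \<notin> \<phi> ` U"
    show "inj_on \<phi> (ext U e)"
      unfolding hom_inj_iff[OF E(1) p]
    proof (intro ballI impI)
      fix x assume "x \<in> ext U e" and 0: "\<phi> x = \<zero>\<^bsub>W\<^esub>"
      then obtain u c where h: "x = u \<oplus>\<^bsub>V\<^esub> c \<odot>\<^bsub>V\<^esub> e" "u \<in> U" "c \<in> carrier K" by (auto simp: ext_def)
      have pu: "\<phi> u \<in> carrier W" "\<phi> e \<in> carrier W" using homs_D(5)[OF p] h E by auto
      have eq: "\<phi> u \<oplus>\<^bsub>W\<^esub> c \<odot>\<^bsub>W\<^esub> \<phi> e = \<zero>\<^bsub>W\<^esub>" using val[OF p h(2,3)] h 0 by simp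
      have "c = \<zero>"
      proof (rule ccontr)
        assume c0: "c \<noteq> \<zero>"
        then have ic: "inv c \<in> carrier K" "inv c \<otimes> c = \<one>" using h K.field_Units by auto
        define u' where "u' = (\<ominus> (inv c)) \<odot>\<^bsub>V\<^esub> u"
        have u': "u' \<in> U" using U h ic by (simp add: u'_def submodule_def)
        have "\<phi> u' = (\<ominus> (inv c)) \<odot>\<^bsub>W\<^esub> \<phi> u"
          unfolding u'_def using homs_D(4)[OF p] ic h E by auto
        also have "\<phi> u = \<ominus>\<^bsub>W\<^esub> (c \<odot>\<^bsub>W\<^esub> \<phi> e)" using eq pu h by (simp add: W.V.M.minus_equality)
        also have "(\<ominus> (inv c)) \<odot>\<^bsub>W\<^esub> (\<ominus>\<^bsub>W\<^esub> (c \<odot>\<^bsub>W\<^esub> \<phi> e)) = inv c \<odot>\<^bsub>W\<^esub> (c \<odot>\<^bsub>W\<^esub> \<phi> e)"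
          using ic h pu by (simp add: W.V.smult_l_minus W.V.smult_r_minus)
        also have "\<dots> = \<phi> e" using ic h pu by (simp add: W.V.smult_assoc1[symmetric])
        finally show False using i imageI[OF u', of \<phi>] by simp
      qed
      then have "x = u" using h Uc e by auto
      then show "x = \<zero>\<^bsub>V\<^esub>"
        using i 0 h U hom_zero[OF E(1) p] inj_onD[of \<phi> U x "\<zero>\<^bsub>V\<^esub>"] by (simp add: submodule_def)
    qed
  qed
qed

text \<open>
  Along a complete flag a linear map is given by one free value for each step, and an
  injective one must avoid the image of the previous step.
\<close>

lemma card_homs_injs:
  "\<exists>k. card (carrier V) = card (carrier K) ^ k \<and> card (homs (carrier V)) = card (carrier W) ^ k \<and>
    card (injs (carrier V)) = (\<Prod>i<k. card (carrier W) - card (carrier K) ^ i)"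
proof -
  have "\<exists>k. card (carrier V) = card (carrier K) ^ k \<and> (card (homs (carrier V)) = card (carrier W) ^ k \<and>
    card (injs (carrier V)) = (\<Prod>i<k. card (carrier W) - card (carrier K) ^ i))"
  proof (rule flag_induct)
    have h: "homs {\<zero>\<^bsub>V\<^esub>} = {\<lambda>x\<in>{\<zero>\<^bsub>V\<^esub>}. \<zero>\<^bsub>W\<^esub>}"
    proof
      show "homs {\<zero>\<^bsub>V\<^esub>} \<subseteq> {\<lambda>x\<in>{\<zero>\<^bsub>V\<^esub>}. \<zero>\<^bsub>W\<^esub>}"
      proof
        fix \<phi> assume p: "\<phi> \<in> homs {\<zero>\<^bsub>V\<^esub>}"
        have "\<phi> = (\<lambda>x\<in>{\<zero>\<^bsub>V\<^esub>}. \<zero>\<^bsub>W\<^esub>)"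
          using hom_zero[OF zero_submodule p]
          by (intro extensionalityI[OF homs_D(2)[OF p] restrict_extensional]) simp
        then show "\<phi> \<in> {\<lambda>x\<in>{\<zero>\<^bsub>V\<^esub>}. \<zero>\<^bsub>W\<^esub>}" by simp
      qed
      show "{\<lambda>x\<in>{\<zero>\<^bsub>V\<^esub>}. \<zero>\<^bsub>W\<^esub>} \<subseteq> homs {\<zero>\<^bsub>V\<^esub>}" by (auto simp: homs_def)
    qed
    then have i: "injs {\<zero>\<^bsub>V\<^esub>} = {\<lambda>x\<in>{\<zero>\<^bsub>V\<^esub>}. \<zero>\<^bsub>W\<^esub>}" by (auto simp: injs_def)
    show "card (homs {\<zero>\<^bsub>V\<^esub>}) = card (carrier W) ^ 0 \<and>
      card (injs {\<zero>\<^bsub>V\<^esub>}) = (\<Prod>i<0. card (carrier W) - card (carrier K) ^ i)"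
      unfolding h i by simp
  next
    fix U e k assume U: "submodule K U V" and e: "e \<in> carrier V" "e \<notin> U" and cU: "card U = card (carrier K) ^ k"
      and IH: "card (homs U) = card (carrier W) ^ k \<and> card (injs U) = (\<Prod>i<k. card (carrier W) - card (carrier K) ^ i)"
    have Uc: "U \<subseteq> carrier V" using U by (simp add: submodule_def)
    note b = ext_homs_bij(1)[OF U e]
    have "card (homs (ext U e)) = card (homs U) * card (carrier W)"
      using bij_betw_same_card[OF b] by (simp add: card_cartesian_product)
    moreover have "card (injs (ext U e)) = card (injs U) * (card (carrier W) - card (carrier K) ^ k)"
    proof -
      let ?r = "\<lambda>\<phi>. (restrict \<phi> U, \<phi> e)"
      let ?T = "SIGMA \<phi>:injs U. carrier W - \<phi> ` U"
      have img: "(restrict \<phi> U) ` U = \<phi> ` U" for \<phi> :: "'c \<Rightarrow> 'e" by auto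
      have im: "?r ` injs (ext U e) = ?T"
      proof
        show "?r ` injs (ext U e) \<subseteq> ?T"
        proof (rule image_subsetI)
          fix \<phi> assume p: "\<phi> \<in> injs (ext U e)"
          then have ph: "\<phi> \<in> homs (ext U e)" "inj_on \<phi> (ext U e)" by (simp_all add: injs_def)
          then have i: "inj_on \<phi> U" "\<phi> e \<notin> \<phi> ` U"
            using ext_homs_bij(2)[OF U e ph(1)] by blast+
          have "restrict \<phi> U \<in> homs U" "\<phi> e \<in> carrier W" using bij_betwE[OF b] ph by auto
          then show "?r \<phi> \<in> ?T" using i by (simp add: injs_def)
        qed
        show "?T \<subseteq> ?r ` injs (ext U e)"
        proof
          fix z assume z: "z \<in> ?T"
          then obtain \<psi> w where "z = (\<psi>, w)" "\<psi> \<in> injs U" "w \<in> carrier W - \<psi> ` U" by (rule SigmaE) blast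
          then have "z \<in> homs U \<times> carrier W" unfolding injs_def by blast
          then have "z \<in> ?r ` homs (ext U e)" using b unfolding bij_betw_def by blast
          then obtain \<phi> where p: "\<phi> \<in> homs (ext U e)" "z = ?r \<phi>" by (rule imageE)
          have "inj_on (restrict \<phi> U) U" "\<phi> e \<notin> (restrict \<phi> U) ` U" using z p(2) by (simp_all add: injs_def)
          then have "\<phi> \<in> injs (ext U e)"
            using p(1) ext_homs_bij(2)[OF U e p(1)] by (simp add: injs_def)
          then show "z \<in> ?r ` injs (ext U e)" using p by blast
        qed
      qed
      have inj: "inj_on ?r (injs (ext U e))"
        using b unfolding bij_betw_def injs_def by (blast intro: inj_on_subset)
      have "card (injs (ext U e)) = card ?T" using card_image[OF inj] unfolding im by simp
      also have "\<dots> = (\<Sum>\<phi>\<in>injs U. card (carrier W - \<phi> ` U))"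
        by (rule card_SigmaI) (use finite_homs[OF Uc] W.finV in \<open>auto simp: injs_def\<close>)
      also have "\<dots> = (\<Sum>\<phi>\<in>injs U. card (carrier W) - card (carrier K) ^ k)"
      proof (rule sum.cong[OF refl])
        fix \<phi> assume "\<phi> \<in> injs U"
        then have "\<phi> ` U \<subseteq> carrier W" "card (\<phi> ` U) = card U"
          using homs_D(5) by (auto simp: injs_def card_image)
        then show "card (carrier W - \<phi> ` U) = card (carrier W) - card (carrier K) ^ k"
          using W.finV cU by (simp add: card_Diff_subset finite_subset)
      qed
      finally show ?thesis by simp
    qed
    ultimately show "card (homs (ext U e)) = card (carrier W) ^ Suc k \<and>
      card (injs (ext U e)) = (\<Prod>i<Suc k. card (carrier W) - card (carrier K) ^ i)"
      using IH by (simp add: mult.commute)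
  qed
  then show ?thesis by blast
qed

end

section \<open>Counting along fibres\<close>

lemma (in abelian_group) add_minus_cancel:
  assumes "a \<in> carrier G" "b \<in> carrier G"
  shows "a \<oplus> (b \<ominus> a) = b" "(a \<oplus> b) \<ominus> a = b" "a \<ominus> \<zero> = a"
proof -
  show "a \<oplus> (b \<ominus> a) = b"
    using assms a_comm[of b "\<ominus> a"] r_neg2[of a b] by (simp add: a_minus_def)
  show "(a \<oplus> b) \<ominus> a = b"
    using assms a_comm[of a b] by (simp add: a_minus_def a_assoc r_neg)
  have "\<ominus> \<zero> = \<zero>" by (rule minus_equality) auto
  then show "a \<ominus> \<zero> = a" using assms by (simp add: a_minus_def)
qed

lemma card_fibres:
  assumes "finite A" "S \<subseteq> h ` A" "\<And>b. b \<in> S \<Longrightarrow> card {a \<in> A. h a = b} = k"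
  shows "card {a \<in> A. h a \<in> S} = card S * k"
proof -
  have fS: "finite S" using assms finite_surj by blast
  have "{a \<in> A. h a \<in> S} = (\<Union>b\<in>S. {a \<in> A. h a = b})" by auto
  also have "card \<dots> = (\<Sum>b\<in>S. card {a \<in> A. h a = b})"
    using fS assms(1) by (intro card_UN_disjoint) auto
  also have "\<dots> = card S * k" using assms(3) by simp
  finally show ?thesis .
qed

lemma bij_betw_card_eq_of_inverse:
  assumes "\<And>x. x \<in> A \<Longrightarrow> f x \<in> B" "\<And>y. y \<in> B \<Longrightarrow> g y \<in> A"
    "\<And>x. x \<in> A \<Longrightarrow> g (f x) = x" "\<And>y. y \<in> B \<Longrightarrow> f (g y) = y"
  shows "card A = card B"
  by (rule bij_betw_same_card[OF bij_betw_byWitness[of A g f B]]) (use assms in auto)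

text \<open>
  Translation by \<open>a\<close> carries the kernel to the fibre over \<open>h a\<close>.
\<close>

lemma (in abelian_group) hom_fibre_card:
  assumes h: "\<And>x y. x \<in> carrier G \<Longrightarrow> y \<in> carrier G \<Longrightarrow> h (x \<oplus> y) = h x \<oplus>\<^bsub>H\<^esub> h y"
    and H: "abelian_group H" and hc: "h \<in> carrier G \<rightarrow> carrier H" and a: "a \<in> carrier G"
  shows "card {x \<in> carrier G. h x = h a} = card {x \<in> carrier G. h x = \<zero>\<^bsub>H\<^esub>}"
proof -
  interpret H: abelian_group H by (rule H)
  interpret h: abelian_group_hom G H h
    using abelian_group_axioms H hc h
    by (intro abelian_group_homI)
      (auto simp: hom_def Pi_iff abelian_group_def abelian_group_axioms_def comm_group_def
        group_hom_def group_hom_axioms_def)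
  show ?thesis
  proof (rule bij_betw_card_eq_of_inverse[where f = "\<lambda>x. x \<ominus> a" and g = "\<lambda>x. x \<oplus> a"])
    fix x assume x: "x \<in> {x \<in> carrier G. h x = h a}"
    have "h (x \<ominus> a) = \<zero>\<^bsub>H\<^esub>"
      using x a hc[THEN funcset_mem, OF a] by (simp add: a_minus_def H.r_neg)
    then show "x \<ominus> a \<in> {x \<in> carrier G. h x = \<zero>\<^bsub>H\<^esub>}" using x a by simp
    show "x \<ominus> a \<oplus> a = x" using x a by (simp add: a_minus_def a_assoc l_neg)
  next
    fix x assume x: "x \<in> {x \<in> carrier G. h x = \<zero>\<^bsub>H\<^esub>}"
    then show "x \<oplus> a \<in> {x \<in> carrier G. h x = h a}"
      using a hc[THEN funcset_mem, OF a] by simp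
    show "x \<oplus> a \<ominus> a = x" using x a by (simp add: a_minus_def a_assoc r_neg)
  qed
qed

text \<open>
  The first isomorphism theorem, as a count.
\<close>

lemma (in abelian_group) card_hom_image_kernel:
  assumes fin: "finite (carrier G)"
    and h: "\<And>x y. x \<in> carrier G \<Longrightarrow> y \<in> carrier G \<Longrightarrow> h (x \<oplus> y) = h x \<oplus>\<^bsub>H\<^esub> h y"
    and H: "abelian_group H" and hc: "h \<in> carrier G \<rightarrow> carrier H"
  shows "card (carrier G) = card (h ` carrier G) * card {x \<in> carrier G. h x = \<zero>\<^bsub>H\<^esub>}"
proof -
  have "card {x \<in> carrier G. h x \<in> h ` carrier G} = card (h ` carrier G) * card {x \<in> carrier G. h x = \<zero>\<^bsub>H\<^esub>}"
    by (rule card_fibres[OF fin order_refl]) (use hom_fibre_card[OF h H hc] in auto)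
  moreover have "{x \<in> carrier G. h x \<in> h ` carrier G} = carrier G" by auto
  ultimately show ?thesis by simp
qed

section \<open>Cosets in abelian groups\<close>

lemma (in abelian_subgroup) rcos_eq_iff:
  assumes "x \<in> carrier G" "y \<in> carrier G"
  shows "H +> x = H +> y \<longleftrightarrow> x \<ominus> y \<in> H"
proof -
  have "x \<in> H +> y \<longleftrightarrow> x \<ominus> y \<in> H"
    using a_rcos_module[OF assms(2,1)] by (simp add: a_minus_def)
  then show ?thesis using assms a_repr_independence'[of x y] a_rcos_self[of x] by auto
qed

lemma (in abelian_subgroup) rcosets_eq: "a_rcosets H = (\<lambda>x. H +> x) ` carrier G"
  by (auto simp: A_RCOSETS_def')

lemma (in abelian_subgroup) rcos_zero: "H +> \<zero> = H"
  by (rule a_rcos_const) (rule additive_subgroup.zero_closed[OF additive_subgroup_axioms])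

lemma (in abelian_subgroup) H0: "H \<in> (+>) H ` carrier G"
  using imageI[OF abelian_monoid.zero_closed[OF abelian_monoid_axioms], of "\<lambda>x. H +> x"] rcos_zero by simp

text \<open>
  The fields \<open>m\<close>, \<open>i\<close> and \<open>r\<close> are left open so that the result applies to module records with
  any multiplication and scalar multiplication.
\<close>

lemma (in abelian_subgroup) quot_abelian_group:
  "abelian_group \<lparr>carrier = a_rcosets H, mult = m, one = i, zero = H, add = set_add G, \<dots> = r\<rparr>"
proof (rule abelian_groupI)
  show "\<zero>\<^bsub>\<lparr>carrier = a_rcosets H, mult = m, one = i, zero = H, add = set_add G, \<dots> = r\<rparr>\<^esub>
    \<in> carrier \<lparr>carrier = a_rcosets H, mult = m, one = i, zero = H, add = set_add G, \<dots> = r\<rparr>"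
    by (simp add: rcosets_eq H0)
next
  fix x assume "x \<in> carrier \<lparr>carrier = a_rcosets H, mult = m, one = i, zero = H, add = set_add G, \<dots> = r\<rparr>"
  then obtain a where a: "a \<in> carrier G" "x = H +> a" by (auto simp: rcosets_eq)
  have "(H +> \<ominus> a) <+> (H +> a) = H" using a a_rcos_sum[of "\<ominus> a" a] rcos_zero by (simp add: l_neg)
  then show "\<exists>y\<in>carrier \<lparr>carrier = a_rcosets H, mult = m, one = i, zero = H, add = set_add G, \<dots> = r\<rparr>.
    y \<oplus>\<^bsub>\<lparr>carrier = a_rcosets H, mult = m, one = i, zero = H, add = set_add G, \<dots> = r\<rparr>\<^esub> x
      = \<zero>\<^bsub>\<lparr>carrier = a_rcosets H, mult = m, one = i, zero = H, add = set_add G, \<dots> = r\<rparr>\<^esub>"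
    using a by (auto simp: rcosets_eq)
next
  fix x assume "x \<in> carrier \<lparr>carrier = a_rcosets H, mult = m, one = i, zero = H, add = set_add G, \<dots> = r\<rparr>"
  then obtain a where a: "a \<in> carrier G" "x = H +> a" by (auto simp: rcosets_eq)
  have "(H +> \<zero>) <+> (H +> a) = H +> a" using a a_rcos_sum[of \<zero> a] by simp
  then show "\<zero>\<^bsub>\<lparr>carrier = a_rcosets H, mult = m, one = i, zero = H, add = set_add G, \<dots> = r\<rparr>\<^esub>
    \<oplus>\<^bsub>\<lparr>carrier = a_rcosets H, mult = m, one = i, zero = H, add = set_add G, \<dots> = r\<rparr>\<^esub> x = x"
    using a rcos_zero by simp
qed (auto simp: rcosets_eq a_rcos_sum a_assoc, (simp add: a_comm)+)

lemma (in abelian_subgroup) card_rcosets: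
  assumes "finite (carrier G)"
  shows "card (a_rcosets H) * card H = card (carrier G)"
  using add.lagrange_finite[OF _ a_subgroup] assms by (simp add: A_RCOSETS_def order_def)

lemma (in abelian_subgroup) card_rcos: "finite (carrier G) \<Longrightarrow> x \<in> carrier G \<Longrightarrow> card (H +> x) = card H"
  using a_card_cosets_equal[OF _ a_subset, of "H +> x"] by (auto simp: rcosets_eq)

section \<open>Maps out of a cokernel\<close>

definition mat_image :: "'a :: comm_ring_1 poly \<Rightarrow> 'a mat \<Rightarrow> 'a vec set" where
  "mat_image Q X = {pmv Q X v | v. v \<in> carrier_vec (dim_row X)}"

lemma minus_add_cancel_vec:
  "w \<in> carrier_vec n \<Longrightarrow> v \<in> carrier_vec n \<Longrightarrow> w - v + v = (w :: 'a :: ab_group_add vec)"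
  by (intro eq_vecI) auto

lemma abelian_group_module_vec: "abelian_group (module_vec TYPE('a :: comm_ring_1) n)"
proof (rule abelian_groupI)
  fix x assume "x \<in> carrier (module_vec TYPE('a) n)"
  then show "\<exists>y\<in>carrier (module_vec TYPE('a) n). y \<oplus>\<^bsub>module_vec TYPE('a) n\<^esub> x = \<zero>\<^bsub>module_vec TYPE('a) n\<^esub>"
    by (intro bexI[of _ "- x"]) (auto simp: module_vec_def)
qed (auto simp: module_vec_def)

lemma module_vec_minus:
  assumes "x \<in> carrier_vec n" "y \<in> carrier_vec n"
  shows "x \<ominus>\<^bsub>module_vec TYPE('a :: comm_ring_1) n\<^esub> y = x - y"
proof -
  interpret V: abelian_group "module_vec TYPE('a) n" by (rule abelian_group_module_vec)
  have "\<ominus>\<^bsub>module_vec TYPE('a) n\<^esub> y = - y"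
    by (rule V.minus_equality) (use assms in \<open>auto simp: module_vec_def\<close>)
  then show ?thesis using assms by (simp add: a_minus_def) (auto simp: module_vec_def vec_eq_iff)
qed

lemma mat_image_subgroup:
  assumes X: "X \<in> carrier_mat n n"
  shows "abelian_subgroup (mat_image Q X) (module_vec TYPE('a :: comm_ring_1) n)"
proof (rule abelian_subgroupI3[OF _ abelian_group_module_vec])
  interpret V: abelian_group "module_vec TYPE('a) n" by (rule abelian_group_module_vec)
  have mi: "mat_image Q X = {pmv Q X v | v. v \<in> carrier_vec n}" using X by (simp add: mat_image_def)
  show "additive_subgroup (mat_image Q X) (module_vec TYPE('a) n)"
  proof (rule additive_subgroup.intro, rule V.add.subgroupI)
    show "mat_image Q X \<subseteq> carrier (module_vec TYPE('a) n)"
      using X by (auto simp: mi module_vec_def)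
    show "mat_image Q X \<noteq> {}" using zero_carrier_vec[of n] unfolding mi by blast
  next
    fix a assume "a \<in> mat_image Q X"
    then obtain v where v: "v \<in> carrier_vec n" "a = pmv Q X v" by (auto simp: mi)
    have c: "pmv Q X v \<in> carrier_vec n" using X v by simp
    have "\<ominus>\<^bsub>module_vec TYPE('a) n\<^esub> a = - a"
      by (rule V.minus_equality) (use v c in \<open>auto simp: module_vec_def\<close>)
    also have "- a = pmv Q X (- v)" using X v mat_vec_smult[OF poly_mat_carrier[OF X] v(1), of Q "- 1"]
      by (simp add: smult_vec_def uminus_vec_def)
    finally show "\<ominus>\<^bsub>module_vec TYPE('a) n\<^esub> a \<in> mat_image Q X"
      using v by (auto simp: mi intro!: exI[of _ "- v"])
  next
    fix a b assume "a \<in> mat_image Q X" "b \<in> mat_image Q X"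
    then obtain v w where v: "v \<in> carrier_vec n" "a = pmv Q X v" "w \<in> carrier_vec n" "b = pmv Q X w"
      by (auto simp: mi)
    then have "a + b = pmv Q X (v + w)" using X by (simp add: pmv_add)
    then show "a \<oplus>\<^bsub>module_vec TYPE('a) n\<^esub> b \<in> mat_image Q X"
      using v by (auto simp: mi module_vec_def intro!: exI[of _ "v + w"])
  qed
qed

lemma mat_image_props:
  assumes X: "X \<in> carrier_mat n n"
  shows "mat_image Q X \<subseteq> carrier_vec n"
    "v \<in> carrier_vec n \<Longrightarrow> pmv Q X v \<in> mat_image Q X"
    "u \<in> mat_image Q X \<Longrightarrow> w \<in> mat_image Q X \<Longrightarrow> u + w \<in> mat_image Q X"
    "u \<in> mat_image Q X \<Longrightarrow> pmv f X u \<in> mat_image Q X"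
proof -
  have mi: "mat_image Q X = {pmv Q X v | v. v \<in> carrier_vec n}" using X by (simp add: mat_image_def)
  show "mat_image Q X \<subseteq> carrier_vec n" using X by (auto simp: mi)
  show "v \<in> carrier_vec n \<Longrightarrow> pmv Q X v \<in> mat_image Q X" by (auto simp: mi)
  show "u \<in> mat_image Q X \<Longrightarrow> w \<in> mat_image Q X \<Longrightarrow> u + w \<in> mat_image Q X"
  proof -
    assume "u \<in> mat_image Q X" "w \<in> mat_image Q X"
    then obtain v v' where "v \<in> carrier_vec n" "u = pmv Q X v" "v' \<in> carrier_vec n" "w = pmv Q X v'"
      unfolding mi by blast
    then have "u + w = pmv Q X (v + v')" "v + v' \<in> carrier_vec n" using pmv_add[OF X] by auto
    then show "u + w \<in> mat_image Q X" unfolding mi by blast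
  qed
  assume "u \<in> mat_image Q X"
  then obtain v where v: "v \<in> carrier_vec n" "u = pmv Q X v" by (auto simp: mi)
  then have "pmv f X u = pmv Q X (pmv f X v)" using pmv_comm[OF X] by simp
  then show "pmv f X u \<in> mat_image Q X" using v X by (auto simp: mi intro!: exI[of _ "pmv f X v"])
qed

text \<open>
  The cokernel of \<open>Q(X)\<close> is the universal target of additive maps that turn \<open>X\<close> into
  multiplication by \<open>t\<close> and vanish on the image of \<open>Q(X)\<close>; isomorphisms correspond to the
  surjective maps among these with no larger kernel. With \<open>\<sigma>\<close> the identity this concerns the
  cokernel over \<open>\<int>\<^sub>p\<close>, and with \<open>\<sigma>\<close> the reduction map it concerns the cokernel modulo \<open>p\<close>,
  viewed as a module over \<open>\<int>\<^sub>p[t]/(P)\<close>.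
\<close>

lemma cok_isomorphic_iff:
  fixes Q :: "'a :: comm_ring_1 poly" and M :: "('r, 'm) module" and R :: "('r, 's) ring_scheme"
  assumes X: "X \<in> carrier_mat n n" and \<sigma>: "\<sigma> \<in> carrier R \<rightarrow> carrier (poly_quot Q)"
  shows "module_isomorphic R (restrict_scalars \<sigma> (cok Q X)) M \<longleftrightarrow>
    (\<exists>F \<in> carrier_vec n \<rightarrow> carrier M.
      (\<forall>v\<in>carrier_vec n. \<forall>w\<in>carrier_vec n. F (v + w) = F v \<oplus>\<^bsub>M\<^esub> F w) \<and>
      (\<forall>c\<in>carrier R. \<forall>f\<in>\<sigma> c. \<forall>v\<in>carrier_vec n. F (pmv f X v) = c \<odot>\<^bsub>M\<^esub> F v) \<and>
      F ` carrier_vec n = carrier M \<and>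
      (\<forall>v\<in>carrier_vec n. \<forall>w\<in>carrier_vec n. F v = F w \<longleftrightarrow> v - w \<in> mat_image Q X))"
    (is "?L \<longleftrightarrow> ?R")
proof -
  let ?V = "module_vec TYPE('a) n"
  define N where "N = mat_image Q X"
  interpret N: abelian_subgroup N ?V unfolding N_def by (rule mat_image_subgroup[OF X])
  have Vs: "carrier ?V = carrier_vec n" "add ?V = (+)" "zero ?V = 0\<^sub>v n" by (auto simp: module_vec_def)
  define cc where "cc v = N +>\<^bsub>?V\<^esub> v" for v
  have cc_eq: "cc v = cc w \<longleftrightarrow> v - w \<in> N" if "v \<in> carrier_vec n" "w \<in> carrier_vec n" for v w
    using N.rcos_eq_iff[of v w] that by (simp add: cc_def Vs module_vec_minus)
  have mi: "{pmv Q X v | v. v \<in> carrier_vec n} = N" using X by (simp add: N_def mat_image_def)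
  have C: "carrier (restrict_scalars \<sigma> (cok Q X)) = cc ` carrier_vec n"
    using X N.rcosets_eq by (simp add: restrict_scalars_def cok_def Let_def mi cc_def Vs)
  have A: "cc v \<oplus>\<^bsub>restrict_scalars \<sigma> (cok Q X)\<^esub> cc w = cc (v + w)"
    if "v \<in> carrier_vec n" "w \<in> carrier_vec n" for v w
    using X N.a_rcos_sum[of v w] that
    by (simp add: restrict_scalars_def cok_def Let_def mi cc_def Vs)
  (* All cosets that the definition of the scalar multiplication unites are equal. *)
  have S: "c \<odot>\<^bsub>restrict_scalars \<sigma> (cok Q X)\<^esub> cc v = cc (pmv f X v)"
    if c: "c \<in> carrier R" and f: "f \<in> \<sigma> c" and v: "v \<in> carrier_vec n" for c f v
  proof -
    obtain f0 where "\<sigma> c = pcls Q f0" using funcset_mem[OF \<sigma> c] by (auto simp: carrier_poly_quot)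
    then have sc: "\<sigma> c = pcls Q f" using f by auto
    have all: "cc (pmv f' X w) = cc (pmv f X v)" if f': "f' \<in> pcls Q f" and w: "w \<in> cc v" for f' w
    proof -
      obtain h where "f' - f = Q * h" using f' unfolding mem_pcls pcls_eq_iff by (rule dvdE)
      then have h: "f' = f + Q * h" by (simp add: algebra_simps)
      have wc: "w \<in> carrier_vec n" using N.a_elemrcos_carrier[of v w] v w by (simp add: cc_def Vs)
      have "cc v = cc w" using N.a_repr_independence'[of w v] v w by (simp add: cc_def Vs)
      then have d: "w - v \<in> N" using cc_eq[OF wc v] by simp
      have "pmv f' X w - pmv f X v = pmv f X (w - v) + pmv Q X (pmv h X w)"
      proof -
        have "pmv f X w = pmv f X (w - v) + pmv f X v"
          using pmv_add[OF X minus_carrier_vec[OF wc v] v, of f] minus_add_cancel_vec[OF wc v] by simp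
        then show ?thesis
          using wc v X pmv_carrier[OF X wc] pmv_carrier[OF X v] pmv_carrier[OF X pmv_carrier[OF X wc]]
            pmv_carrier[OF X minus_carrier_vec[OF wc v]]
          by (auto simp: h pmv_add_poly[OF X wc] pmv_mult[OF X wc] vec_eq_iff)
      qed
      also have "\<dots> \<in> N" using mat_image_props[OF X] d X wc unfolding N_def by simp
      finally show ?thesis using X wc v by (simp add: cc_eq)
    qed
    have ne: "f \<in> pcls Q f" "v \<in> cc v" using N.a_rcos_self[of v] v by (auto simp: cc_def Vs)
    have "c \<odot>\<^bsub>restrict_scalars \<sigma> (cok Q X)\<^esub> cc v = (\<Union>f'\<in>pcls Q f. \<Union>w\<in>cc v. cc (pmv f' X w))"
      using X by (simp add: restrict_scalars_def cok_def Let_def mi cc_def Vs sc)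
    also have "\<dots> = (\<Union>f'\<in>pcls Q f. \<Union>w\<in>cc v. cc (pmv f X v))"
      by (intro SUP_cong refl all)
    also have "\<dots> = cc (pmv f X v)" using ne by auto
    finally show ?thesis .
  qed
  show ?thesis
  proof
    assume ?L
    then obtain \<phi> where \<phi>: "\<phi> \<in> module_hom R (restrict_scalars \<sigma> (cok Q X)) M"
      and b: "bij_betw \<phi> (cc ` carrier_vec n) (carrier M)"
      by (auto simp: module_isomorphic_def module_isos_def C)
    show ?R
    proof (intro bexI[of _ "\<lambda>v :: 'a vec. \<phi> (cc v)"] conjI ballI)
      fix v w :: "'a vec" assume v: "v \<in> carrier_vec n" and w: "w \<in> carrier_vec n"
      show "\<phi> (cc (v + w)) = \<phi> (cc v) \<oplus>\<^bsub>M\<^esub> \<phi> (cc w)"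
        using module_hom_add[OF \<phi>, of "cc v" "cc w"] v w by (simp add: A C)
      show "\<phi> (cc v) = \<phi> (cc w) \<longleftrightarrow> v - w \<in> mat_image Q X"
        using b v w cc_eq[OF v w] by (auto simp: bij_betw_def N_def dest: inj_onD)
    next
      fix c f and v :: "'a vec" assume "c \<in> carrier R" "f \<in> \<sigma> c" "v \<in> carrier_vec n"
      then show "\<phi> (cc (pmv f X v)) = c \<odot>\<^bsub>M\<^esub> \<phi> (cc v)"
        using module_hom_smult[OF \<phi>, of c "cc v"] by (simp add: S C)
    next
      show "(\<lambda>v. \<phi> (cc v)) ` carrier_vec n = carrier M" using b by (auto simp: bij_betw_def)
      then show "(\<lambda>v. \<phi> (cc v)) \<in> carrier_vec n \<rightarrow> carrier M" by auto
    qed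
  next
    assume ?R
    then obtain F where R: "F \<in> carrier_vec n \<rightarrow> carrier M"
      "\<forall>v\<in>carrier_vec n. \<forall>w\<in>carrier_vec n. F (v + w) = F v \<oplus>\<^bsub>M\<^esub> F w"
      "\<forall>c\<in>carrier R. \<forall>f\<in>\<sigma> c. \<forall>v\<in>carrier_vec n. F (pmv f X v) = c \<odot>\<^bsub>M\<^esub> F v"
      "F ` carrier_vec n = carrier M"
      "\<forall>v\<in>carrier_vec n. \<forall>w\<in>carrier_vec n. F v = F w \<longleftrightarrow> v - w \<in> mat_image Q X"
      by (elim bexE conjE)
    note Fc = R(1) and Fadd = R(2)[rule_format] and Fs = R(3)[rule_format] and Fo = R(4) and Fk = R(5)[rule_format]
    (* F is constant on cosets, so any representative will do. *)
    define \<phi> where "\<phi> W = F (SOME v. v \<in> carrier_vec n \<and> cc v = W)" for W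
    have \<phi>: "\<phi> (cc v) = F v" if v: "v \<in> carrier_vec n" for v
    proof -
      define w where "w = (SOME w. w \<in> carrier_vec n \<and> cc w = cc v)"
      have "w \<in> carrier_vec n \<and> cc w = cc v" unfolding w_def by (rule someI[of _ v]) (use v in simp)
      then show ?thesis using cc_eq[of w v] Fk[of w v] v by (simp add: \<phi>_def w_def N_def)
    qed
    have "\<phi> \<in> module_hom R (restrict_scalars \<sigma> (cok Q X)) M"
      unfolding module_hom_def C
    proof (intro CollectI conjI ballI allI impI funcsetI)
      fix W assume "W \<in> cc ` carrier_vec n"
      then show "\<phi> W \<in> carrier M" using \<phi> Fc by auto
    next
      fix W W' assume "W \<in> cc ` carrier_vec n \<and> W' \<in> cc ` carrier_vec n"
      then show "\<phi> (W \<oplus>\<^bsub>restrict_scalars \<sigma> (cok Q X)\<^esub> W') = \<phi> W \<oplus>\<^bsub>M\<^esub> \<phi> W'"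
        using \<phi> Fadd by (auto simp: A)
    next
      fix c W assume "c \<in> carrier R \<and> W \<in> cc ` carrier_vec n"
      then obtain v where c: "c \<in> carrier R" and v: "v \<in> carrier_vec n" "W = cc v" by auto
      obtain f where f: "f \<in> \<sigma> c" using funcset_mem[OF \<sigma> c] by (auto simp: carrier_poly_quot)
      show "\<phi> (c \<odot>\<^bsub>restrict_scalars \<sigma> (cok Q X)\<^esub> W) = c \<odot>\<^bsub>M\<^esub> \<phi> W"
        using S[OF c f v(1)] v \<phi> Fs[OF c f v(1)] X by simp
    qed
    moreover have "bij_betw \<phi> (cc ` carrier_vec n) (carrier M)"
      unfolding bij_betw_def
    proof
      show "inj_on \<phi> (cc ` carrier_vec n)"
        using Fk cc_eq by (auto simp: inj_on_def \<phi> N_def)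
      have "\<phi> ` cc ` carrier_vec n = F ` carrier_vec n" using \<phi> by (force simp: image_iff)
      then show "\<phi> ` cc ` carrier_vec n = carrier M" using Fo by simp
    qed
    ultimately show ?L by (auto simp: module_isomorphic_def module_isos_def C)
  qed
qed

section \<open>Finite modules over Z_p[t]/(P) and their presentations\<close>

locale padic_module =
  fixes P :: "'p :: prime_card padic_int poly"
    and M :: "('p padic_int poly set, 'm) module" (structure)
    and n :: nat
  assumes module_M: "Module.module (poly_quot P) M" and fin: "finite (carrier M)"
begin

sublocale mod: Module.module "poly_quot P" M by (rule module_M)

definition act :: "'p padic_int poly \<Rightarrow> 'm \<Rightarrow> 'm" where
  "act f x = pcls P f \<odot>\<^bsub>M\<^esub> x"

abbreviation sc :: "'p padic_int \<Rightarrow> 'm \<Rightarrow> 'm" where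
  "sc a \<equiv> act [:a:]"

abbreviation pM :: "'p padic_int" where "pM \<equiv> of_nat CARD('p)"

lemma act_closed [simp]: "x \<in> carrier M \<Longrightarrow> act f x \<in> carrier M"
  by (simp add: act_def)

lemma act_add_poly: "x \<in> carrier M \<Longrightarrow> act (f + g) x = act f x \<oplus> act g x"
  using mod.smult_l_distr[of "pcls P f" "pcls P g" x] by (simp add: act_def)

lemma act_mult: "x \<in> carrier M \<Longrightarrow> act (f * g) x = act f (act g x)"
  using mod.smult_assoc1[of "pcls P f" "pcls P g" x] by (simp add: act_def)

lemma act_add: "x \<in> carrier M \<Longrightarrow> y \<in> carrier M \<Longrightarrow> act f (x \<oplus> y) = act f x \<oplus> act f y"
  by (simp add: act_def mod.smult_r_distr)

lemma act_1 [simp]: "x \<in> carrier M \<Longrightarrow> act 1 x = x"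
  using mod.smult_one[of x] by (simp add: act_def)

lemma act_one_const [simp]: "x \<in> carrier M \<Longrightarrow> sc 1 x = x"
  using act_1[of x] by (simp add: one_pCons)

lemma act_0 [simp]: "x \<in> carrier M \<Longrightarrow> act 0 x = \<zero>"
  using mod.smult_l_null[of x] by (simp add: act_def)

lemma act_zero [simp]: "act f \<zero> = \<zero>"
  by (simp add: act_def)

lemma act_minus: "x \<in> carrier M \<Longrightarrow> y \<in> carrier M \<Longrightarrow> act f (x \<ominus> y) = act f x \<ominus> act f y"
  by (simp add: act_def a_minus_def mod.smult_r_distr mod.smult_r_minus)

lemma act_P: "x \<in> carrier M \<Longrightarrow> act P x = \<zero>"
  using act_0[of x] pcls_eq_iff[of P P 0] by (simp add: act_def)

lemma act_P_mult: "x \<in> carrier M \<Longrightarrow> act (P * f) x = \<zero>"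
  by (simp add: act_mult act_P)

lemma act_comm: "x \<in> carrier M \<Longrightarrow> act f (act g x) = act g (act f x)"
  by (metis act_mult mult.commute)

lemma sc_mult: "x \<in> carrier M \<Longrightarrow> sc (a * b) x = sc a (sc b x)"
  using act_mult[of x "[:a:]" "[:b:]"] by (simp add: mult.commute)

lemma sc_add: "x \<in> carrier M \<Longrightarrow> sc (a + b) x = sc a x \<oplus> sc b x"
  using act_add_poly[of x "[:a:]" "[:b:]"] by simp

lemma act_pCons: "x \<in> carrier M \<Longrightarrow> act (pCons a f) x = sc a x \<oplus> act [:0, 1:] (act f x)"
proof -
  assume x: "x \<in> carrier M"
  have "pCons a f = [:a:] + [:0, 1:] * f" by simp
  then show ?thesis using x by (simp only: act_add_poly act_mult)
qed

lemma add_pow_eq_sc: "x \<in> carrier M \<Longrightarrow> [m] \<cdot> x = sc (of_nat m) x" for m :: nat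
proof (induction m)
  case (Suc m)
  then show ?case using sc_add[of x "of_nat m" 1] by (simp add: add.commute)
qed simp

text \<open>
  As the module is finite, \<open>p^i x = p^j x\<close> for some \<open>i < j\<close>. Then \<open>(1 - p c) p^i x = 0\<close> for
  some \<open>c\<close>, and \<open>1 - p c\<close> is a unit.
\<close>

lemma sc_p_power_kills_elem:
  assumes x: "x \<in> carrier M"
  shows "\<exists>k. sc (pM ^ k) x = \<zero>"
proof -
  define g where "g i = sc (pM ^ i) x" for i :: nat
  have "finite (range g)"
    by (rule finite_subset[OF _ fin]) (use x in \<open>auto simp: g_def\<close>)
  then have "\<not> inj g" using finite_imageD infinite_UNIV_nat by blast
  then obtain i j where "i \<noteq> j" "g i = g j" by (auto simp: inj_def)
  then obtain i j where "i < j" "g i = g j" by (metis nat_neq_iff)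
  then have ij: "i < j" "sc (pM ^ i) x = sc (pM ^ j) x" by (simp_all add: g_def)
  define c where "c = pM ^ (j - i - 1)"
  have pj: "pM ^ j = pM ^ i * (pM * c)"
  proof -
    have "j = i + Suc (j - i - 1)" using ij by simp
    then show ?thesis unfolding c_def by (metis power_Suc power_add)
  qed
  obtain u where u: "(1 - pM * c) * u = 1" using one_minus_p_mult_unit by blast
  define y where "y = sc (pM ^ i) x"
  have y: "y \<in> carrier M" using x by (simp add: y_def)
  have "y = sc ((pM * c) * pM ^ i) x"
    unfolding y_def ij(2) pj by (subst mult.commute) (rule refl)
  then have "y = sc (pM * c) y" unfolding y_def using sc_mult[OF x] by simp
  then have "sc (1 - pM * c) y \<oplus> y = \<zero> \<oplus> y"
    using sc_add[OF y, of "1 - pM * c" "pM * c"] y by simp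
  then have "sc (1 - pM * c) y = \<zero>" using y by (simp add: mod.M.add.right_cancel)
  then have "sc u (sc (1 - pM * c) y) = \<zero>" by simp
  then have "sc (u * (1 - pM * c)) y = \<zero>" using y by (simp add: sc_mult)
  then have "y = \<zero>" using y u by (simp add: mult.commute)
  then show ?thesis unfolding y_def by blast
qed

lemma sc_p_power_kills: "\<exists>k. \<forall>x \<in> carrier M. sc (pM ^ k) x = \<zero>"
proof -
  obtain K where K: "\<And>x. x \<in> carrier M \<Longrightarrow> sc (pM ^ K x) x = \<zero>"
    using sc_p_power_kills_elem by metis
  have "sc (pM ^ (\<Sum>y\<in>carrier M. K y)) x = \<zero>" if x: "x \<in> carrier M" for x
  proof -
    (* The sum of the exponents serves as a common upper bound. *)
    have "(\<Sum>y\<in>carrier M. K y) = (\<Sum>y\<in>carrier M - {x}. K y) + K x"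
      using fin x by (simp add: sum.remove)
    then show ?thesis using x K by (simp add: power_add sc_mult)
  qed
  then show ?thesis by blast
qed

section \<open>Linear maps from Z_p^n\<close>

text \<open>
  The maps are extensional so that they can be counted.
\<close>

definition lin :: "('p padic_int vec \<Rightarrow> 'm) set" where
  "lin = {F \<in> carrier_vec n \<rightarrow>\<^sub>E carrier M.
     (\<forall>v\<in>carrier_vec n. \<forall>w\<in>carrier_vec n. F (v + w) = F v \<oplus> F w) \<and>
     (\<forall>a. \<forall>v\<in>carrier_vec n. F (a \<cdot>\<^sub>v v) = sc a (F v))}"

lemma linD:
  assumes "F \<in> lin"
  shows "v \<in> carrier_vec n \<Longrightarrow> F v \<in> carrier M"
    "v \<in> carrier_vec n \<Longrightarrow> w \<in> carrier_vec n \<Longrightarrow> F (v + w) = F v \<oplus> F w"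
    "v \<in> carrier_vec n \<Longrightarrow> F (a \<cdot>\<^sub>v v) = sc a (F v)"
    "F \<in> extensional (carrier_vec n)"
  using assms by (auto simp: lin_def PiE_def)

lemma lin_zero: "F \<in> lin \<Longrightarrow> F (0\<^sub>v n) = \<zero>"
  using linD(3)[of F "0\<^sub>v n" 0] linD(1)[of F "0\<^sub>v n"] by (simp add: smult_zero_vec_right)

lemma lin_minus:
  assumes F: "F \<in> lin" and v: "v \<in> carrier_vec n" "w \<in> carrier_vec n"
  shows "F (v - w) = F v \<ominus> F w"
proof -
  have "F (v - w) \<oplus> F w = F v"
    using linD(2)[OF F minus_carrier_vec[OF v] v(2)] minus_add_cancel_vec[OF v] by simp
  then show ?thesis
    using linD(1)[OF F v(1)] linD(1)[OF F v(2)] linD(1)[OF F minus_carrier_vec[OF v]]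
    by (simp add: a_minus_def mod.M.add.inv_solve_right)
qed

lemma lin_eq_iff:
  assumes F: "F \<in> lin" and v: "v \<in> carrier_vec n" "w \<in> carrier_vec n"
  shows "F v = F w \<longleftrightarrow> F (v - w) = \<zero>"
  using lin_minus[OF F v] linD(1)[OF F] v by simp

text \<open>
  The linear map with values \<open>z j\<close> at the standard basis, truncated to the first \<open>k\<close>
  coordinates so that its properties can be proved by induction on \<open>k\<close>.
\<close>

primrec ev :: "(nat \<Rightarrow> 'm) \<Rightarrow> nat \<Rightarrow> 'p padic_int vec \<Rightarrow> 'm" where
  "ev z 0 v = \<zero>"
| "ev z (Suc k) v = ev z k v \<oplus> sc (v $ k) (z k)"

lemma ev_closed: "(\<And>j. j < k \<Longrightarrow> z j \<in> carrier M) \<Longrightarrow> ev z k v \<in> carrier M"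
  by (induction k) auto

lemma ev_lin:
  assumes z: "\<And>j. j < n \<Longrightarrow> z j \<in> carrier M"
  shows "restrict (ev z n) (carrier_vec n) \<in> lin"
proof -
  have c: "ev z k v \<in> carrier M" if "k \<le> n" for k v using z that by (intro ev_closed) auto
  have add: "ev z k (v + w) = ev z k v \<oplus> ev z k w"
    if "k \<le> n" "v \<in> carrier_vec n" "w \<in> carrier_vec n" for k v w
    using that
  proof (induction k)
    case (Suc k)
    have "ev z k (v + w) = ev z k v \<oplus> ev z k w" using Suc by simp
    moreover have "z k \<in> carrier M" "ev z k v \<in> carrier M" "ev z k w \<in> carrier M" using c z Suc.prems by auto
    ultimately show ?case using Suc.prems by (simp add: sc_add mod.M.a_ac)
  qed simp
  have sm: "ev z k (a \<cdot>\<^sub>v v) = sc a (ev z k v)" if "k \<le> n" "v \<in> carrier_vec n" for k v a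
    using that by (induction k) (use c z in \<open>auto simp: sc_mult act_add\<close>)
  show ?thesis using c add sm by (auto simp: lin_def)
qed

lemma ev_unit:
  assumes z: "\<And>j. j < n \<Longrightarrow> z j \<in> carrier M" and k: "k \<le> n" and i: "i < n"
  shows "ev z k (unit_vec n i) = (if i < k then z i else \<zero>)"
  using k by (induction k) (use z i in \<open>auto simp: unit_vec_def less_Suc_eq\<close>)

lemma lin_eq_ev:
  assumes F: "F \<in> lin" and v: "v \<in> carrier_vec n"
  shows "F v = ev (\<lambda>j. F (unit_vec n j)) n v"
proof -
  (* The vector v with all coordinates from k onwards replaced by 0. *)
  let ?v = "\<lambda>k. vec n (\<lambda>i. if i < k then v $ i else 0)"
  have main: "F (?v k) = ev (\<lambda>j. F (unit_vec n j)) k v" if "k \<le> n" for k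
    using that
  proof (induction k)
    case 0
    have "?v 0 = 0\<^sub>v n" by auto
    then show ?case using lin_zero[OF F] by simp
  next
    case (Suc k)
    have "?v (Suc k) = ?v k + v $ k \<cdot>\<^sub>v unit_vec n k"
      by (intro eq_vecI) (use Suc.prems in \<open>auto simp: unit_vec_def dest: less_antisym\<close>)
    then have "F (?v (Suc k)) = F (?v k) \<oplus> sc (v $ k) (F (unit_vec n k))"
      using linD(2)[OF F, of "?v k" "v $ k \<cdot>\<^sub>v unit_vec n k"] linD(3)[OF F, of "unit_vec n k"] by simp
    then show ?case using Suc by simp
  qed
  have "?v n = v" using v by auto
  then show ?thesis using main[of n] by simp
qed

lemma lin_eqI:
  assumes F: "F \<in> lin" "F' \<in> lin" and eq: "\<And>j. j < n \<Longrightarrow> F (unit_vec n j) = F' (unit_vec n j)"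
  shows "F = F'"
proof (rule extensionalityI[OF linD(4)[OF F(1)] linD(4)[OF F(2)]])
  fix v :: "'p padic_int vec" assume v: "v \<in> carrier_vec n"
  have "ev (\<lambda>j. F (unit_vec n j)) k v = ev (\<lambda>j. F' (unit_vec n j)) k v" if "k \<le> n" for k
    using that by (induction k) (auto simp: eq)
  then show "F v = F' v" unfolding lin_eq_ev[OF F(1) v] lin_eq_ev[OF F(2) v] by simp
qed

lemma lin_prescribe:
  assumes z: "\<And>j. j < n \<Longrightarrow> z j \<in> carrier M"
  shows "\<exists>F \<in> lin. \<forall>j<n. F (unit_vec n j) = z j"
  by (rule bexI[OF _ ev_lin[OF z]]) (use ev_unit[OF z] in auto)

text \<open>
  \<open>\<int>\<^sub>p^n\<close> is free on the standard basis.
\<close>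

lemma card_lin_values:
  assumes "\<And>j. j < n \<Longrightarrow> A j \<subseteq> carrier M"
  shows "card {F \<in> lin. \<forall>j<n. F (unit_vec n j) \<in> A j} = (\<Prod>j<n. card (A j))"
proof -
  let ?r = "\<lambda>F. \<lambda>j\<in>{..<n}. F (unit_vec n j)"
  have "bij_betw ?r {F \<in> lin. \<forall>j<n. F (unit_vec n j) \<in> A j} (PiE {..<n} A)"
  proof (rule bij_betwI')
    fix F F' assume "F \<in> {F \<in> lin. \<forall>j<n. F (unit_vec n j) \<in> A j}" "F' \<in> {F \<in> lin. \<forall>j<n. F (unit_vec n j) \<in> A j}"
    then have F: "F \<in> lin" "F' \<in> lin" by auto
    show "(?r F = ?r F') = (F = F')"
    proof
      assume eq: "?r F = ?r F'"
      show "F = F'"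
      proof (rule lin_eqI[OF F])
        fix j assume "j < n"
        then show "F (unit_vec n j) = F' (unit_vec n j)" using fun_cong[OF eq, of j] by simp
      qed
    qed simp
  next
    fix z assume z: "z \<in> PiE {..<n} A"
    then have "z j \<in> carrier M" if "j < n" for j using assms that by auto
    then obtain F where F: "F \<in> lin" "\<forall>j<n. F (unit_vec n j) = z j" using lin_prescribe by blast
    have "z = ?r F" using z F by (auto simp: PiE_def extensional_def fun_eq_iff)
    then show "\<exists>F\<in>{F \<in> lin. \<forall>j<n. F (unit_vec n j) \<in> A j}. z = ?r F"
      using F z by (intro bexI[of _ F]) auto
  qed auto
  then show ?thesis by (simp add: bij_betw_same_card card_PiE)
qed

lemma card_lin: "card lin = card (carrier M) ^ n"
proof -
  have "{F \<in> lin. \<forall>j<n. F (unit_vec n j) \<in> carrier M} = lin" using linD(1) by auto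
  then show ?thesis using card_lin_values[of "\<lambda>_. carrier M"] by simp
qed

lemma finite_lin: "finite lin"
proof (cases "n = 0")
  case False
  have "carrier M \<noteq> {}" using mod.M.zero_closed by blast
  then have "card lin > 0" using fin card_lin by (simp add: card_gt_0_iff)
  then show ?thesis using card_ge_0_finite by blast
next
  case True
  have "card lin = 1" using card_lin True by simp
  then show ?thesis using card_ge_0_finite by force
qed

definition lcomp :: "('p padic_int vec \<Rightarrow> 'm) \<Rightarrow> 'p padic_int mat \<Rightarrow> 'p padic_int vec \<Rightarrow> 'm" where
  "lcomp F Y = (\<lambda>v\<in>carrier_vec n. F (Y *\<^sub>v v))"

lemma lcomp_lin:
  assumes F: "F \<in> lin" and Y: "Y \<in> carrier_mat n n"
  shows "lcomp F Y \<in> lin"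
  using linD[OF F] mult_mat_vec_carrier[OF Y]
  by (auto simp: lin_def lcomp_def mult_add_distrib_mat_vec[OF Y] mat_vec_smult[OF Y])

text \<open>
  \<open>\<int>\<^sub>p^n\<close> is projective: the columns of \<open>Y\<close> are preimages under \<open>F\<close> of the values of \<open>Z\<close> at
  the standard basis.
\<close>

lemma lin_surj_lift:
  assumes F: "F \<in> lin" and surj: "F ` carrier_vec n = carrier M" and Z: "Z \<in> lin"
  shows "\<exists>Y \<in> carrier_mat n n. lcomp F Y = Z"
proof -
  have "\<exists>v. v \<in> carrier_vec n \<and> F v = Z (unit_vec n j)" for j
  proof -
    have "Z (unit_vec n j) \<in> F ` carrier_vec n" using surj linD(1)[OF Z] by simp
    then show ?thesis by auto
  qed
  then obtain y where y: "\<And>j. y j \<in> carrier_vec n \<and> F (y j) = Z (unit_vec n j)" by metis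
  define Y where "Y = mat n n (\<lambda>(i, j). y j $ i)"
  have Y: "Y \<in> carrier_mat n n" by (simp add: Y_def)
  have "Y *\<^sub>v unit_vec n j = y j" if j: "j < n" for j
  proof -
    have "Y *\<^sub>v unit_vec n j = col Y j" using Y j by (intro eq_vecI) auto
    also have "\<dots> = y j" using y[of j] j by (intro eq_vecI) (auto simp: Y_def)
    finally show ?thesis .
  qed
  then have "lcomp F Y = Z"
    using y by (intro lin_eqI[OF lcomp_lin[OF F Y] Z]) (auto simp: lcomp_def)
  then show ?thesis using Y by blast
qed

section \<open>Presentations\<close>

text \<open>
  For \<open>N = P(X) \<int>\<^sub>p^n\<close> these are the isomorphisms from the cokernel of \<open>P(X)\<close> to \<open>M\<close>, read as
  maps on \<open>\<int>\<^sub>p^n\<close>. Other choices of \<open>N\<close> allow the cokernel modulo \<open>p\<close> to be treated in the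
  same way.
\<close>

definition pres :: "'p padic_int mat \<Rightarrow> 'p padic_int vec set \<Rightarrow> ('p padic_int vec \<Rightarrow> 'm) set" where
  "pres X N = {F \<in> lin. (\<forall>v\<in>carrier_vec n. F (X *\<^sub>v v) = act [:0, 1:] (F v)) \<and>
     F ` carrier_vec n = carrier M \<and> (\<forall>v\<in>carrier_vec n. F v = \<zero> \<longleftrightarrow> v \<in> N)}"

lemma lin_act:
  assumes F: "F \<in> lin" and X: "X \<in> carrier_mat n n"
    and FX: "\<And>v. v \<in> carrier_vec n \<Longrightarrow> F (X *\<^sub>v v) = act [:0, 1:] (F v)" and v: "v \<in> carrier_vec n"
  shows "F (pmv f X v) = act f (F v)"
proof (induction f)
  case 0
  then show ?case using X v lin_zero[OF F] linD(1)[OF F v] by (simp add: pmv_0)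
next
  case (pCons a f)
  have c: "pmv f X v \<in> carrier_vec n" using X v by simp
  then show ?case
    using pCons.IH X v linD[OF F] FX[OF c] mult_mat_vec_carrier[OF X c]
    by (simp add: pmv_pCons[OF X v] act_pCons[of "F v" a f])
qed

lemma pres_act:
  assumes "F \<in> pres X N" "X \<in> carrier_mat n n" "v \<in> carrier_vec n"
  shows "F (pmv f X v) = act f (F v)"
  by (rule lin_act) (use assms in \<open>auto simp: pres_def\<close>)

text \<open>
  Two surjections with the same kernel differ by a unique bijection of \<open>M\<close>. It is linear over
  \<open>\<int>\<^sub>p[t]/(P)\<close> because both surjections turn \<open>X\<close> into \<open>t\<close>. So composition with automorphisms
  acts simply transitively on presentations with kernel \<open>N\<close>.
\<close>

lemma card_pres:
  assumes F0: "F0 \<in> pres X N" and X: "X \<in> carrier_mat n n"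
  shows "card (pres X N) = card (module_aut (poly_quot P) M)"
proof -
  have L: "F \<in> lin" and surj: "F ` carrier_vec n = carrier M"
    and ker: "\<And>v. v \<in> carrier_vec n \<Longrightarrow> F v = \<zero> \<longleftrightarrow> v \<in> N" if "F \<in> pres X N" for F
    using that by (auto simp: pres_def)
  have eq_iff: "F v = F w \<longleftrightarrow> v - w \<in> N" if F: "F \<in> pres X N" and v: "v \<in> carrier_vec n" "w \<in> carrier_vec n" for F v w
    using ker[OF F minus_carrier_vec[OF v]] lin_minus[OF L[OF F] v] linD(1)[OF L[OF F]] v by simp
  let ?R = "poly_quot P"
  let ?h = "\<lambda>\<alpha>. \<lambda>v\<in>carrier_vec n. \<alpha> (F0 v)"
  have "bij_betw ?h (module_aut ?R M) (pres X N)"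
  proof (rule bij_betwI')
    fix \<alpha> \<beta> assume "\<alpha> \<in> module_aut ?R M" "\<beta> \<in> module_aut ?R M"
    then have e: "\<alpha> \<in> extensional (carrier M)" "\<beta> \<in> extensional (carrier M)" by (auto simp: module_aut_def)
    show "(?h \<alpha> = ?h \<beta>) = (\<alpha> = \<beta>)"
    proof
      assume eq: "?h \<alpha> = ?h \<beta>"
      show "\<alpha> = \<beta>"
      proof (rule extensionalityI[OF e])
        fix x assume "x \<in> carrier M"
        then obtain v where v: "v \<in> carrier_vec n" "x = F0 v" using surj[OF F0] by blast
        then show "\<alpha> x = \<beta> x" using fun_cong[OF eq, of v] by simp
      qed
    qed simp
  next
    fix \<alpha> assume a: "\<alpha> \<in> module_aut ?R M"
    then have h: "\<alpha> \<in> module_hom ?R M M" and b: "bij_betw \<alpha> (carrier M) (carrier M)"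
      by (auto simp: module_aut_def module_isos_def)
    have ac: "\<alpha> (act f x) = act f (\<alpha> x)" if "x \<in> carrier M" for f x
      using module_hom_smult[OF h, of "pcls P f" x] that by (simp add: act_def)
    have ad: "\<alpha> (x \<oplus> y) = \<alpha> x \<oplus> \<alpha> y" if "x \<in> carrier M" "y \<in> carrier M" for x y
      using module_hom_add[OF h] that by simp
    have cl: "\<alpha> x \<in> carrier M" if "x \<in> carrier M" for x using b that by (auto simp: bij_betw_def)
    have z: "\<alpha> x = \<zero> \<longleftrightarrow> x = \<zero>" if x: "x \<in> carrier M" for x
    proof -
      have "\<alpha> \<zero> = \<zero>" using ac[of \<zero> 0] cl[of \<zero>] by simp
      then show ?thesis using b x inj_onD[of \<alpha> "carrier M" x \<zero>] by (auto simp: bij_betw_def)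
    qed
    have "?h \<alpha> \<in> lin"
      using linD[OF L[OF F0]] by (auto simp: lin_def cl ad ac)
    moreover have "?h \<alpha> ` carrier_vec n = carrier M"
    proof -
      have "?h \<alpha> ` carrier_vec n = \<alpha> ` F0 ` carrier_vec n" by (auto simp: image_iff)
      then show ?thesis using surj[OF F0] b by (simp add: bij_betw_def)
    qed
    moreover have "F0 (X *\<^sub>v v) = act [:0, 1:] (F0 v)" if "v \<in> carrier_vec n" for v
      using F0 that by (auto simp: pres_def)
    ultimately show "?h \<alpha> \<in> pres X N"
      using linD(1)[OF L[OF F0]] mult_mat_vec_carrier[OF X] by (auto simp: pres_def ac z ker[OF F0])
  next
    fix F assume F: "F \<in> pres X N"
    (* A section of F0; the automorphism to be found is F after this section. *)
    define c where "c x = (SOME v. v \<in> carrier_vec n \<and> F0 v = x)" for x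
    have c: "c x \<in> carrier_vec n" "F0 (c x) = x" if "x \<in> carrier M" for x
    proof -
      have "x \<in> F0 ` carrier_vec n" using surj[OF F0] that by simp
      then have "\<exists>v. v \<in> carrier_vec n \<and> F0 v = x" by auto
      then have "c x \<in> carrier_vec n \<and> F0 (c x) = x" unfolding c_def by (rule someI_ex)
      then show "c x \<in> carrier_vec n" "F0 (c x) = x" by auto
    qed
    define \<alpha> where "\<alpha> = (\<lambda>x\<in>carrier M. F (c x))"
    have aF: "\<alpha> (F0 v) = F v" if v: "v \<in> carrier_vec n" for v
    proof -
      have m: "F0 v \<in> carrier M" using linD(1)[OF L[OF F0] v] .
      have "F (c (F0 v)) = F v" using eq_iff[OF F0 c(1)[OF m] v] eq_iff[OF F c(1)[OF m] v] c(2)[OF m] by simp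
      then show ?thesis using m by (simp add: \<alpha>_def)
    qed
    have ex: "\<exists>v\<in>carrier_vec n. x = F0 v" if "x \<in> carrier M" for x using surj[OF F0] that by blast
    have "\<alpha> \<in> module_hom ?R M M"
      unfolding module_hom_def
    proof (intro CollectI conjI allI impI funcsetI)
      fix x assume "x \<in> carrier M"
      then show "\<alpha> x \<in> carrier M" using c linD(1)[OF L[OF F]] by (simp add: \<alpha>_def)
    next
      fix x y assume "x \<in> carrier M \<and> y \<in> carrier M"
      then obtain v w where vw: "v \<in> carrier_vec n" "x = F0 v" "w \<in> carrier_vec n" "y = F0 w" using ex by metis
      then have "x \<oplus> y = F0 (v + w)" using linD(2)[OF L[OF F0]] by simp
      then show "\<alpha> (x \<oplus> y) = \<alpha> x \<oplus> \<alpha> y"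
        using vw aF linD(2)[OF L[OF F]] by simp
    next
      fix r x assume rx: "r \<in> carrier ?R \<and> x \<in> carrier M"
      then obtain f where f: "r = pcls P f" by (auto simp: carrier_poly_quot)
      obtain v where v: "v \<in> carrier_vec n" "x = F0 v" using rx ex by metis
      have "r \<odot>\<^bsub>M\<^esub> x = F0 (pmv f X v)" using pres_act[OF F0 X v(1), of f] by (simp add: f v act_def)
      then have "\<alpha> (r \<odot>\<^bsub>M\<^esub> x) = F (pmv f X v)" using aF X v by simp
      also have "\<dots> = r \<odot>\<^bsub>M\<^esub> \<alpha> x" using pres_act[OF F X v(1), of f] aF v by (simp add: f act_def)
      finally show "\<alpha> (r \<odot>\<^bsub>M\<^esub> x) = r \<odot>\<^bsub>M\<^esub> \<alpha> x" .
    qed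
    moreover have "bij_betw \<alpha> (carrier M) (carrier M)"
      unfolding bij_betw_def
    proof
      show "inj_on \<alpha> (carrier M)"
      proof (rule inj_onI)
        fix x y assume xy: "x \<in> carrier M" "y \<in> carrier M" "\<alpha> x = \<alpha> y"
        then obtain v w where vw: "v \<in> carrier_vec n" "x = F0 v" "w \<in> carrier_vec n" "y = F0 w" using ex by metis
        then show "x = y" using xy aF eq_iff[OF F0] eq_iff[OF F] by simp
      qed
      have "\<alpha> ` carrier M = \<alpha> ` F0 ` carrier_vec n" using surj[OF F0] by simp
      also have "\<dots> = F ` carrier_vec n" using aF by (force simp: image_iff)
      finally show "\<alpha> ` carrier M = carrier M" using surj[OF F] by simp
    qed
    ultimately have "\<alpha> \<in> module_aut ?R M" by (simp add: module_aut_def module_isos_def \<alpha>_def)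
    moreover have "F = ?h \<alpha>"
      by (rule extensionalityI[OF linD(4)[OF L[OF F]] restrict_extensional]) (simp add: aF)
    ultimately show "\<exists>\<alpha>\<in>module_aut ?R M. F = ?h \<alpha>" by blast
  qed
  then show ?thesis by (simp add: bij_betw_same_card)
qed

text \<open>
  As the ring \<open>\<int>\<^sub>p[t]/(P)\<close> is generated by \<open>t\<close> and the scalars, compatibility with these
  suffices.
\<close>

lemma cok_isomorphic_iff_pres:
  assumes X: "X \<in> carrier_mat n n"
  shows "module_isomorphic (poly_quot P) (cok P X) M \<longleftrightarrow> pres X (mat_image P X) \<noteq> {}"
proof -
  have r: "module_isomorphic (poly_quot P) (cok P X) M =
      module_isomorphic (poly_quot P) (restrict_scalars (\<lambda>r. r) (cok P X)) M"
    by (simp add: module_isomorphic_def module_isos_def module_hom_def restrict_scalars_def)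
  show ?thesis
    unfolding r cok_isomorphic_iff[where R = "poly_quot P" and \<sigma> = "\<lambda>r. r" and Q = P and M = M, OF X, simplified]
  proof (intro iffI)
    assume "\<exists>F\<in>carrier_vec n \<rightarrow> carrier M.
       (\<forall>v\<in>carrier_vec n. \<forall>w\<in>carrier_vec n. F (v + w) = F v \<oplus> F w) \<and>
       (\<forall>c\<in>carrier (poly_quot P). \<forall>f\<in>c. \<forall>v\<in>carrier_vec n. F (pmv f X v) = c \<odot>\<^bsub>M\<^esub> F v) \<and>
       F ` carrier_vec n = carrier M \<and>
       (\<forall>v\<in>carrier_vec n. \<forall>w\<in>carrier_vec n. (F v = F w) = (v - w \<in> mat_image P X))"
    then obtain F where F: "F \<in> carrier_vec n \<rightarrow> carrier M"
      "\<forall>v\<in>carrier_vec n. \<forall>w\<in>carrier_vec n. F (v + w) = F v \<oplus> F w"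
      "\<forall>c\<in>carrier (poly_quot P). \<forall>f\<in>c. \<forall>v\<in>carrier_vec n. F (pmv f X v) = c \<odot>\<^bsub>M\<^esub> F v"
      "F ` carrier_vec n = carrier M"
      "\<forall>v\<in>carrier_vec n. \<forall>w\<in>carrier_vec n. (F v = F w) = (v - w \<in> mat_image P X)"
      by (elim bexE conjE)
    have Fa: "F (pmv f X v) = act f (F v)" if "v \<in> carrier_vec n" for f v
      using F(3)[THEN bspec, OF pcls_carrier[of P f], THEN bspec, of f, THEN bspec, OF _ that] by (simp add: act_def)
    have Fs: "F (a \<cdot>\<^sub>v v) = sc a (F v)" if "v \<in> carrier_vec n" for a v
      using Fa[OF that, of "[:a:]"] pmv_const[OF X that] by simp
    have Ft: "F (X *\<^sub>v v) = act [:0, 1:] (F v)" if "v \<in> carrier_vec n" for v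
      using Fa[OF that, of "[:0, 1:]"] pmv_t[OF X that] by simp
    have F0: "F (0\<^sub>v n) = \<zero>" using Fs[of "0\<^sub>v n" 0] funcset_mem[OF F(1) zero_carrier_vec] by (simp add: smult_zero_vec_right)
    have Fk: "F v = \<zero> \<longleftrightarrow> v \<in> mat_image P X" if v: "v \<in> carrier_vec n" for v
    proof -
      have "v - 0\<^sub>v n = v" using v by auto
      then show ?thesis using F(5)[rule_format, OF v zero_carrier_vec] F0 by simp
    qed
    have "restrict F (carrier_vec n) \<in> pres X (mat_image P X)"
      using F(1,2,4) Fs Ft Fk mult_mat_vec_carrier[OF X] by (auto simp: pres_def lin_def)
    then show "pres X (mat_image P X) \<noteq> {}" by blast
  next
    assume "pres X (mat_image P X) \<noteq> {}"
    then obtain F where F: "F \<in> pres X (mat_image P X)" by blast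
    then have L: "F \<in> lin" by (simp add: pres_def)
    have "F (pmv f X v) = c \<odot>\<^bsub>M\<^esub> F v" if "c \<in> carrier (poly_quot P)" "f \<in> c" "v \<in> carrier_vec n" for c f v
    proof -
      have "c = pcls P f" using that by (auto simp: carrier_poly_quot)
      then show ?thesis using pres_act[OF F X that(3)] by (simp add: act_def)
    qed
    moreover have "(F v = F w) = (v - w \<in> mat_image P X)" if v: "v \<in> carrier_vec n" "w \<in> carrier_vec n" for v w
      using F minus_carrier_vec[OF v] unfolding lin_eq_iff[OF L v] by (simp add: pres_def)
    ultimately show "\<exists>F\<in>carrier_vec n \<rightarrow> carrier M.
       (\<forall>v\<in>carrier_vec n. \<forall>w\<in>carrier_vec n. F (v + w) = F v \<oplus> F w) \<and>
       (\<forall>c\<in>carrier (poly_quot P). \<forall>f\<in>c. \<forall>v\<in>carrier_vec n. F (pmv f X v) = c \<odot>\<^bsub>M\<^esub> F v) \<and>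
       F ` carrier_vec n = carrier M \<and>
       (\<forall>v\<in>carrier_vec n. \<forall>w\<in>carrier_vec n. (F v = F w) = (v - w \<in> mat_image P X))"
      using F linD[OF L] by (intro bexI[of _ F]) (auto simp: pres_def)
  qed
qed

text \<open>
  With this set in place of \<open>P(X) \<int>\<^sub>p^n\<close>, presentations of the cokernel modulo \<open>p\<close> are maps on
  \<open>\<int>\<^sub>p^n\<close> as well.
\<close>

definition res_image :: "'p mod_ring mat \<Rightarrow> 'p padic_int vec set" where
  "res_image Xbar = {v \<in> carrier_vec n. rvec v \<in> mat_image (poly_residue P) Xbar}"

lemma rvec_add: "v \<in> carrier_vec n \<Longrightarrow> w \<in> carrier_vec n \<Longrightarrow> rvec (v + w) = rvec v + rvec (w :: 'p padic_int vec)"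
  by (intro eq_vecI) (auto simp: residue_hom)

lemma rvec_smult: "rvec (a \<cdot>\<^sub>v v) = residue a \<cdot>\<^sub>v rvec (v :: 'p padic_int vec)"
  by (intro eq_vecI) (auto simp: residue_hom)

text \<open>
  An isomorphism from the cokernel modulo \<open>p\<close> is pulled back to \<open>\<int>\<^sub>p^n\<close> along the reduction
  map.
\<close>

lemma cok_residue_isomorphic_pres:
  assumes Xb: "Xbar \<in> carrier_mat n n" and X: "X \<in> carrier_mat n n" "rmat X = Xbar"
    and iso: "module_isomorphic (poly_quot P) (restrict_scalars quot_residue (cok (poly_residue P) Xbar)) M"
  shows "pres X (res_image Xbar) \<noteq> {}"
proof -
  let ?Q = "poly_residue P"
  have \<sigma>: "quot_residue \<in> carrier (poly_quot P) \<rightarrow> carrier (poly_quot ?Q)"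
    by (auto simp: carrier_poly_quot quot_residue_pcls)
  from iffD1[OF cok_isomorphic_iff[where R = "poly_quot P" and \<sigma> = quot_residue and Q = ?Q and M = M, OF Xb \<sigma>] iso]
  obtain F where F: "F \<in> carrier_vec n \<rightarrow> carrier M"
      "\<forall>v\<in>carrier_vec n. \<forall>w\<in>carrier_vec n. F (v + w) = F v \<oplus> F w"
      "\<forall>c\<in>carrier (poly_quot P). \<forall>f\<in>quot_residue c. \<forall>v\<in>carrier_vec n. F (pmv f Xbar v) = c \<odot>\<^bsub>M\<^esub> F v"
      "F ` carrier_vec n = carrier M"
      "\<forall>v\<in>carrier_vec n. \<forall>w\<in>carrier_vec n. (F v = F w) = (v - w \<in> mat_image ?Q Xbar)"
    by (elim bexE conjE)
  define F' where "F' = (\<lambda>v\<in>carrier_vec n. F (rvec v))"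
  have Fa: "F (pmv (poly_residue f) Xbar v) = act f (F v)" if "v \<in> carrier_vec n" for f v
    using F(3)[THEN bspec, OF pcls_carrier[of P f], THEN bspec, of "poly_residue f", THEN bspec, OF _ that]
    by (simp add: act_def quot_residue_pcls)
  have Fs: "F (residue a \<cdot>\<^sub>v v) = sc a (F v)" if "v \<in> carrier_vec n" for a v
    using Fa[OF that, of "[:a:]"] pmv_const[OF Xb that] by simp
  have Ft: "F (Xbar *\<^sub>v v) = act [:0, 1:] (F v)" if "v \<in> carrier_vec n" for v
    using Fa[OF that, of "[:0, 1:]"] pmv_t[OF Xb that] by simp
  have F0: "F (0\<^sub>v n) = \<zero>" using Fs[of "0\<^sub>v n" 0] funcset_mem[OF F(1) zero_carrier_vec] by (simp add: smult_zero_vec_right)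
  have Fk: "F v = \<zero> \<longleftrightarrow> v \<in> mat_image ?Q Xbar" if v: "v \<in> carrier_vec n" for v
  proof -
    have "v - 0\<^sub>v n = v" using v by auto
    then show ?thesis using F(5)[rule_format, OF v zero_carrier_vec] F0 by simp
  qed
  have rX: "rvec (X *\<^sub>v v) = Xbar *\<^sub>v rvec v" if "v \<in> carrier_vec n" for v
    using residue.mult_mat_vec_hom[OF X(1) that] X(2) by simp
  have "F' \<in> lin"
    using F(1,2) Fs by (auto simp: lin_def F'_def rvec_add rvec_smult)
  moreover have "F' ` carrier_vec n = carrier M"
  proof -
    have "rvec ` carrier_vec n = (carrier_vec n :: 'p mod_ring vec set)"
    proof (intro equalityI subsetI)
      fix v :: "'p mod_ring vec" assume v: "v \<in> carrier_vec n"
      then show "v \<in> rvec ` carrier_vec n" using rvec_lift[OF v] by (intro image_eqI[of _ _ "map_vec lift_res v"]) auto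
    qed auto
    then have "F ` rvec ` carrier_vec n = carrier M" using F(4) by simp
    then show ?thesis by (simp add: F'_def image_image)
  qed
  ultimately have "F' \<in> pres X (res_image Xbar)"
    using mult_mat_vec_carrier[OF X(1)] by (auto simp: pres_def res_image_def F'_def rX Ft Fk)
  then show ?thesis by blast
qed

end

section \<open>Reduction modulo p and p-torsion\<close>

context padic_module
begin

definition pmult :: "'m set" where
  "pmult = sc pM ` carrier M"

text \<open>
  The module \<open>M/pM\<close>, with \<open>\<kappa>\<close> below as the map from \<open>M\<close> onto it.
\<close>

definition Mbar :: "('p padic_int poly set, 'm set) module" where
  "Mbar = quot_nat M CARD('p)"

definition \<kappa> :: "'m \<Rightarrow> 'm set" where
  "\<kappa> x = pmult +> x"

definition tors :: "('p padic_int poly set, 'm) module" where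
  "tors = M\<lparr>carrier := {x \<in> carrier M. sc pM x = \<zero>}\<rparr>"

lemma pmult_alt: "{[CARD('p)] \<cdot> x | x. x \<in> carrier M} = pmult"
  by (auto simp: pmult_def add_pow_eq_sc) (metis add_pow_eq_sc)

lemma pmult_closed: "x \<in> pmult \<Longrightarrow> x \<in> carrier M"
  by (auto simp: pmult_def)

lemma act_pmult: "x \<in> pmult \<Longrightarrow> act f x \<in> pmult"
  using act_comm[of _ f "[:pM:]"] by (auto simp: pmult_def)

lemma pmult_subgroup: "abelian_subgroup pmult M"
proof (rule abelian_subgroupI3[OF _ mod.M.abelian_group_axioms])
  show "additive_subgroup pmult M"
  proof (rule additive_subgroup.intro, rule mod.M.add.subgroupI)
    show "pmult \<subseteq> carrier M" using pmult_closed by auto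
    show "pmult \<noteq> {}" using mod.M.zero_closed by (auto simp: pmult_def)
  next
    fix a assume "a \<in> pmult"
    then obtain x where x: "x \<in> carrier M" "a = sc pM x" by (auto simp: pmult_def)
    then have "\<ominus> a = sc pM (\<ominus> x)" by (simp add: act_def mod.smult_r_minus)
    then show "\<ominus> a \<in> pmult" using x by (auto simp: pmult_def)
  next
    fix a b assume "a \<in> pmult" "b \<in> pmult"
    then obtain x y where x: "x \<in> carrier M" "a = sc pM x" "y \<in> carrier M" "b = sc pM y" by (auto simp: pmult_def)
    then have "a \<oplus> b = sc pM (x \<oplus> y)" by (simp add: act_add)
    then show "a \<oplus> b \<in> pmult" using x by (auto simp: pmult_def)
  qed
qed

sublocale pm: abelian_subgroup pmult M by (rule pmult_subgroup)

lemma \<kappa>_eq_iff: "x \<in> carrier M \<Longrightarrow> y \<in> carrier M \<Longrightarrow> \<kappa> x = \<kappa> y \<longleftrightarrow> x \<ominus> y \<in> pmult"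
  by (simp add: \<kappa>_def pm.rcos_eq_iff)

lemma Mbar_simps:
  "carrier Mbar = \<kappa> ` carrier M" "\<zero>\<^bsub>Mbar\<^esub> = pmult" "\<zero>\<^bsub>Mbar\<^esub> = \<kappa> \<zero>"
  "x \<in> carrier M \<Longrightarrow> y \<in> carrier M \<Longrightarrow> \<kappa> x \<oplus>\<^bsub>Mbar\<^esub> \<kappa> y = \<kappa> (x \<oplus> y)"
  "x \<in> carrier M \<Longrightarrow> pcls P f \<odot>\<^bsub>Mbar\<^esub> \<kappa> x = \<kappa> (act f x)"
proof -
  show "carrier Mbar = \<kappa> ` carrier M"
    by (simp add: Mbar_def quot_nat_def quot_module_def pmult_alt pm.rcosets_eq \<kappa>_def[abs_def])
  show "\<zero>\<^bsub>Mbar\<^esub> = pmult" by (simp add: Mbar_def quot_nat_def quot_module_def pmult_alt)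
  then show "\<zero>\<^bsub>Mbar\<^esub> = \<kappa> \<zero>" by (simp add: \<kappa>_def pm.rcos_zero)
  show "x \<in> carrier M \<Longrightarrow> y \<in> carrier M \<Longrightarrow> \<kappa> x \<oplus>\<^bsub>Mbar\<^esub> \<kappa> y = \<kappa> (x \<oplus> y)"
    by (simp add: Mbar_def quot_nat_def quot_module_def pmult_alt \<kappa>_def pm.a_rcos_sum)
  assume x: "x \<in> carrier M"
  have all: "\<kappa> (act f y) = \<kappa> (act f x)" if "y \<in> \<kappa> x" for y
  proof -
    have y: "y \<in> carrier M" using pm.a_elemrcos_carrier[OF x] that by (simp add: \<kappa>_def)
    have "\<kappa> x = \<kappa> y" using pm.a_repr_independence'[of y x] that x by (simp add: \<kappa>_def)
    then have "x \<ominus> y \<in> pmult" using \<kappa>_eq_iff x y by simp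
    then have "act f x \<ominus> act f y \<in> pmult" using act_pmult[of _ f] act_minus[OF x y, of f] by metis
    then have "\<kappa> (act f x) = \<kappa> (act f y)" using \<kappa>_eq_iff x y by simp
    then show ?thesis by simp
  qed
  have "x \<in> \<kappa> x" using pm.a_rcos_self[OF x] by (simp add: \<kappa>_def)
  have "pcls P f \<odot>\<^bsub>Mbar\<^esub> \<kappa> x = (\<Union>y\<in>\<kappa> x. \<kappa> (act f y))"
    by (simp add: Mbar_def quot_nat_def quot_module_def pmult_alt) (simp add: \<kappa>_def act_def)
  also have "\<dots> = (\<Union>y\<in>\<kappa> x. \<kappa> (act f x))" by (intro SUP_cong refl all)
  also have "\<dots> = \<kappa> (act f x)" using \<open>x \<in> \<kappa> x\<close> by auto
  finally show "pcls P f \<odot>\<^bsub>Mbar\<^esub> \<kappa> x = \<kappa> (act f x)" .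
qed

lemma Mbar_module: "Module.module (poly_quot P) Mbar"
proof (rule moduleI[OF cring_poly_quot])
  have "Mbar = \<lparr>carrier = a_rcosets pmult, mult = undefined, one = undefined, zero = pmult, add = set_add M,
      smult = (\<lambda>r C. \<Union>x\<in>C. pmult +> r \<odot>\<^bsub>M\<^esub> x)\<rparr>"
    by (simp add: Mbar_def quot_nat_def quot_module_def pmult_alt)
  then show "abelian_group Mbar" using pm.quot_abelian_group by metis
qed (auto simp: Mbar_simps carrier_poly_quot act_add_poly act_mult act_add)

lemma Mbar_finite: "finite (carrier Mbar)"
  using fin by (simp add: Mbar_simps)

lemma Mbar_padic: "padic_module P Mbar"
  by (rule padic_module.intro[OF Mbar_module Mbar_finite])

lemma tors_simps: "carrier tors = {x \<in> carrier M. sc pM x = \<zero>}" "add tors = add M" "zero tors = zero M" "smult tors = smult M"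
  by (simp_all add: tors_def)

lemma tors_module: "Module.module (poly_quot P) tors"
  unfolding tors_def
proof (rule mod.submodule_is_module, unfold submodule_def, intro conjI ballI allI impI)
  show "Module.module (poly_quot P) M" by (rule module_M)
  show "{x \<in> carrier M. sc pM x = \<zero>} \<subseteq> carrier M" by auto
next
  fix c v assume "c \<in> carrier (poly_quot P)" and v: "v \<in> {x \<in> carrier M. sc pM x = \<zero>}"
  then obtain f where f: "c = pcls P f" by (auto simp: carrier_poly_quot)
  have "sc pM (act f v) = \<zero>" using act_comm[of v "[:pM:]" f] v by simp
  then show "c \<odot>\<^bsub>M\<^esub> v \<in> {x \<in> carrier M. sc pM x = \<zero>}" using v by (simp add: f flip: act_def)
qed (auto simp: act_add)

lemma tors_padic: "padic_module P tors"
  by (rule padic_module.intro[OF tors_module]) (use fin in \<open>auto simp: tors_simps\<close>)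

lemma card_tors: "card (carrier M) = card pmult * card (carrier tors)"
  unfolding pmult_def tors_simps
  by (rule mod.M.card_hom_image_kernel[OF fin _ mod.M.abelian_group_axioms]) (auto simp: act_add)

lemma card_Mbar: "card (carrier Mbar) * card pmult = card (carrier M)"
  using pm.card_rcosets[OF fin] by (simp add: Mbar_simps(1) pm.rcosets_eq \<kappa>_def[abs_def])

lemma card_pmult_pos: "card pmult > 0"
  using fin mod.M.zero_closed by (auto simp: pmult_def card_gt_0_iff)

text \<open>
  Multiplication by \<open>p\<close> has kernel \<open>M[p]\<close> and image \<open>pM\<close>, so both sides equal \<open>|M| / |pM|\<close>.
\<close>

lemma card_Mbar_tors: "card (carrier Mbar) = card (carrier tors)"
proof -
  have "card pmult * card (carrier Mbar) = card pmult * card (carrier tors)"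
    using card_tors card_Mbar by (simp add: mult.commute)
  then show ?thesis using card_pmult_pos by simp
qed

text \<open>
  When \<open>p\<close> annihilates \<open>M\<close>, this is \<open>M\<close> as a vector space over the residue field.
\<close>

definition desc :: "('p mod_ring poly set, 'm) module" where
  "desc = descend_scalars (poly_quot P) quot_residue M"

end

locale padic_prime =
  fixes P :: "'p :: prime_card padic_int poly"
  assumes monic: "lead_coeff P = 1" and irr: "Factorial_Ring.irreducible (poly_residue P)"
begin

abbreviation "Q \<equiv> poly_residue P"
abbreviation "K \<equiv> poly_quot Q"

lemma degree_Q: "degree Q = degree P"
proof (rule antisym)
  show "degree Q \<le> degree P" by (rule degree_le) (simp add: coeff_eq_0)
  show "degree P \<le> degree Q" by (rule le_degree) (simp add: monic residue_hom)
qed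

lemma degree_pos: "degree P > 0"
proof (rule ccontr)
  assume "\<not> degree P > 0"
  then have "degree Q = 0" using degree_Q by simp
  moreover have "Q \<noteq> 0" using irr by auto
  ultimately have "Q dvd 1" by (simp add: is_unit_iff_degree)
  then show False using irr irreducible_not_unit by blast
qed

lemma field_K: "field K"
  by (rule field_poly_quot[OF irr])

lemma finite_K: "finite (carrier K)"
  by (rule finite_poly_quot) (simp add: degree_Q degree_pos)

lemma card_K: "card (carrier K) = CARD('p) ^ degree P"
  by (rule card_poly_quot[OF degree_Q degree_pos])

end

locale killed_module = padic_prime P + padic_module P M n
  for P :: "'p :: prime_card padic_int poly" and M :: "('p padic_int poly set, 'm) module" (structure) and n +
  assumes killed: "x \<in> carrier M \<Longrightarrow> act [:of_nat CARD('p):] x = \<zero>"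
begin

lemma act_residue_cong:
  assumes x: "x \<in> carrier M" and d: "Q dvd poly_residue f - poly_residue g"
  shows "act f x = act g x"
proof -
  obtain g' h where gh: "f - g = P * g' + Polynomial.smult pM h"
    using lift_poly_dvd[of P "f - g"] d by auto
  have "f = g + (P * g' + [:pM:] * h)" using gh by (simp add: algebra_simps)
  then have "act f x = act g x \<oplus> (act (P * g') x \<oplus> act ([:pM:] * h) x)"
    using x by (simp only: act_add_poly)
  then show ?thesis using x killed[of "act h x"] by (simp only: act_P_mult act_mult act_P act_closed) simp
qed

lemma desc_simps: "carrier desc = carrier M" "add desc = add M" "zero desc = zero M"
  by (simp_all add: desc_def descend_scalars_def)

text \<open>
  The scalar acts through some preimage in \<open>\<int>\<^sub>p[t]/(P)\<close>; all preimages act alike because \<open>p\<close>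
  annihilates \<open>M\<close>.
\<close>

lemma desc_smult:
  assumes x: "x \<in> carrier M"
  shows "pcls Q (poly_residue f) \<odot>\<^bsub>desc\<^esub> x = act f x"
proof -
  let ?F = "inv_into (carrier (poly_quot P)) quot_residue (pcls Q (poly_residue f))"
  have im: "pcls Q (poly_residue f) \<in> quot_residue ` carrier (poly_quot P)"
    by (rule image_eqI[OF _ pcls_carrier[of P f]]) (simp add: quot_residue_pcls)
  have F: "?F \<in> carrier (poly_quot P)" "quot_residue ?F = pcls Q (poly_residue f)"
    using inv_into_into[OF im] f_inv_into_f[OF im] by auto
  obtain g where g: "?F = pcls P g" using F(1) by (auto simp: carrier_poly_quot)
  then have "Q dvd poly_residue f - poly_residue g"
    using F(2) by (simp add: quot_residue_pcls pcls_eq_iff[of Q "poly_residue f"] eq_commute[of "pcls Q (poly_residue g)"])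
  then have "act f x = act g x" by (rule act_residue_cong[OF x])
  then show ?thesis by (simp add: desc_def descend_scalars_def g act_def)
qed

lemma desc_space: "finite_space K desc"
proof -
  interpret F: field K by (rule field_K)
  have ag: "abelian_group desc"
  proof (rule abelian_groupI)
    fix x assume "x \<in> carrier desc"
    then show "\<exists>y\<in>carrier desc. y \<oplus>\<^bsub>desc\<^esub> x = \<zero>\<^bsub>desc\<^esub>"
      by (intro bexI[of _ "\<ominus> x"]) (auto simp: desc_simps mod.M.l_neg)
  qed (auto simp: desc_simps mod.M.a_ac)
  have rep: "\<exists>f. c = pcls Q (poly_residue f)" if "c \<in> carrier K" for c
    by (rule poly_quot_residue_rep[OF that]) blast
  have "Module.module K desc"
  proof (rule moduleI[OF F.is_cring ag])
    fix a x assume "a \<in> carrier K" "x \<in> carrier desc"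
    then show "a \<odot>\<^bsub>desc\<^esub> x \<in> carrier desc" using rep[of a] by (auto simp: desc_smult desc_simps)
  next
    fix a b x assume h: "a \<in> carrier K" "b \<in> carrier K" "x \<in> carrier desc"
    then obtain f g where fg: "a = pcls Q (poly_residue f)" "b = pcls Q (poly_residue g)" using rep by metis
    show "(a \<oplus>\<^bsub>K\<^esub> b) \<odot>\<^bsub>desc\<^esub> x = a \<odot>\<^bsub>desc\<^esub> x \<oplus>\<^bsub>desc\<^esub> b \<odot>\<^bsub>desc\<^esub> x"
      using h desc_smult[of x "f + g"] by (simp add: fg desc_smult desc_simps act_add_poly)
    show "(a \<otimes>\<^bsub>K\<^esub> b) \<odot>\<^bsub>desc\<^esub> x = a \<odot>\<^bsub>desc\<^esub> (b \<odot>\<^bsub>desc\<^esub> x)"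
      using h desc_smult[of x "f * g"] by (simp add: fg desc_smult desc_simps act_mult)
  next
    fix a x y assume h: "a \<in> carrier K" "x \<in> carrier desc" "y \<in> carrier desc"
    then obtain f where "a = pcls Q (poly_residue f)" using rep by metis
    then show "a \<odot>\<^bsub>desc\<^esub> (x \<oplus>\<^bsub>desc\<^esub> y) = a \<odot>\<^bsub>desc\<^esub> x \<oplus>\<^bsub>desc\<^esub> a \<odot>\<^bsub>desc\<^esub> y"
      using h by (simp add: desc_smult desc_simps act_add)
  next
    fix x assume "x \<in> carrier desc"
    then show "\<one>\<^bsub>K\<^esub> \<odot>\<^bsub>desc\<^esub> x = x" using desc_smult[of x 1] by (simp add: desc_simps)
  qed
  then show ?thesis
    by (simp add: finite_space_def finite_space_axioms_def field_K finite_K desc_simps fin)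
qed

text \<open>
  Every scalar in \<open>K\<close> is the reduction of a scalar in \<open>\<int>\<^sub>p[t]/(P)\<close>, so linearity over the two
  rings is the same condition. As \<open>M\<close> is finite, the automorphisms are then the injective
  endomorphisms of a vector space.
\<close>

lemma card_aut_killed:
  assumes k: "card (carrier M) = card (carrier K) ^ k"
  shows "card (module_aut (poly_quot P) M) = (\<Prod>i<k. card (carrier K) ^ k - card (carrier K) ^ i)"
proof -
  interpret D: two_finite_spaces K desc desc
    by (simp add: two_finite_spaces_def desc_space)
  have rep: "\<exists>f. c = pcls Q (poly_residue f)" if "c \<in> carrier K" for c
    by (rule poly_quot_residue_rep[OF that]) blast
  have "module_aut (poly_quot P) M = D.injs (carrier desc)"
  proof (intro equalityI subsetI)
    fix \<alpha> assume "\<alpha> \<in> module_aut (poly_quot P) M"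
    then have h: "\<alpha> \<in> module_hom (poly_quot P) M M" and b: "bij_betw \<alpha> (carrier M) (carrier M)"
      and e: "\<alpha> \<in> extensional (carrier M)"
      by (auto simp: module_aut_def module_isos_def)
    have cl: "\<alpha> x \<in> carrier M" if "x \<in> carrier M" for x using b that by (auto simp: bij_betw_def)
    have "\<alpha> (c \<odot>\<^bsub>desc\<^esub> x) = c \<odot>\<^bsub>desc\<^esub> \<alpha> x" if cx: "c \<in> carrier K" "x \<in> carrier M" for c x
    proof -
      obtain f where f: "c = pcls Q (poly_residue f)" using rep cx by blast
      show ?thesis using module_hom_smult[OF h, of "pcls P f" x] cx cl
        by (simp add: f desc_smult) (simp add: act_def)
    qed
    then show "\<alpha> \<in> D.injs (carrier desc)"
      using module_hom_add[OF h] b e cl by (auto simp: D.injs_def D.homs_def desc_simps bij_betw_def PiE_def)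
  next
    fix \<alpha> assume "\<alpha> \<in> D.injs (carrier desc)"
    then have a: "\<alpha> \<in> D.homs (carrier desc)" and i: "inj_on \<alpha> (carrier M)" by (auto simp: D.injs_def desc_simps)
    note a' = D.homs_D[OF a, unfolded desc_simps]
    have "\<alpha> ` carrier M = carrier M" using endo_inj_surj[OF fin _ i] a'(5) by blast
    then have b: "bij_betw \<alpha> (carrier M) (carrier M)" using i by (simp add: bij_betw_def)
    have "\<alpha> (r \<odot>\<^bsub>M\<^esub> x) = r \<odot>\<^bsub>M\<^esub> \<alpha> x" if rx: "r \<in> carrier (poly_quot P)" "x \<in> carrier M" for r x
    proof -
      obtain f where f: "r = pcls P f" using rx by (auto simp: carrier_poly_quot)
      show ?thesis using a'(4)[of "pcls Q (poly_residue f)" x] rx a'(5)[of x]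
        by (simp add: f desc_smult) (simp add: act_def)
    qed
    then show "\<alpha> \<in> module_aut (poly_quot P) M"
      using a' b by (auto simp: module_aut_def module_isos_def module_hom_def)
  qed
  moreover obtain l where l: "card (carrier desc) = card (carrier K) ^ l"
    "card (D.injs (carrier desc)) = (\<Prod>i<l. card (carrier desc) - card (carrier K) ^ i)"
    using D.card_homs_injs by blast
  moreover have "l = k"
  proof -
    have "CARD('p) > 1" using prime_gt_1_nat[OF prime_card] .
    then have "card (carrier K) > 1" unfolding card_K by (rule one_less_power) (rule degree_pos)
    then show ?thesis using l(1) k by (simp add: desc_simps)
  qed
  ultimately show ?thesis using k by (simp add: desc_simps)
qed

end

section \<open>Separating a vector from a subspace\<close>

text \<open>
  Extend a basis of \<open>U\<close> by \<open>x\<close>; the functional is the coordinate along \<open>x\<close>. Vectors of length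
  \<open>n\<close> are regarded as functions on the natural numbers that vanish from \<open>n\<close> on, because these
  live in a vector space that is a full type.
\<close>

lemma separating_functional:
  fixes U :: "'a :: field vec set"
  assumes U: "U \<subseteq> carrier_vec n" "0\<^sub>v n \<in> U" "\<And>u v. u \<in> U \<Longrightarrow> v \<in> U \<Longrightarrow> u + v \<in> U"
    "\<And>a u. u \<in> U \<Longrightarrow> a \<cdot>\<^sub>v u \<in> U"
    and x: "x \<in> carrier_vec n" "x \<notin> U"
  shows "\<exists>c \<in> carrier_vec n. (\<forall>u\<in>U. c \<bullet> u = 0) \<and> c \<bullet> x = 1"
proof -
  define s :: "'a \<Rightarrow> (nat \<Rightarrow> 'a) \<Rightarrow> nat \<Rightarrow> 'a" where "s = (\<lambda>a f i. a * f i)"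
  interpret vs: vector_space s
    by unfold_locales (auto simp: s_def fun_eq_iff algebra_simps)
  interpret pr: vector_space_pair s "(*) :: 'a \<Rightarrow> 'a \<Rightarrow> 'a"
    by unfold_locales (auto simp: algebra_simps)
  define h where "h v = (\<lambda>i. if i < n then v $ i else 0)" for v :: "'a vec"
  have h_inj: "v = w" if "h v = h w" "v \<in> carrier_vec n" "w \<in> carrier_vec n" for v w
    using that by (intro eq_vecI) (auto simp: h_def fun_eq_iff, metis)
  have sub: "vs.subspace (h ` U)"
  proof (rule vs.subspaceI)
    have "h (0\<^sub>v n) = 0" by (auto simp: h_def)
    then show "0 \<in> h ` U" using U(2) by force
  next
    fix f g assume "f \<in> h ` U" "g \<in> h ` U"
    then obtain u v where uv: "u \<in> U" "f = h u" "v \<in> U" "g = h v" by auto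
    have "dim_vec u = n" "dim_vec v = n" using uv U(1) by auto
    then have "f + g = h (u + v)" using uv by (auto simp: h_def fun_eq_iff)
    then show "f + g \<in> h ` U" using uv U(3) by auto
  next
    fix a f assume "f \<in> h ` U"
    then obtain u where u: "u \<in> U" "f = h u" by auto
    have "dim_vec u = n" using u U(1) by auto
    then have "s a f = h (a \<cdot>\<^sub>v u)" using u by (auto simp: h_def s_def fun_eq_iff)
    then show "s a f \<in> h ` U" using u U(4) by auto
  qed
  obtain B where B: "B \<subseteq> h ` U" "vs.independent B" "h ` U \<subseteq> vs.span B"
    using vs.maximal_independent_subset by blast
  have "h x \<notin> vs.span B"
  proof
    assume "h x \<in> vs.span B"
    then have "h x \<in> h ` U" using vs.span_minimal[OF B(1) sub] by blast
    then show False using h_inj[of x] x U(1) by auto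
  qed
  then have ind: "vs.independent (insert (h x) B)" using B(2) by (simp add: vs.independent_insertI)
  obtain g where g: "Vector_Spaces.linear s (*) g" "\<forall>y\<in>insert (h x) B. g y = (if y = h x then 1 else 0)"
    using pr.linear_independent_extend[OF ind, of "\<lambda>y. if y = h x then 1 else 0"] by blast
  interpret g: Vector_Spaces.linear s "(*)" g by (rule g(1))
  have gB: "g y = 0" if "y \<in> B" for y
    using g(2) that \<open>h x \<notin> vs.span B\<close> vs.span_base[of y B] by auto
  have gU: "g y = 0" if "y \<in> h ` U" for y
  proof -
    have "y \<in> vs.span B" using that B(3) by blast
    then show ?thesis
    proof (induction rule: vs.span_induct_alt)
      case base
      show ?case by (rule g.zero)
    next
      case (step a y z)
      then show ?case unfolding g.add g.scale by (simp add: gB)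
    qed
  qed
  define c where "c = vec n (\<lambda>j. g (\<lambda>i. if i = j then 1 else 0))"
  have gc: "g (h v) = c \<bullet> v" if v: "v \<in> carrier_vec n" for v
  proof -
    have sum_apply: "(\<Sum>j\<in>A. f j) i = (\<Sum>j\<in>A. f j i)" if "finite A" for A and f :: "nat \<Rightarrow> nat \<Rightarrow> 'a" and i
      using that by (induction A) auto
    have "h v = (\<Sum>j<n. s (v $ j) (\<lambda>i. if i = j then 1 else 0))"
      by (rule ext) (simp add: sum_apply h_def s_def if_distrib[of "\<lambda>x. _ * x"] cong: if_cong)
    then have "g (h v) = (\<Sum>j<n. v $ j * g (\<lambda>i. if i = j then 1 else 0))"
      by (simp add: g.sum g.scale)
    also have "\<dots> = c \<bullet> v" using v by (simp add: scalar_prod_def c_def lessThan_atLeast0 mult.commute)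
    finally show ?thesis .
  qed
  show ?thesis
  proof (intro bexI[of _ c] conjI ballI)
    show "c \<in> carrier_vec n" by (simp add: c_def)
    fix u assume "u \<in> U"
    then show "c \<bullet> u = 0" using gU[of "h u"] gc[of u] U(1) by auto
  next
    show "c \<bullet> x = 1" using gc[OF x(1)] g(2) by simp
  qed
qed

section \<open>The kernel of P(X) modulo p\<close>

locale cok_setup = padic_prime P + padic_module P M n
  for P :: "'p :: prime_card padic_int poly" and M :: "('p padic_int poly set, 'm) module" (structure) and n +
  fixes Xbar :: "'p mod_ring mat"
  assumes Xbar: "Xbar \<in> carrier_mat n n"
begin

lemma tors_killed: "killed_module P tors"
proof -
  interpret T: padic_module P tors by (rule tors_padic)
  show ?thesis
    by (simp add: killed_module_def killed_module_axioms_def padic_prime_axioms tors_padic T.act_def tors_simps)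
      (simp add: act_def)
qed

lemma Mbar_killed: "killed_module P Mbar"
proof -
  interpret V: padic_module P Mbar by (rule Mbar_padic)
  have "\<kappa> (sc pM x) = \<zero>\<^bsub>Mbar\<^esub>" if "x \<in> carrier M" for x
    using that pm.a_rcos_const[of "sc pM x"] by (simp add: \<kappa>_def Mbar_simps(2)) (simp add: pmult_def)
  then show ?thesis
    by (auto simp: killed_module_def killed_module_axioms_def padic_prime_axioms Mbar_padic V.act_def Mbar_simps(1,5))
qed

sublocale T: killed_module P tors n by (rule tors_killed)
sublocale V: killed_module P Mbar n by (rule Mbar_killed)

lemma T_act [simp]: "T.act f x = act f x"
  by (simp add: T.act_def act_def tors_simps)

lemma T_lin: "T.lin = {Z \<in> lin. \<forall>v\<in>carrier_vec n. sc pM (Z v) = \<zero>}"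
  by (auto simp: T.lin_def lin_def tors_simps PiE_def)

lemma V_act: "x \<in> carrier M \<Longrightarrow> V.act f (\<kappa> x) = \<kappa> (act f x)"
  by (simp add: V.act_def Mbar_simps)

text \<open>
  The kernel of \<open>P(Xbar)\<close>, which is a vector space over \<open>K\<close>. A scalar acts through any
  polynomial that represents it.
\<close>

definition W :: "('p mod_ring poly set, 'p mod_ring vec) module" where
  "W = \<lparr>carrier = {w \<in> carrier_vec n. pmv Q Xbar w = 0\<^sub>v n}, mult = undefined, one = undefined,
     zero = 0\<^sub>v n, add = (+), smult = (\<lambda>C w. pmv (SOME f. f \<in> C) Xbar w)\<rparr>"

lemma W_simps: "carrier W = {w \<in> carrier_vec n. pmv Q Xbar w = 0\<^sub>v n}" "zero W = 0\<^sub>v n" "add W = (+)"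
  by (simp_all add: W_def)

lemma W_smult:
  assumes w: "w \<in> carrier W"
  shows "pcls Q f \<odot>\<^bsub>W\<^esub> w = pmv f Xbar w"
proof -
  have wc: "w \<in> carrier_vec n" "pmv Q Xbar w = 0\<^sub>v n" using w by (auto simp: W_simps)
  define g where "g = (SOME g. g \<in> pcls Q f)"
  have "g \<in> pcls Q f" unfolding g_def by (rule someI[of _ f]) simp
  then obtain h where "g - f = Q * h" unfolding mem_pcls pcls_eq_iff by (rule dvdE)
  then have "g = f + h * Q" by (simp add: algebra_simps)
  then have "pmv g Xbar w = pmv f Xbar w + pmv h Xbar (0\<^sub>v n)"
    using wc by (simp add: pmv_add_poly[OF Xbar] pmv_mult[OF Xbar])
  also have "pmv h Xbar (0\<^sub>v n) = 0\<^sub>v n" using Xbar by (intro mat_vec_zero) simp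
  finally show ?thesis using wc pmv_carrier[OF Xbar wc(1), of f] by (simp add: W_def g_def)
qed

lemma W_pmv: "w \<in> carrier W \<Longrightarrow> pmv f Xbar w \<in> carrier W"
proof -
  assume w: "w \<in> carrier W"
  have "pmv Q Xbar (pmv f Xbar w) = pmv f Xbar (0\<^sub>v n)"
    using w pmv_comm[OF Xbar, of w Q f] by (simp add: W_simps)
  also have "\<dots> = 0\<^sub>v n" using Xbar by (intro mat_vec_zero) simp
  finally show ?thesis using w Xbar by (simp add: W_simps)
qed

lemma finite_carrier_vec: "finite (carrier_vec n :: 'p mod_ring vec set)"
proof -
  have "carrier_vec n \<subseteq> (\<lambda>f. vec n f) ` ({..<n} \<rightarrow>\<^sub>E (UNIV :: 'p mod_ring set))"
  proof
    fix v :: "'p mod_ring vec" assume "v \<in> carrier_vec n"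
    then have v: "v = vec n (\<lambda>i\<in>{..<n}. v $ i)" by (intro eq_vecI) auto
    show "v \<in> (\<lambda>f. vec n f) ` ({..<n} \<rightarrow>\<^sub>E UNIV)" using image_eqI[where f = "\<lambda>f. vec n f", OF v, of "{..<n} \<rightarrow>\<^sub>E UNIV"] by simp
  qed
  then show ?thesis by (rule finite_subset) (intro finite_imageI finite_PiE, auto)
qed

lemma W_space: "finite_space K W"
proof -
  interpret F: field K by (rule field_K)
  have add: "v + w \<in> carrier W" if "v \<in> carrier W" "w \<in> carrier W" for v w
    using that Xbar by (auto simp: W_simps pmv_add)
  have ag: "abelian_group W"
  proof (rule abelian_groupI)
    fix x assume x: "x \<in> carrier W"
    have "(- 1) \<cdot>\<^sub>v x \<in> carrier W" using x Xbar by (auto simp: W_simps pmv_smult smult_zero_vec_right)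
    moreover have "(- 1) \<cdot>\<^sub>v x + x = 0\<^sub>v n" using x by (intro eq_vecI) (auto simp: W_simps)
    ultimately show "\<exists>y\<in>carrier W. y \<oplus>\<^bsub>W\<^esub> x = \<zero>\<^bsub>W\<^esub>" unfolding W_simps(2,3) by blast
  next
    show "\<zero>\<^bsub>W\<^esub> \<in> carrier W" using Xbar mat_vec_zero[OF poly_mat_carrier[OF Xbar]] by (simp add: W_simps)
  next
    fix x y assume "x \<in> carrier W" "y \<in> carrier W"
    then show "x \<oplus>\<^bsub>W\<^esub> y \<in> carrier W" using add by (simp add: W_simps(3))
  next
    fix x y z assume "x \<in> carrier W" "y \<in> carrier W" "z \<in> carrier W"
    then show "x \<oplus>\<^bsub>W\<^esub> y \<oplus>\<^bsub>W\<^esub> z = x \<oplus>\<^bsub>W\<^esub> (y \<oplus>\<^bsub>W\<^esub> z)"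
      unfolding W_simps by (intro assoc_add_vec) auto
  next
    fix x y assume "x \<in> carrier W" "y \<in> carrier W"
    then show "x \<oplus>\<^bsub>W\<^esub> y = y \<oplus>\<^bsub>W\<^esub> x" unfolding W_simps by (intro comm_add_vec) auto
  next
    fix x assume "x \<in> carrier W"
    then show "\<zero>\<^bsub>W\<^esub> \<oplus>\<^bsub>W\<^esub> x = x" unfolding W_simps by simp
  qed
  have rep: "\<exists>f. c = pcls Q f" if "c \<in> carrier K" for c
    using that by (auto simp: carrier_poly_quot)
  have W_c: "w \<in> carrier_vec n" if "w \<in> carrier W" for w using that by (simp add: W_simps)
  have "Module.module K W"
  proof (rule moduleI[OF F.is_cring ag])
    fix a x assume "a \<in> carrier K" "x \<in> carrier W"
    then show "a \<odot>\<^bsub>W\<^esub> x \<in> carrier W" using rep[of a] by (auto simp: W_smult W_pmv)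
  next
    fix a b x assume h: "a \<in> carrier K" "b \<in> carrier K" "x \<in> carrier W"
    then obtain f g where fg: "a = pcls Q f" "b = pcls Q g" using rep by metis
    show "(a \<oplus>\<^bsub>K\<^esub> b) \<odot>\<^bsub>W\<^esub> x = a \<odot>\<^bsub>W\<^esub> x \<oplus>\<^bsub>W\<^esub> b \<odot>\<^bsub>W\<^esub> x"
      using h W_c[OF h(3)] by (simp add: fg W_smult W_simps(3) pmv_add_poly[OF Xbar])
    show "(a \<otimes>\<^bsub>K\<^esub> b) \<odot>\<^bsub>W\<^esub> x = a \<odot>\<^bsub>W\<^esub> (b \<odot>\<^bsub>W\<^esub> x)"
      using h W_c[OF h(3)] by (simp add: fg W_smult W_pmv pmv_mult[OF Xbar])
  next
    fix a x y assume h: "a \<in> carrier K" "x \<in> carrier W" "y \<in> carrier W"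
    then obtain f where "a = pcls Q f" using rep by metis
    then show "a \<odot>\<^bsub>W\<^esub> (x \<oplus>\<^bsub>W\<^esub> y) = a \<odot>\<^bsub>W\<^esub> x \<oplus>\<^bsub>W\<^esub> a \<odot>\<^bsub>W\<^esub> y"
      using h add W_c by (simp add: W_smult W_simps(3) pmv_add[OF Xbar])
  next
    fix x assume "x \<in> carrier W"
    then show "\<one>\<^bsub>K\<^esub> \<odot>\<^bsub>W\<^esub> x = x" using W_c by (simp add: W_smult pmv_1[OF Xbar])
  qed
  moreover have "finite (carrier W)" by (rule finite_subset[OF _ finite_carrier_vec]) (auto simp: W_simps)
  ultimately show ?thesis
    by (simp add: finite_space_def finite_space_axioms_def field_K finite_K)
qed

sublocale WT: two_finite_spaces K W T.desc
  by (simp add: two_finite_spaces_def W_space T.desc_space)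

text \<open>
  An endomorphism of a finite group has kernel and cokernel of the same size.
\<close>

lemma card_W:
  assumes F: "F \<in> V.pres X1 (V.res_image Xbar)" and X1: "X1 \<in> carrier_mat n n"
  shows "card (carrier W) = card (carrier Mbar)"
proof -
  let ?U = "module_vec TYPE('p mod_ring) n"
  interpret U: abelian_group ?U by (rule abelian_group_module_vec)
  have Us: "carrier ?U = carrier_vec n" "add ?U = (+)" "zero ?U = 0\<^sub>v n" by (auto simp: module_vec_def)
  have L: "F \<in> V.lin" and surj: "F ` carrier_vec n = carrier Mbar"
    and ker: "\<And>v. v \<in> carrier_vec n \<Longrightarrow> F v = \<zero>\<^bsub>Mbar\<^esub> \<longleftrightarrow> rvec v \<in> mat_image Q Xbar"
    using F by (auto simp: V.pres_def V.res_image_def)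
  have 1: "card (carrier ?U) = card (pmv Q Xbar ` carrier ?U) * card {x \<in> carrier ?U. pmv Q Xbar x = \<zero>\<^bsub>?U\<^esub>}"
    by (rule U.card_hom_image_kernel[OF _ _ U.abelian_group_axioms])
      (use Xbar finite_carrier_vec in \<open>auto simp: Us pmv_add[OF Xbar]\<close>)
  have im: "pmv Q Xbar ` carrier ?U = mat_image Q Xbar"
    using Xbar by (auto simp: mat_image_def Us)
  (* The map that F induces on vectors modulo p. *)
  define h where "h v = F (map_vec lift_res v)" for v
  have Fr: "F v = F w" if "v \<in> carrier_vec n" "w \<in> carrier_vec n" "rvec v = rvec w" for v w
  proof -
    obtain u where u: "u \<in> carrier_vec n" "v = w + pM \<cdot>\<^sub>v u"
      using iffD1[OF rvec_eq_iff[OF \<open>v \<in> carrier_vec n\<close> \<open>w \<in> carrier_vec n\<close>] \<open>rvec v = rvec w\<close>] by blast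
    then have "F v = F w \<oplus>\<^bsub>Mbar\<^esub> V.sc pM (F u)" using that V.linD[OF L] by simp
    then show ?thesis using V.killed V.linD(1)[OF L] u that by simp
  qed
  have hF: "h (rvec v) = F v" if "v \<in> carrier_vec n" for v
    unfolding h_def by (rule Fr) (use that rvec_lift[of "rvec v" n] in auto)
  have lc: "map_vec lift_res v \<in> carrier_vec n" if "v \<in> carrier_vec n" for v :: "'p mod_ring vec" using that by simp
  have hadd: "h (v + w) = h v \<oplus>\<^bsub>Mbar\<^esub> h w" if vw: "v \<in> carrier_vec n" "w \<in> carrier_vec n" for v w
  proof -
    have "h (rvec (map_vec lift_res v + map_vec lift_res w)) = F (map_vec lift_res v) \<oplus>\<^bsub>Mbar\<^esub> F (map_vec lift_res w)"
      using hF[of "map_vec lift_res v + map_vec lift_res w"] V.linD(2)[OF L] vw by simp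
    then show ?thesis using vw by (simp add: rvec_add rvec_lift h_def)
  qed
  have him: "h ` carrier ?U = carrier Mbar"
  proof -
    have "carrier Mbar \<subseteq> h ` carrier ?U"
    proof
      fix x assume "x \<in> carrier Mbar"
      then obtain v where "v \<in> carrier_vec n" "x = F v" using surj by blast
      then show "x \<in> h ` carrier ?U" using hF[of v] by (intro image_eqI[of _ _ "rvec v"]) (auto simp: Us)
    qed
    then show ?thesis using V.linD(1)[OF L] lc by (auto simp: h_def Us)
  qed
  have 2: "card (carrier ?U) = card (h ` carrier ?U) * card {x \<in> carrier ?U. h x = \<zero>\<^bsub>Mbar\<^esub>}"
    by (rule U.card_hom_image_kernel[OF _ _ V.mod.M.abelian_group_axioms])
      (use finite_carrier_vec hadd V.linD(1)[OF L] lc in \<open>auto simp: Us h_def\<close>)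
  have hk: "{x \<in> carrier ?U. h x = \<zero>\<^bsub>Mbar\<^esub>} = mat_image Q Xbar"
  proof -
    have "h v = \<zero>\<^bsub>Mbar\<^esub> \<longleftrightarrow> v \<in> mat_image Q Xbar" if v: "v \<in> carrier_vec n" for v
      using ker[OF lc[OF v]] unfolding h_def rvec_lift[OF v] .
    then show ?thesis using mat_image_props(1)[OF Xbar, of Q] by (auto simp: Us)
  qed
  have "card (mat_image Q Xbar) * card (carrier W) = card (mat_image Q Xbar) * card (carrier Mbar)"
    using 1 2 unfolding im him hk by (simp add: Us W_simps mult.commute)
  moreover have "card (mat_image Q Xbar) > 0"
  proof -
    have "finite (mat_image Q Xbar)" using mat_image_props(1)[OF Xbar, of Q] finite_carrier_vec finite_subset by blast
    moreover have "mat_image Q Xbar \<noteq> {}" using mat_image_props(2)[OF Xbar zero_carrier_vec, of Q] by blast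
    ultimately show ?thesis by (simp add: card_gt_0_iff)
  qed
  ultimately show ?thesis by simp
qed

end

section \<open>Lifting presentations modulo p\<close>

context cok_setup
begin

definition X1 :: "'p padic_int mat" where
  "X1 = map_mat lift_res Xbar"

lemma X1: "X1 \<in> carrier_mat n n" "rmat X1 = Xbar"
  using Xbar by (auto simp: X1_def intro!: eq_matI)

text \<open>
  The candidates for presentations of cokernels of matrices that reduce to \<open>Xbar\<close>: linear maps
  that are presentations modulo \<open>p\<close>. Modulo \<open>p\<close> the choice of \<open>X1\<close> among the lifts of \<open>Xbar\<close>
  makes no difference.
\<close>

definition pres_lifts :: "('p padic_int vec \<Rightarrow> 'm) set" where
  "pres_lifts = {F \<in> lin. (\<lambda>v\<in>carrier_vec n. \<kappa> (F v)) \<in> V.pres X1 (V.res_image Xbar)}"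

lemma \<kappa>_zero_iff: "x \<in> carrier M \<Longrightarrow> \<kappa> x = \<zero>\<^bsub>Mbar\<^esub> \<longleftrightarrow> x \<in> pmult"
  using \<kappa>_eq_iff[of x \<zero>] by (simp add: Mbar_simps(3) mod.M.add_minus_cancel(3))

lemma \<kappa>_lin: "F \<in> lin \<Longrightarrow> (\<lambda>v\<in>carrier_vec n. \<kappa> (F v)) \<in> V.lin"
  using linD[of F] by (auto simp: V.lin_def Mbar_simps V_act)

lemma pres_liftsD:
  assumes F: "F \<in> pres_lifts"
  shows "F \<in> lin"
    "v \<in> carrier_vec n \<Longrightarrow> F (X1 *\<^sub>v v) \<ominus> act [:0, 1:] (F v) \<in> pmult"
    "x \<in> carrier M \<Longrightarrow> \<exists>v\<in>carrier_vec n. x \<ominus> F v \<in> pmult"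
    "v \<in> carrier_vec n \<Longrightarrow> F v \<in> pmult \<longleftrightarrow> rvec v \<in> mat_image Q Xbar"
proof -
  let ?F = "\<lambda>v\<in>carrier_vec n. \<kappa> (F v)"
  have p: "?F \<in> V.pres X1 (V.res_image Xbar)" and L: "F \<in> lin" using F by (auto simp: pres_lifts_def)
  show "F \<in> lin" by (rule L)
  show "F (X1 *\<^sub>v v) \<ominus> act [:0, 1:] (F v) \<in> pmult" if v: "v \<in> carrier_vec n"
  proof -
    have Xv: "X1 *\<^sub>v v \<in> carrier_vec n" using X1 v by (intro mult_mat_vec_carrier)
    have "?F (X1 *\<^sub>v v) = V.act [:0, 1:] (?F v)" using p v unfolding V.pres_def by blast
    then have "\<kappa> (F (X1 *\<^sub>v v)) = \<kappa> (act [:0, 1:] (F v))"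
      using v Xv linD(1)[OF L v] by (simp add: V_act)
    then show ?thesis using \<kappa>_eq_iff linD(1)[OF L] v Xv by simp
  qed
  show "\<exists>v\<in>carrier_vec n. x \<ominus> F v \<in> pmult" if x: "x \<in> carrier M"
  proof -
    have "\<kappa> x \<in> ?F ` carrier_vec n" using p x by (simp add: V.pres_def Mbar_simps)
    then obtain v where v: "v \<in> carrier_vec n" "\<kappa> x = \<kappa> (F v)" by auto
    then show ?thesis using \<kappa>_eq_iff[OF x linD(1)[OF L v(1)]] by blast
  qed
  show "F v \<in> pmult \<longleftrightarrow> rvec v \<in> mat_image Q Xbar" if v: "v \<in> carrier_vec n"
  proof -
    have "?F v = \<zero>\<^bsub>Mbar\<^esub> \<longleftrightarrow> v \<in> V.res_image Xbar" using p v unfolding V.pres_def by blast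
    then show ?thesis using v \<kappa>_zero_iff[OF linD(1)[OF L v]] by (simp add: V.res_image_def)
  qed
qed

text \<open>
  A map to \<open>M/pM\<close> lifts to \<open>M\<close> by lifting its \<open>n\<close> values at the standard basis, each within a
  coset of \<open>pM\<close>. The presentations modulo \<open>p\<close> are a torsor under the automorphisms of \<open>M/pM\<close>.
\<close>

lemma card_pres_lifts:
  assumes ne: "V.pres X1 (V.res_image Xbar) \<noteq> {}"
  shows "card pres_lifts = card (module_aut (poly_quot P) Mbar) * card pmult ^ n"
proof -
  let ?h = "\<lambda>F. \<lambda>v\<in>carrier_vec n. \<kappa> (F v)"
  have fib: "card {F \<in> lin. ?h F = G} = card pmult ^ n" if G: "G \<in> V.lin" for G
  proof -
    have ex: "\<exists>x \<in> carrier M. G (unit_vec n j) = \<kappa> x" if "j < n" for j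
    proof -
      have "G (unit_vec n j) \<in> carrier Mbar" using V.linD(1)[OF G] by simp
      then show ?thesis by (auto simp: Mbar_simps)
    qed
    have "{F \<in> lin. ?h F = G} = {F \<in> lin. \<forall>j<n. F (unit_vec n j) \<in> G (unit_vec n j)}"
    proof (intro Collect_cong conj_cong refl)
      fix F assume F: "F \<in> lin"
      have "?h F = G \<longleftrightarrow> (\<forall>j<n. \<kappa> (F (unit_vec n j)) = G (unit_vec n j))"
        using V.lin_eqI[OF \<kappa>_lin[OF F] G] by auto
      also have "\<dots> \<longleftrightarrow> (\<forall>j<n. F (unit_vec n j) \<in> G (unit_vec n j))"
      proof (intro all_cong)
        fix j assume "j < n"
        then obtain x where x: "x \<in> carrier M" "G (unit_vec n j) = \<kappa> x" using ex by blast
        define y where "y = F (unit_vec n j)"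
        have y: "y \<in> carrier M" using linD(1)[OF F] by (simp add: y_def)
        have "\<kappa> y = \<kappa> x \<longleftrightarrow> y \<in> \<kappa> x"
          using pm.a_rcos_self[OF y] pm.a_repr_independence'[OF _ x(1), of y] by (auto simp: \<kappa>_def)
        then show "\<kappa> (F (unit_vec n j)) = G (unit_vec n j) \<longleftrightarrow> F (unit_vec n j) \<in> G (unit_vec n j)"
          by (simp add: x y_def)
      qed
      finally show "?h F = G \<longleftrightarrow> (\<forall>j<n. F (unit_vec n j) \<in> G (unit_vec n j))" .
    qed
    also have "card \<dots> = (\<Prod>j<n. card (G (unit_vec n j)))"
    proof (rule card_lin_values)
      fix j assume "j < n"
      then obtain x where x: "x \<in> carrier M" "G (unit_vec n j) = \<kappa> x" using ex by blast
      then show "G (unit_vec n j) \<subseteq> carrier M" using pm.a_elemrcos_carrier[OF x(1)] by (auto simp: \<kappa>_def)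
    qed
    also have "\<dots> = (\<Prod>j<n. card pmult)"
    proof (rule prod.cong[OF refl])
      fix j assume "j \<in> {..<n}"
      then obtain x where "x \<in> carrier M" "G (unit_vec n j) = \<kappa> x" using ex by blast
      then show "card (G (unit_vec n j)) = card pmult" using pm.card_rcos[OF fin] by (simp add: \<kappa>_def)
    qed
    finally show ?thesis by simp
  qed
  have sub: "V.pres X1 (V.res_image Xbar) \<subseteq> V.lin" by (auto simp: V.pres_def)
  have "card {F \<in> lin. ?h F \<in> V.pres X1 (V.res_image Xbar)} = card (V.pres X1 (V.res_image Xbar)) * card pmult ^ n"
  proof (rule card_fibres[OF finite_lin])
    show "V.pres X1 (V.res_image Xbar) \<subseteq> ?h ` lin"
    proof
      fix G assume "G \<in> V.pres X1 (V.res_image Xbar)"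
      then have "card {F \<in> lin. ?h F = G} > 0" using fib sub card_pmult_pos by auto
      then have "{F \<in> lin. ?h F = G} \<noteq> {}" by (metis card.empty less_nat_zero_code)
      then show "G \<in> ?h ` lin" by blast
    qed
  qed (use fib sub in blast)
  moreover obtain F0 where "F0 \<in> V.pres X1 (V.res_image Xbar)" using ne by blast
  ultimately show ?thesis using V.card_pres[OF _ X1(1)] by (simp add: pres_lifts_def)
qed

text \<open>
  \<open>F\<close> is onto modulo \<open>p\<close>, hence modulo every power of \<open>p\<close>, and some power of \<open>p\<close> annihilates
  \<open>M\<close>.
\<close>

lemma pres_lifts_surj:
  assumes F: "F \<in> pres_lifts"
  shows "F ` carrier_vec n = carrier M"
proof -
  note L = pres_liftsD(1)[OF F]
  have step: "\<exists>v\<in>carrier_vec n. \<exists>y\<in>carrier M. x = F v \<oplus> sc (pM ^ k) y" if "x \<in> carrier M" for x k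
    using that
  proof (induction k)
    case 0
    then show ?case
      by (intro bexI[of _ "0\<^sub>v n"] bexI[of _ x]) (auto simp: lin_zero[OF L])
  next
    case (Suc k)
    then obtain v y where v: "v \<in> carrier_vec n" "y \<in> carrier M" "x = F v \<oplus> sc (pM ^ k) y" by blast
    obtain w where w: "w \<in> carrier_vec n" "y \<ominus> F w \<in> pmult" using pres_liftsD(3)[OF F v(2)] by blast
    then obtain z where z: "z \<in> carrier M" "y \<ominus> F w = sc pM z" by (auto simp: pmult_def)
    have Fw: "F w \<in> carrier M" "F v \<in> carrier M" using linD(1)[OF L] v w by auto
    have "y = F w \<oplus> (y \<ominus> F w)" using v Fw by (simp add: mod.M.add_minus_cancel)
    then have "y = F w \<oplus> sc pM z" using z by simp
    then have "sc (pM ^ k) y = F (pM ^ k \<cdot>\<^sub>v w) \<oplus> sc (pM ^ Suc k) z"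
      using z Fw linD(3)[OF L w(1), of "pM ^ k"] sc_mult[OF z(1), of "pM ^ k" pM]
      by (simp add: act_add mult.commute)
    then have "x = F (v + pM ^ k \<cdot>\<^sub>v w) \<oplus> sc (pM ^ Suc k) z"
      using v w z Fw linD(1)[OF L, of "pM ^ k \<cdot>\<^sub>v w"] linD(2)[OF L v(1), of "pM ^ k \<cdot>\<^sub>v w"]
      by (simp add: mod.M.a_assoc)
    then show ?case
      using v(1) w(1) z(1) by (intro bexI[of _ "v + pM ^ k \<cdot>\<^sub>v w"] bexI[of _ z]) auto
  qed
  obtain k where k: "\<And>x. x \<in> carrier M \<Longrightarrow> sc (pM ^ k) x = \<zero>" using sc_p_power_kills by blast
  have "x \<in> F ` carrier_vec n" if "x \<in> carrier M" for x
  proof -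
    from step[OF that, of k]
    obtain v y where v: "v \<in> carrier_vec n" "y \<in> carrier M" "x = F v \<oplus> sc (pM ^ k) y" by blast
    then have "x = F v" using k linD(1)[OF L v(1)] by simp
    then show ?thesis using v by blast
  qed
  then show ?thesis using linD(1)[OF L] by blast
qed

definition compat :: "('p padic_int vec \<Rightarrow> 'm) \<Rightarrow> 'p padic_int mat \<Rightarrow> bool" where
  "compat F X \<longleftrightarrow> X \<in> carrier_mat n n \<and> rmat X = Xbar \<and> (\<forall>v\<in>carrier_vec n. F (X *\<^sub>v v) = act [:0, 1:] (F v))"

lemma mat_p_add:
  assumes "X \<in> carrier_mat n n" "Y \<in> carrier_mat n n" "v \<in> carrier_vec n"
  shows "(X + pM \<cdot>\<^sub>m Y) *\<^sub>v v = X *\<^sub>v v + pM \<cdot>\<^sub>v (Y *\<^sub>v v)"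
proof -
  have "(pM \<cdot>\<^sub>m Y) *\<^sub>v v = pM \<cdot>\<^sub>v (Y *\<^sub>v v)"
    using assms by (intro eq_vecI) (auto simp: scalar_prod_def sum_distrib_left mult.assoc)
  then show ?thesis using assms by (simp add: add_mult_distrib_mat_vec[of _ n n])
qed

lemma rmat_p_add:
  assumes "X \<in> carrier_mat n n" "Y \<in> carrier_mat n n"
  shows "rmat (X + pM \<cdot>\<^sub>m Y) = rmat X"
proof -
  have "residue pM = (0 :: 'p mod_ring)" using residue_eq_0_iff[of pM] by simp
  then show ?thesis using assms by (intro eq_matI) (auto simp: residue_hom simp del: residue_of_nat)
qed

text \<open>
  The identity \<open>F X = t F\<close> holds modulo \<open>p\<close> for the lift \<open>X1\<close> of \<open>Xbar\<close>. The defect has the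
  form \<open>p Z\<close> for a linear map \<open>Z\<close>, and writing \<open>Z = F \<circ> Y\<close> shows that \<open>X1 + p Y\<close> satisfies the
  identity exactly.
\<close>

lemma pres_lifts_compat:
  assumes F: "F \<in> pres_lifts"
  shows "\<exists>X. compat F X"
proof -
  note L = pres_liftsD(1)[OF F]
  have c: "X1 *\<^sub>v v \<in> carrier_vec n" if "v \<in> carrier_vec n" for v using X1 that by (intro mult_mat_vec_carrier)
  have "\<exists>h. h \<in> carrier M \<and> act [:0, 1:] (F (unit_vec n j)) \<ominus> F (X1 *\<^sub>v unit_vec n j) = sc pM h" for j
  proof -
    define a b where "a = F (X1 *\<^sub>v unit_vec n j)" and "b = act [:0, 1:] (F (unit_vec n j))"
    have ab: "a \<in> carrier M" "b \<in> carrier M" using linD(1)[OF L] c by (auto simp: a_def b_def)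
    have "\<kappa> a = \<kappa> b" using pres_liftsD(2)[OF F, of "unit_vec n j"] \<kappa>_eq_iff[OF ab] by (simp add: a_def b_def)
    then have "b \<ominus> a \<in> pmult" using \<kappa>_eq_iff[OF ab(2,1)] by simp
    then show ?thesis by (auto simp: pmult_def a_def b_def)
  qed
  then obtain h where h: "\<And>j. h j \<in> carrier M \<and> act [:0, 1:] (F (unit_vec n j)) \<ominus> F (X1 *\<^sub>v unit_vec n j) = sc pM (h j)"
    by metis
  obtain Z where Z: "Z \<in> lin" "\<forall>j<n. Z (unit_vec n j) = h j" using lin_prescribe[of h] h by blast
  obtain Y where Y: "Y \<in> carrier_mat n n" "lcomp F Y = Z" using lin_surj_lift[OF L pres_lifts_surj[OF F] Z(1)] by blast
  define X where "X = X1 + pM \<cdot>\<^sub>m Y"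
  have X: "X \<in> carrier_mat n n" using X1 Y by (simp add: X_def)
  have FX: "F (X *\<^sub>v v) = F (X1 *\<^sub>v v) \<oplus> sc pM (Z v)" if v: "v \<in> carrier_vec n" for v
  proof -
    have Yv: "Y *\<^sub>v v \<in> carrier_vec n" using Y v by (intro mult_mat_vec_carrier)
    have "F (Y *\<^sub>v v) = Z v" using Y(2) v by (auto simp: lcomp_def)
    then show ?thesis
      unfolding X_def mat_p_add[OF X1(1) Y(1) v] using linD(2)[OF L c[OF v]] linD(3)[OF L Yv] Yv by simp
  qed
  let ?t = "\<lambda>v\<in>carrier_vec n. act [:0, 1:] (F v)"
  have t: "?t \<in> lin"
    using linD[OF L] by (auto simp: lin_def act_add act_comm)
  have "lcomp F X = ?t"
  proof (rule lin_eqI[OF lcomp_lin[OF L X] t])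
    fix j assume j: "j < n"
    define a b where "a = F (X1 *\<^sub>v unit_vec n j)" and "b = act [:0, 1:] (F (unit_vec n j))"
    have ab: "a \<in> carrier M" "b \<in> carrier M" using linD(1)[OF L] c by (auto simp: a_def b_def)
    have "F (X *\<^sub>v unit_vec n j) = a \<oplus> (b \<ominus> a)"
      using FX[of "unit_vec n j"] h[of j] Z(2) j by (simp add: a_def b_def)
    also have "\<dots> = b" using ab by (simp add: mod.M.add_minus_cancel)
    finally show "lcomp F X (unit_vec n j) = ?t (unit_vec n j)" by (simp add: lcomp_def b_def)
  qed
  then have "F (X *\<^sub>v v) = act [:0, 1:] (F v)" if "v \<in> carrier_vec n" for v
  proof -
    have "lcomp F X v = ?t v" using \<open>lcomp F X = ?t\<close> by simp
    then show ?thesis using that by (simp add: lcomp_def)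
  qed
  then have "compat F X" using X rmat_p_add[OF X1(1) Y(1)] X1(2) by (simp add: compat_def X_def)
  then show ?thesis by blast
qed

text \<open>
  Forming cokernels commutes with reduction modulo \<open>p\<close>.
\<close>

lemma pres_in_pres_lifts:
  assumes F: "F \<in> pres X (mat_image P X)" and X: "X \<in> carrier_mat n n" "rmat X = Xbar"
  shows "F \<in> pres_lifts"
proof -
  have L: "F \<in> lin" and surj: "F ` carrier_vec n = carrier M"
    and ker: "\<And>v. v \<in> carrier_vec n \<Longrightarrow> F v = \<zero> \<longleftrightarrow> v \<in> mat_image P X"
    and FX: "\<And>v. v \<in> carrier_vec n \<Longrightarrow> F (X *\<^sub>v v) = act [:0, 1:] (F v)"
    using F by (auto simp: pres_def)
  have Fp: "\<kappa> (F v) = \<kappa> (F w)" if vw: "v \<in> carrier_vec n" "w \<in> carrier_vec n" "rvec v = rvec w" for v w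
  proof -
    obtain u where u: "u \<in> carrier_vec n" "v = w + pM \<cdot>\<^sub>v u" using iffD1[OF rvec_eq_iff[OF vw(1,2)] vw(3)] by blast
    have "F v = F w \<oplus> sc pM (F u)" using u linD[OF L] vw by simp
    then have "F v \<ominus> F w = sc pM (F u)"
      using linD(1)[OF L] vw u by (simp add: mod.M.add_minus_cancel)
    then have "F v \<ominus> F w \<in> pmult" using linD(1)[OF L u(1)] by (auto simp: pmult_def)
    then show ?thesis using \<kappa>_eq_iff linD(1)[OF L] vw by simp
  qed
  let ?F = "\<lambda>v\<in>carrier_vec n. \<kappa> (F v)"
  have "F v \<in> pmult \<longleftrightarrow> rvec v \<in> mat_image Q Xbar" if v: "v \<in> carrier_vec n" for v
  proof
    assume "F v \<in> pmult"
    then obtain x where x: "x \<in> carrier M" "F v = sc pM x" by (auto simp: pmult_def)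
    then have "x \<in> F ` carrier_vec n" using surj by simp
    then obtain u where u: "u \<in> carrier_vec n" "F v = sc pM (F u)" using x by auto
    have "F (pM \<cdot>\<^sub>v u) = F v" using u linD(3)[OF L] by simp
    then have "F (v - pM \<cdot>\<^sub>v u) = \<zero>" using lin_eq_iff[OF L v, of "pM \<cdot>\<^sub>v u"] u by simp
    then have "v - pM \<cdot>\<^sub>v u \<in> mat_image P X" using ker v u by simp
    then obtain w where w: "w \<in> carrier_vec n" "v - pM \<cdot>\<^sub>v u = pmv P X w" using X by (auto simp: mat_image_def)
    have "pmv P X w + pM \<cdot>\<^sub>v u = v"
      using minus_add_cancel_vec[OF v smult_carrier_vec[THEN iffD2, OF u(1)], of pM] w(2) by simp
    then have "v = pmv P X w + pM \<cdot>\<^sub>v u" by (rule sym)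
    then have "rvec v = rvec (pmv P X w)"
      using rvec_eq_iff[OF v pmv_carrier[OF X(1) w(1), of P]] u by blast
    also have "\<dots> = pmv Q Xbar (rvec w)" using rvec_pmv[OF X(1) w(1)] X(2) by simp
    finally show "rvec v \<in> mat_image Q Xbar" using w mat_image_props(2)[OF Xbar] by simp
  next
    assume "rvec v \<in> mat_image Q Xbar"
    then obtain w where w: "w \<in> carrier_vec n" "rvec v = pmv Q Xbar w" using Xbar by (auto simp: mat_image_def)
    define w' where "w' = map_vec lift_res w"
    have w': "w' \<in> carrier_vec n" "rvec w' = w" using w rvec_lift by (auto simp: w'_def)
    have "rvec v = rvec (pmv P X w')" using rvec_pmv[OF X(1) w'(1), of P] w w' X(2) by simp
    then have "\<kappa> (F v) = \<kappa> (F (pmv P X w'))" by (rule Fp[OF v pmv_carrier[OF X(1) w'(1)]])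
    also have "F (pmv P X w') = \<zero>" using ker mat_image_props(2)[OF X(1) w'(1)] X w' by simp
    finally have "\<kappa> (F v) = \<zero>\<^bsub>Mbar\<^esub>" by (simp add: Mbar_simps(3))
    then show "F v \<in> pmult" using \<kappa>_zero_iff linD(1)[OF L v] by simp
  qed
  note ker' = this
  have im: "?F ` carrier_vec n = carrier Mbar"
  proof -
    have "?F ` carrier_vec n = \<kappa> ` F ` carrier_vec n" by (force simp: image_iff)
    then show ?thesis by (simp add: surj Mbar_simps(1))
  qed
  have eq: "?F (X1 *\<^sub>v v) = V.act [:0, 1:] (?F v)" if v: "v \<in> carrier_vec n" for v
  proof -
    have c: "X1 *\<^sub>v v \<in> carrier_vec n" "X *\<^sub>v v \<in> carrier_vec n"
      using mult_mat_vec_carrier[OF X1(1) v] mult_mat_vec_carrier[OF X(1) v] by auto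
    have "rvec (X1 *\<^sub>v v) = rvec (X *\<^sub>v v)"
      using residue.mult_mat_vec_hom[OF X1(1) v] residue.mult_mat_vec_hom[OF X(1) v] X1(2) X(2) by simp
    then have "\<kappa> (F (X1 *\<^sub>v v)) = \<kappa> (act [:0, 1:] (F v))" using Fp[OF c] FX[OF v] by simp
    then show ?thesis using v c linD(1)[OF L v] by (simp add: V_act)
  qed
  have kr: "?F v = \<zero>\<^bsub>Mbar\<^esub> \<longleftrightarrow> v \<in> V.res_image Xbar" if v: "v \<in> carrier_vec n" for v
    using ker'[OF v] \<kappa>_zero_iff[OF linD(1)[OF L v]] v by (simp add: V.res_image_def)
  have "?F \<in> V.pres X1 (V.res_image Xbar)"
    unfolding V.pres_def using \<kappa>_lin[OF L] im eq kr by blast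
  then show ?thesis using L by (simp add: pres_lifts_def)
qed

end

section \<open>The obstruction map\<close>

locale cok_pres = cok_setup P M n Xbar
  for P :: "'p :: prime_card padic_int poly" and M :: "('p padic_int poly set, 'm) module" (structure)
    and n and Xbar :: "'p mod_ring mat" +
  fixes F assumes pres_lifts: "F \<in> pres_lifts"
begin

lemmas F_lin = pres_liftsD(1)[OF pres_lifts]
lemmas F_surj = pres_lifts_surj[OF pres_lifts]

lemma compatD:
  assumes "compat F X"
  shows "X \<in> carrier_mat n n" "rmat X = Xbar" "v \<in> carrier_vec n \<Longrightarrow> F (X *\<^sub>v v) = act [:0, 1:] (F v)"
  using assms by (auto simp: compat_def)

lemma F_pmv: "compat F X \<Longrightarrow> v \<in> carrier_vec n \<Longrightarrow> F (pmv f X v) = act f (F v)"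
  by (rule lin_act[OF F_lin]) (auto simp: compat_def)

text \<open>
  The preimage of \<open>ker P(Xbar)\<close> in \<open>\<int>\<^sub>p^n\<close>. For \<open>w\<close> in it \<open>P(X) w\<close> is divisible by \<open>p\<close>, and
  the classes of the vectors \<open>P(X) w / p\<close> are precisely the \<open>p\<close>-torsion of the cokernel of
  \<open>P(X)\<close>. So \<open>obs X\<close> below describes the map from the \<open>p\<close>-torsion of the cokernel to that of
  \<open>M\<close> that \<open>F\<close> induces.
\<close>

definition W_lift :: "'p padic_int vec set" where
  "W_lift = {w \<in> carrier_vec n. rvec w \<in> carrier W}"

definition div_p :: "'p padic_int vec \<Rightarrow> 'p padic_int vec" where
  "div_p v = (SOME u. u \<in> carrier_vec n \<and> v = pM \<cdot>\<^sub>v u)"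

definition obs :: "'p padic_int mat \<Rightarrow> 'p padic_int vec \<Rightarrow> 'm" where
  "obs X w = F (div_p (pmv P X w))"

lemma div_p_eq: "u \<in> carrier_vec n \<Longrightarrow> v = pM \<cdot>\<^sub>v u \<Longrightarrow> div_p v = u"
proof -
  assume u: "u \<in> carrier_vec n" "v = pM \<cdot>\<^sub>v u"
  have "div_p v \<in> carrier_vec n \<and> v = pM \<cdot>\<^sub>v div_p v"
    unfolding div_p_def by (rule someI[of _ u]) (use u in simp)
  then show "div_p v = u" using u smult_p_vec_cancel[of "div_p v" n u] by simp
qed

lemma obs_eq: "u \<in> carrier_vec n \<Longrightarrow> pmv P X w = pM \<cdot>\<^sub>v u \<Longrightarrow> obs X w = F u"
  by (simp add: obs_def div_p_eq)

lemma W_liftD: "w \<in> W_lift \<Longrightarrow> w \<in> carrier_vec n"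
  by (simp add: W_lift_def)

lemma W_lift_div:
  assumes X: "compat F X" and w: "w \<in> W_lift"
  shows "\<exists>u\<in>carrier_vec n. pmv P X w = pM \<cdot>\<^sub>v u"
proof -
  have wc: "w \<in> carrier_vec n" using w by (simp add: W_lift_def)
  have "rvec (pmv P X w) = 0\<^sub>v n"
    using rvec_pmv[OF compatD(1)[OF X] wc] compatD(2)[OF X] w by (simp add: W_lift_def W_simps)
  then show ?thesis using rvec_eq_0_iff[OF pmv_carrier[OF compatD(1)[OF X] wc]] by simp
qed

lemma obs_add:
  assumes X: "compat F X" and w: "w \<in> W_lift" "w' \<in> W_lift"
  shows "obs X (w + w') = obs X w \<oplus> obs X w'"
proof -
  obtain u where u: "u \<in> carrier_vec n" "pmv P X w = pM \<cdot>\<^sub>v u" using W_lift_div[OF X w(1)] by blast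
  obtain u' where u': "u' \<in> carrier_vec n" "pmv P X w' = pM \<cdot>\<^sub>v u'" using W_lift_div[OF X w(2)] by blast
  have "pmv P X (w + w') = pM \<cdot>\<^sub>v (u + u')"
    using pmv_add[OF compatD(1)[OF X] W_liftD[OF w(1)] W_liftD[OF w(2)], of P] u u' by (simp add: smult_add_distrib_vec[of _ n])
  then have "obs X (w + w') = F (u + u')" by (rule obs_eq[rotated]) (use u u' in simp)
  then show ?thesis using obs_eq[OF u] obs_eq[OF u'] linD(2)[OF F_lin u(1) u'(1)] by simp
qed

lemma obs_p:
  assumes X: "compat F X" and w: "w \<in> W_lift" and x: "x \<in> carrier_vec n"
  shows "obs X (w + pM \<cdot>\<^sub>v x) = obs X w"
proof -
  note Xc = compatD(1)[OF X] and wc = W_liftD[OF w]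
  obtain u where u: "u \<in> carrier_vec n" "pmv P X w = pM \<cdot>\<^sub>v u" using W_lift_div[OF X w] by blast
  have c: "pmv P X x \<in> carrier_vec n" using Xc x by simp
  have "pmv P X (w + pM \<cdot>\<^sub>v x) = pM \<cdot>\<^sub>v (u + pmv P X x)"
    using pmv_add[OF Xc wc, of "pM \<cdot>\<^sub>v x" P] pmv_smult[OF Xc x, of P pM] u c x
    by (simp add: smult_add_distrib_vec[of _ n])
  then have "obs X (w + pM \<cdot>\<^sub>v x) = F (u + pmv P X x)" by (rule obs_eq[rotated]) (use u c in simp)
  also have "\<dots> = F u \<oplus> act P (F x)" using linD(2)[OF F_lin u(1) c] F_pmv[OF X x, of P] by simp
  also have "\<dots> = F u" using linD(1)[OF F_lin] u x by (simp add: act_P)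
  finally show ?thesis using obs_eq[OF u] by simp
qed

lemma obs_cong:
  assumes X: "compat F X" and w: "w \<in> W_lift" "w' \<in> W_lift" "rvec w = rvec w'"
  shows "obs X w = obs X w'"
proof -
  obtain x where "x \<in> carrier_vec n" "w = w' + pM \<cdot>\<^sub>v x"
    using iffD1[OF rvec_eq_iff[OF W_liftD[OF w(1)] W_liftD[OF w(2)]] w(3)] by blast
  then show ?thesis using obs_p[OF X w(2)] by simp
qed

lemma W_lift_pmv: "compat F X \<Longrightarrow> w \<in> W_lift \<Longrightarrow> pmv f X w \<in> W_lift"
  using rvec_pmv[OF compatD(1) W_liftD, of X w f] W_pmv[of "rvec w" "poly_residue f"] compatD(2)[of X]
    pmv_carrier[OF compatD(1) W_liftD, of X w f] by (simp add: W_lift_def)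

lemma obs_act:
  assumes X: "compat F X" and w: "w \<in> W_lift"
  shows "obs X (pmv f X w) = act f (obs X w)"
proof -
  note Xc = compatD(1)[OF X] and wc = W_liftD[OF w]
  obtain u where u: "u \<in> carrier_vec n" "pmv P X w = pM \<cdot>\<^sub>v u" using W_lift_div[OF X w] by blast
  have "pmv P X (pmv f X w) = pM \<cdot>\<^sub>v pmv f X u"
    using pmv_comm[OF Xc wc, of P f] pmv_smult[OF Xc u(1), of f pM] u by simp
  then have "obs X (pmv f X w) = F (pmv f X u)" by (rule obs_eq[rotated]) (use u Xc in simp)
  then show ?thesis using F_pmv[OF X u(1)] obs_eq[OF u] by simp
qed

lemma obs_tors:
  assumes X: "compat F X" and w: "w \<in> W_lift"
  shows "obs X w \<in> carrier tors"
proof -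
  obtain u where u: "u \<in> carrier_vec n" "pmv P X w = pM \<cdot>\<^sub>v u" using W_lift_div[OF X w] by blast
  have "sc pM (F u) = F (pmv P X w)" using linD(3)[OF F_lin u(1)] u by simp
  also have "\<dots> = \<zero>" using F_pmv[OF X W_liftD[OF w]] linD(1)[OF F_lin W_liftD[OF w]] by (simp add: act_P)
  finally show ?thesis using obs_eq[OF u] linD(1)[OF F_lin u(1)] by (simp add: tors_simps)
qed

abbreviation lft :: "'p mod_ring vec \<Rightarrow> 'p padic_int vec" where
  "lft \<equiv> map_vec lift_res"

lemma lft_W_lift: "w \<in> carrier W \<Longrightarrow> lft w \<in> W_lift" "w \<in> carrier W \<Longrightarrow> rvec (lft w) = w"
  using rvec_lift[of w n] by (auto simp: W_lift_def W_simps)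

text \<open>
  The map \<open>obs X\<close> only depends on \<open>w\<close> modulo \<open>p\<close>, so the lift of \<open>w\<close> is immaterial.
\<close>

definition \<delta> :: "'p padic_int mat \<Rightarrow> 'p mod_ring vec \<Rightarrow> 'm" where
  "\<delta> X = (\<lambda>w\<in>carrier W. obs X (lft w))"

lemma \<delta>_eq: "compat F X \<Longrightarrow> w \<in> W_lift \<Longrightarrow> \<delta> X (rvec w) = obs X w"
  using obs_cong[of X "lft (rvec w)" w] lft_W_lift[of "rvec w"] by (simp add: \<delta>_def W_lift_def)

lemma W_rep:
  assumes "c \<in> carrier K" obtains f where "c = pcls Q (poly_residue f)"
  by (rule poly_quot_residue_rep[OF assms])

lemma \<delta>_hom:
  assumes X: "compat F X"
  shows "\<delta> X \<in> WT.homs (carrier W)"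
  unfolding WT.homs_def
proof (intro CollectI conjI ballI)
  show "\<delta> X \<in> carrier W \<rightarrow>\<^sub>E carrier T.desc"
    using obs_tors[OF X] lft_W_lift by (auto simp: \<delta>_def T.desc_simps)
next
  fix x y assume x: "x \<in> carrier W" and y: "y \<in> carrier W"
  have xy: "lft x + lft y \<in> W_lift"
  proof -
    have "rvec (lft x + lft y) = x + y" using x y by (simp add: rvec_add[of _ ] lft_W_lift W_simps)
    moreover have "x + y \<in> carrier W" using WT.V.M.a_closed[OF x y] by (simp add: W_simps(3))
    ultimately show ?thesis using x y by (simp add: W_lift_def W_simps)
  qed
  have "rvec (lft x + lft y) = x + y" using x y by (simp add: rvec_add lft_W_lift W_simps)
  then have "\<delta> X (x + y) = obs X (lft x + lft y)" using \<delta>_eq[OF X xy] by simp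
  then show "\<delta> X (x \<oplus>\<^bsub>W\<^esub> y) = \<delta> X x \<oplus>\<^bsub>T.desc\<^esub> \<delta> X y"
    using obs_add[OF X lft_W_lift(1)[OF x] lft_W_lift(1)[OF y]] x y
    by (simp add: W_simps(3) T.desc_simps tors_simps \<delta>_def)
next
  fix c x assume c: "c \<in> carrier K" and x: "x \<in> carrier W"
  obtain f where f: "c = pcls Q (poly_residue f)" by (rule W_rep[OF c])
  have "rvec (pmv f X (lft x)) = pmv (poly_residue f) Xbar x"
    using rvec_pmv[OF compatD(1)[OF X] W_liftD[OF lft_W_lift(1)[OF x]]] compatD(2)[OF X] lft_W_lift(2)[OF x] by simp
  then have "\<delta> X (pmv (poly_residue f) Xbar x) = act f (obs X (lft x))"
    using \<delta>_eq[OF X W_lift_pmv[OF X lft_W_lift(1)[OF x], of f]] obs_act[OF X lft_W_lift(1)[OF x]] by simp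
  then show "\<delta> X (c \<odot>\<^bsub>W\<^esub> x) = c \<odot>\<^bsub>T.desc\<^esub> \<delta> X x"
    using x obs_tors[OF X lft_W_lift(1)[OF x]] by (simp add: f W_smult T.desc_smult \<delta>_def)
qed

lemma card_W_tors: "card (carrier W) = card (carrier tors)"
proof -
  have "(\<lambda>v\<in>carrier_vec n. \<kappa> (F v)) \<in> V.pres X1 (V.res_image Xbar)" using pres_lifts by (simp add: pres_lifts_def)
  then show ?thesis using card_W[OF _ X1(1)] card_Mbar_tors by simp
qed

lemma finite_tors: "finite (carrier tors)"
  using fin by (simp add: tors_simps)

text \<open>
  Let \<open>C\<close> be the cokernel of \<open>P(X)\<close> and \<open>N\<close> the kernel of the map from \<open>C\<close> onto \<open>M\<close> that \<open>F\<close>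
  induces. This map is an isomorphism modulo \<open>p\<close>, so by the snake lemma \<open>N/pN\<close> is the cokernel
  of the map from \<open>C[p]\<close> to \<open>M[p]\<close>, which is \<open>\<delta> X\<close>. Hence \<open>N = 0\<close> if and only if \<open>\<delta> X\<close> is
  onto, and as its source and target have the same size, if and only if it is injective.
\<close>

lemma pres_iff_\<delta>:
  assumes X: "compat F X"
  shows "F \<in> pres X (mat_image P X) \<longleftrightarrow> \<delta> X \<in> WT.injs (carrier W)"
proof -
  note Xc = compatD(1)[OF X]
  have sub: "\<delta> X ` carrier W \<subseteq> carrier tors" using WT.homs_D(5)[OF \<delta>_hom[OF X]] by (auto simp: T.desc_simps)
  have inj_surj: "\<delta> X \<in> WT.injs (carrier W) \<longleftrightarrow> \<delta> X ` carrier W = carrier tors"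
  proof
    assume "\<delta> X \<in> WT.injs (carrier W)"
    then have "card (\<delta> X ` carrier W) = card (carrier tors)" using card_W_tors by (simp add: WT.injs_def card_image)
    then show "\<delta> X ` carrier W = carrier tors" using sub finite_tors card_subset_eq by blast
  next
    assume "\<delta> X ` carrier W = carrier tors"
    then have "inj_on (\<delta> X) (carrier W)" using card_W_tors WT.finV by (simp add: eq_card_imp_inj_on)
    then show "\<delta> X \<in> WT.injs (carrier W)" using \<delta>_hom[OF X] by (simp add: WT.injs_def)
  qed
  have im: "F v = \<zero>" if v: "v \<in> mat_image P X" for v
  proof -
    obtain w where "w \<in> carrier_vec n" "v = pmv P X w" using v Xc by (auto simp: mat_image_def)
    then show ?thesis using F_pmv[OF X] linD(1)[OF F_lin] by (simp add: act_P)
  qed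
  show ?thesis unfolding inj_surj
  proof
    assume "F \<in> pres X (mat_image P X)"
    then have ker: "\<And>v. v \<in> carrier_vec n \<Longrightarrow> F v = \<zero> \<longleftrightarrow> v \<in> mat_image P X" by (auto simp: pres_def)
    have "g \<in> \<delta> X ` carrier W" if g: "g \<in> carrier tors" for g
    proof -
      have gM: "g \<in> carrier M" "sc pM g = \<zero>" using g by (auto simp: tors_simps)
      then have "g \<in> F ` carrier_vec n" using F_surj by simp
      then obtain u where u: "u \<in> carrier_vec n" "g = F u" by auto
      have "F (pM \<cdot>\<^sub>v u) = \<zero>" using linD(3)[OF F_lin u(1)] gM u by simp
      then have "pM \<cdot>\<^sub>v u \<in> mat_image P X" using ker[of "pM \<cdot>\<^sub>v u"] u by simp
      then obtain w where w: "w \<in> carrier_vec n" "pM \<cdot>\<^sub>v u = pmv P X w" using Xc by (auto simp: mat_image_def)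
      have "rvec (pmv P X w) = 0\<^sub>v n"
        by (rule iffD2[OF rvec_eq_0_iff[OF pmv_carrier[OF Xc w(1)]]]) (use u(1) w(2) in \<open>intro bexI[of _ u], simp_all\<close>)
      then have wW: "w \<in> W_lift" using rvec_pmv[OF Xc w(1)] compatD(2)[OF X] w by (simp add: W_lift_def W_simps)
      moreover have "obs X w = g" using obs_eq[OF u(1) w(2)[symmetric]] u by simp
      ultimately have "g = \<delta> X (rvec w)" using \<delta>_eq[OF X, of w] by simp
      then show ?thesis using wW by (intro image_eqI[of _ _ "rvec w"]) (auto simp: W_lift_def)
    qed
    then show "\<delta> X ` carrier W = carrier tors" using sub by blast
  next
    assume s: "\<delta> X ` carrier W = carrier tors"
    define A where "A = poly_mat P X"
    define K0 where "K0 = {v \<in> carrier_vec n. F v = \<zero>}"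
    have AX: "A \<in> carrier_mat n n" using Xc by (simp add: A_def)
    (* K0 / P(X) Z_p^n is the kernel N, and the claim says that N = p N. *)
    have nak: "\<exists>w \<in> carrier_vec n. \<exists>v' \<in> K0. v = A *\<^sub>v w + pM \<cdot>\<^sub>v v'" if v: "v \<in> K0" for v
    proof -
      have vc: "v \<in> carrier_vec n" "F v = \<zero>" using v by (auto simp: K0_def)
      have "\<zero> \<in> pmult" by (rule additive_subgroup.zero_closed[OF pm.additive_subgroup_axioms])
      then have "rvec v \<in> mat_image Q Xbar" using pres_liftsD(4)[OF pres_lifts vc(1)] vc by simp
      then obtain wb where wb: "wb \<in> carrier_vec n" "rvec v = pmv Q Xbar wb" using Xbar by (auto simp: mat_image_def)
      define w where "w = lft wb"
      have w: "w \<in> carrier_vec n" "rvec w = wb" using wb rvec_lift by (auto simp: w_def)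
      have pc: "pmv P X w \<in> carrier_vec n" using Xc w by simp
      have "rvec v = rvec (pmv P X w)" using rvec_pmv[OF Xc w(1), of P] wb w compatD(2)[OF X] by simp
      then obtain u where u: "u \<in> carrier_vec n" "v = pmv P X w + pM \<cdot>\<^sub>v u"
        using iffD1[OF rvec_eq_iff[OF vc(1) pc]] by blast
      have "F (pmv P X w) = \<zero>" using F_pmv[OF X w(1)] linD(1)[OF F_lin w(1)] by (simp add: act_P)
      then have "sc pM (F u) = \<zero>"
        using vc u linD(2)[OF F_lin pc, of "pM \<cdot>\<^sub>v u"] linD(3)[OF F_lin u(1), of pM] linD(1)[OF F_lin u(1)] by simp
      then have "F u \<in> carrier tors" using linD(1)[OF F_lin u(1)] by (simp add: tors_simps)
      then obtain x where x: "x \<in> carrier W" "F u = obs X (lft x)" using s by (auto simp: \<delta>_def image_iff)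
      have xc: "lft x \<in> carrier_vec n" using W_liftD[OF lft_W_lift(1)[OF x(1)]] .
      obtain y where y: "y \<in> carrier_vec n" "pmv P X (lft x) = pM \<cdot>\<^sub>v y" using W_lift_div[OF X lft_W_lift(1)[OF x(1)]] by blast
      have "F u = F y" using x(2) obs_eq[OF y] by simp
      then have "u - y \<in> K0" using lin_eq_iff[OF F_lin u(1) y(1)] u y by (simp add: K0_def)
      moreover have "v = A *\<^sub>v (w + lft x) + pM \<cdot>\<^sub>v (u - y)"
      proof -
        have "A *\<^sub>v (w + lft x) = pmv P X w + pM \<cdot>\<^sub>v y"
          using pmv_add[OF Xc w(1) xc, of P] y by (simp add: A_def)
        then show ?thesis using u y pc by (intro eq_vecI) (auto simp: algebra_simps)
      qed
      ultimately show ?thesis using w(1) xc by (intro bexI[of _ "w + lft x"] bexI[of _ "u - y"]) auto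
    qed
    have "v \<in> mat_image P X" if "v \<in> carrier_vec n" "F v = \<zero>" for v
    proof -
      have "\<exists>u \<in> carrier_vec n. v = A *\<^sub>v u"
        by (rule matrix_nakayama[OF AX _ nak]) (use that in \<open>auto simp: K0_def\<close>)
      then show ?thesis using Xc by (auto simp: A_def mat_image_def)
    qed
    then show "F \<in> pres X (mat_image P X)"
      using im F_lin F_surj compatD(3)[OF X] unfolding pres_def by blast
  qed
qed

section \<open>Varying the matrix within its residue class\<close>

text \<open>
  For the list \<open>as\<close> of the coefficients of a polynomial \<open>f\<close>, \<open>dquot X as Z\<close> is the difference
  quotient of \<open>f\<close>, namely the sum of \<open>a\<^sub>k t^i (Z \<circ> X^j)\<close> over all \<open>i + j + 1 = k\<close>, in Horner
  form, and \<open>dquot_vec\<close> is its analogue on vectors, in which \<open>X + p Y\<close> takes the place of \<open>t\<close>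
  and \<open>Y\<close> that of \<open>Z\<close>. The expansion of \<open>f(X + p Y) = f(X) + p E\<close> has \<open>E = dquot_vec X Y as\<close>,
  and \<open>F \<circ> E\<close> only involves \<open>Z = F \<circ> Y\<close>.
\<close>

primrec dquot :: "'p padic_int mat \<Rightarrow> 'p padic_int list \<Rightarrow> ('p padic_int vec \<Rightarrow> 'm) \<Rightarrow> 'p padic_int vec \<Rightarrow> 'm" where
  "dquot X [] Z v = \<zero>"
| "dquot X (a # as) Z v = act [:0, 1:] (dquot X as Z v) \<oplus> Z (pmv (Poly as) X v)"

primrec dquot_vec :: "'p padic_int mat \<Rightarrow> 'p padic_int mat \<Rightarrow> 'p padic_int list \<Rightarrow> 'p padic_int vec \<Rightarrow> 'p padic_int vec" where
  "dquot_vec X Y [] v = 0\<^sub>v n"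
| "dquot_vec X Y (a # as) v = (X + pM \<cdot>\<^sub>m Y) *\<^sub>v dquot_vec X Y as v + Y *\<^sub>v pmv (Poly as) X v"

lemma dquot_closed:
  assumes "Z \<in> lin" "X \<in> carrier_mat n n" "v \<in> carrier_vec n"
  shows "dquot X as Z v \<in> carrier M"
  by (induction as) (use linD(1)[OF assms(1)] assms in auto)

lemma pmv_vary:
  assumes X: "X \<in> carrier_mat n n" and Y: "Y \<in> carrier_mat n n" and v: "v \<in> carrier_vec n"
  shows "dquot_vec X Y as v \<in> carrier_vec n \<and> pmv (Poly as) (X + pM \<cdot>\<^sub>m Y) v = pmv (Poly as) X v + pM \<cdot>\<^sub>v dquot_vec X Y as v"
proof (induction as)
  case Nil
  then show ?case using X Y v by (auto simp: pmv_0[of _ n])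
next
  case (Cons a as)
  define X' where "X' = X + pM \<cdot>\<^sub>m Y"
  define e where "e = dquot_vec X Y as v"
  define m where "m = pmv (Poly as) X v"
  have X': "X' \<in> carrier_mat n n" using X Y by (simp add: X'_def)
  have e: "e \<in> carrier_vec n" and IH: "pmv (Poly as) X' v = m + pM \<cdot>\<^sub>v e" using Cons by (auto simp: e_def X'_def m_def)
  have m: "m \<in> carrier_vec n" using X v by (simp add: m_def)
  have c: "X *\<^sub>v m \<in> carrier_vec n" "Y *\<^sub>v m \<in> carrier_vec n" "X' *\<^sub>v e \<in> carrier_vec n"
    using X Y X' m e by (auto intro: mult_mat_vec_carrier)
  have "pmv (Poly (a # as)) X' v = a \<cdot>\<^sub>v v + X' *\<^sub>v (m + pM \<cdot>\<^sub>v e)"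
    using pmv_pCons[OF X' v, of a "Poly as"] IH by simp
  also have "X' *\<^sub>v (m + pM \<cdot>\<^sub>v e) = X' *\<^sub>v m + pM \<cdot>\<^sub>v (X' *\<^sub>v e)"
    using mult_add_distrib_mat_vec[OF X' m, of "pM \<cdot>\<^sub>v e"] mat_vec_smult[OF X' e] e by simp
  also have "X' *\<^sub>v m = X *\<^sub>v m + pM \<cdot>\<^sub>v (Y *\<^sub>v m)" unfolding X'_def by (rule mat_p_add[OF X Y m])
  also have "a \<cdot>\<^sub>v v + (X *\<^sub>v m + pM \<cdot>\<^sub>v (Y *\<^sub>v m) + pM \<cdot>\<^sub>v (X' *\<^sub>v e))
      = (a \<cdot>\<^sub>v v + X *\<^sub>v m) + pM \<cdot>\<^sub>v (X' *\<^sub>v e + Y *\<^sub>v m)"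
  proof -
    have "a \<cdot>\<^sub>v v + (x + pM \<cdot>\<^sub>v y + pM \<cdot>\<^sub>v z) = (a \<cdot>\<^sub>v v + x) + pM \<cdot>\<^sub>v (z + y)"
      if "x \<in> carrier_vec n" "y \<in> carrier_vec n" "z \<in> carrier_vec n" for x y z :: "'p padic_int vec"
      using that v by (intro eq_vecI) (auto simp: algebra_simps)
    from this[OF c] show ?thesis .
  qed
  also have "a \<cdot>\<^sub>v v + X *\<^sub>v m = pmv (Poly (a # as)) X v" using pmv_pCons[OF X v, of a "Poly as"] by (simp add: m_def)
  finally show ?case using c by (simp add: X'_def e_def m_def)
qed

lemma F_dquot_vec:
  assumes X: "X \<in> carrier_mat n n" and Y: "Y \<in> carrier_mat n n" and v: "v \<in> carrier_vec n"
    and X': "compat F (X + pM \<cdot>\<^sub>m Y)"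
  shows "F (dquot_vec X Y as v) = dquot X as (lcomp F Y) v"
proof (induction as)
  case Nil
  then show ?case using lin_zero[OF F_lin] by simp
next
  case (Cons a as)
  have e: "dquot_vec X Y as v \<in> carrier_vec n" using pmv_vary[OF X Y v] by simp
  have m: "pmv (Poly as) X v \<in> carrier_vec n" using X v by simp
  have c: "(X + pM \<cdot>\<^sub>m Y) *\<^sub>v dquot_vec X Y as v \<in> carrier_vec n" "Y *\<^sub>v pmv (Poly as) X v \<in> carrier_vec n"
    using mult_mat_vec_carrier[OF compatD(1)[OF X'] e] mult_mat_vec_carrier[OF Y m] by auto
  show ?case
    using linD(2)[OF F_lin c] compatD(3)[OF X' e] Cons m by (simp add: lcomp_def)
qed

lemma obs_vary:
  assumes X: "compat F X" and Y: "Y \<in> carrier_mat n n" and X': "compat F (X + pM \<cdot>\<^sub>m Y)" and w: "w \<in> W_lift"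
  shows "obs (X + pM \<cdot>\<^sub>m Y) w = obs X w \<oplus> dquot X (coeffs P) (lcomp F Y) w"
proof -
  note Xc = compatD(1)[OF X] and wc = W_liftD[OF w]
  obtain u where u: "u \<in> carrier_vec n" "pmv P X w = pM \<cdot>\<^sub>v u" using W_lift_div[OF X w] by blast
  note E = pmv_vary[OF Xc Y wc, of "coeffs P", unfolded Poly_coeffs]
  have "pmv P (X + pM \<cdot>\<^sub>m Y) w = pM \<cdot>\<^sub>v (u + dquot_vec X Y (coeffs P) w)"
    using E u by (simp add: smult_add_distrib_vec[of _ n])
  then have "obs (X + pM \<cdot>\<^sub>m Y) w = F (u + dquot_vec X Y (coeffs P) w)" by (rule obs_eq[rotated]) (use u E in simp)
  then show ?thesis using linD(2)[OF F_lin u(1)] E obs_eq[OF u] F_dquot_vec[OF Xc Y wc X'] by simp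
qed

lemma compat_vary_iff:
  assumes X: "compat F X" and Y: "Y \<in> carrier_mat n n"
  shows "compat F (X + pM \<cdot>\<^sub>m Y) \<longleftrightarrow> lcomp F Y \<in> T.lin"
proof -
  note Xc = compatD(1)[OF X]
  have L: "lcomp F Y \<in> lin" by (rule lcomp_lin[OF F_lin Y])
  have v: "F ((X + pM \<cdot>\<^sub>m Y) *\<^sub>v v) = act [:0, 1:] (F v) \<longleftrightarrow> sc pM (lcomp F Y v) = \<zero>" if v: "v \<in> carrier_vec n" for v
  proof -
    have c: "X *\<^sub>v v \<in> carrier_vec n" "Y *\<^sub>v v \<in> carrier_vec n"
      using mult_mat_vec_carrier[OF Xc v] mult_mat_vec_carrier[OF Y v] by auto
    have "F ((X + pM \<cdot>\<^sub>m Y) *\<^sub>v v) = act [:0, 1:] (F v) \<oplus> sc pM (lcomp F Y v)"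
      unfolding mat_p_add[OF Xc Y v]
      using linD(2)[OF F_lin c(1), of "pM \<cdot>\<^sub>v (Y *\<^sub>v v)"] linD(3)[OF F_lin c(2), of pM] c compatD(3)[OF X v] v
      by (simp add: lcomp_def)
    then show ?thesis using linD(1)[OF L v] linD(1)[OF F_lin v] by simp
  qed
  have "X + pM \<cdot>\<^sub>m Y \<in> carrier_mat n n" using Xc Y by simp
  moreover have "rmat (X + pM \<cdot>\<^sub>m Y) = Xbar" using rmat_p_add[OF Xc Y] compatD(2)[OF X] by simp
  ultimately show ?thesis using v L by (simp add: compat_def T_lin)
qed

end

lemma vec_add_swap:
  fixes a b x y :: "'a :: ab_semigroup_add vec"
  assumes "a \<in> carrier_vec n" "b \<in> carrier_vec n" "x \<in> carrier_vec n" "y \<in> carrier_vec n"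
  shows "(a + x) + (b + y) = (a + b) + (x + y)"
  using assms by (intro eq_vecI) (auto simp: ac_simps)

context cok_pres
begin

definition ladd :: "('p padic_int vec \<Rightarrow> 'm) \<Rightarrow> ('p padic_int vec \<Rightarrow> 'm) \<Rightarrow> 'p padic_int vec \<Rightarrow> 'm" where
  "ladd Z Z' = (\<lambda>v\<in>carrier_vec n. Z v \<oplus> Z' v)"

definition lneg :: "('p padic_int vec \<Rightarrow> 'm) \<Rightarrow> 'p padic_int vec \<Rightarrow> 'm" where
  "lneg Z = (\<lambda>v\<in>carrier_vec n. \<ominus> Z v)"

lemma act_neg: "x \<in> carrier M \<Longrightarrow> act f (\<ominus> x) = \<ominus> act f x"
  by (simp add: act_def mod.smult_r_minus)

lemma T_linD: "Z \<in> T.lin \<Longrightarrow> Z \<in> lin" "Z \<in> T.lin \<Longrightarrow> v \<in> carrier_vec n \<Longrightarrow> sc pM (Z v) = \<zero>"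
  by (auto simp: T_lin)

lemma ladd_lin:
  assumes Z: "Z \<in> T.lin" and Z': "Z' \<in> T.lin"
  shows "ladd Z Z' \<in> T.lin"
proof -
  have c: "Z v \<in> carrier M" "Z' v \<in> carrier M" if "v \<in> carrier_vec n" for v
    using linD(1)[OF T_linD(1)[OF Z] that] linD(1)[OF T_linD(1)[OF Z'] that] by auto
  have sw: "a \<oplus> b \<oplus> (a' \<oplus> b') = a \<oplus> a' \<oplus> (b \<oplus> b')"
    if "a \<in> carrier M" "b \<in> carrier M" "a' \<in> carrier M" "b' \<in> carrier M" for a b a' b'
    using that by (simp add: mod.M.a_ac)
  have "ladd Z Z' (v + w) = ladd Z Z' v \<oplus> ladd Z Z' w" if v: "v \<in> carrier_vec n" and w: "w \<in> carrier_vec n" for v w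
    using linD(2)[OF T_linD(1)[OF Z] v w] linD(2)[OF T_linD(1)[OF Z'] v w] v w sw[OF c(1)[OF v] c(1)[OF w] c(2)[OF v] c(2)[OF w]]
    by (simp add: ladd_def)
  moreover have "ladd Z Z' (a \<cdot>\<^sub>v v) = sc a (ladd Z Z' v)" if v: "v \<in> carrier_vec n" for a v
    using linD(3)[OF T_linD(1)[OF Z] v] linD(3)[OF T_linD(1)[OF Z'] v] v c[OF v] by (simp add: ladd_def act_add)
  moreover have "sc pM (ladd Z Z' v) = \<zero>" if v: "v \<in> carrier_vec n" for v
    using T_linD(2)[OF Z v] T_linD(2)[OF Z' v] c[OF v] v by (simp add: ladd_def act_add)
  moreover have "ladd Z Z' \<in> carrier_vec n \<rightarrow>\<^sub>E carrier M" using c by (simp add: ladd_def)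
  ultimately show ?thesis unfolding T_lin lin_def by blast
qed

lemma lneg_lin:
  assumes Z: "Z \<in> T.lin"
  shows "lneg Z \<in> T.lin"
proof -
  have c: "Z v \<in> carrier M" if "v \<in> carrier_vec n" for v
    using linD(1)[OF T_linD(1)[OF Z] that] .
  have "lneg Z (v + w) = lneg Z v \<oplus> lneg Z w" if v: "v \<in> carrier_vec n" and w: "w \<in> carrier_vec n" for v w
    using linD(2)[OF T_linD(1)[OF Z] v w] v w mod.M.minus_add[OF c[OF v] c[OF w]] by (simp add: lneg_def)
  moreover have "lneg Z (a \<cdot>\<^sub>v v) = sc a (lneg Z v)" if v: "v \<in> carrier_vec n" for a v
    using linD(3)[OF T_linD(1)[OF Z] v] v c[OF v] by (simp add: lneg_def act_neg)
  moreover have "sc pM (lneg Z v) = \<zero>" if v: "v \<in> carrier_vec n" for v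
    using T_linD(2)[OF Z v] c[OF v] v act_zero[of "[:pM:]"] by (simp add: lneg_def act_neg mod.M.minus_equality)
  moreover have "lneg Z \<in> carrier_vec n \<rightarrow>\<^sub>E carrier M" using c by (simp add: lneg_def)
  ultimately show ?thesis unfolding T_lin lin_def by blast
qed

lemma dquot_ladd:
  assumes X: "X \<in> carrier_mat n n" and Z: "Z \<in> T.lin" "Z' \<in> T.lin" and v: "v \<in> carrier_vec n"
  shows "dquot X as (ladd Z Z') v = dquot X as Z v \<oplus> dquot X as Z' v"
proof (induction as)
  case Nil
  then show ?case by simp
next
  case (Cons a as)
  have m: "pmv (Poly as) X v \<in> carrier_vec n" using X v by simp
  have c: "dquot X as Z v \<in> carrier M" "dquot X as Z' v \<in> carrier M"
    using dquot_closed[OF T_linD(1) X v] Z by auto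
  have z: "Z (pmv (Poly as) X v) \<in> carrier M" "Z' (pmv (Poly as) X v) \<in> carrier M"
    using linD(1)[OF T_linD(1) m] Z by auto
  have "ladd Z Z' (pmv (Poly as) X v) = Z (pmv (Poly as) X v) \<oplus> Z' (pmv (Poly as) X v)" using m by (simp add: ladd_def)
  then show ?case using Cons c z by (simp add: act_add mod.M.a_ac)
qed

lemma dquot_lneg:
  assumes X: "X \<in> carrier_mat n n" and Z: "Z \<in> T.lin" and v: "v \<in> carrier_vec n"
  shows "dquot X as (lneg Z) v = \<ominus> dquot X as Z v"
proof (induction as)
  case Nil
  have "\<ominus> \<zero> = \<zero>" by (rule mod.M.minus_equality) auto
  then show ?case unfolding dquot.simps by (rule sym)
next
  case (Cons a as)
  have m: "pmv (Poly as) X v \<in> carrier_vec n" using X v by simp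
  have c: "dquot X as Z v \<in> carrier M" "Z (pmv (Poly as) X v) \<in> carrier M"
    using dquot_closed[OF T_linD(1)[OF Z] X v] linD(1)[OF T_linD(1)[OF Z] m] by auto
  have "lneg Z (pmv (Poly as) X v) = \<ominus> Z (pmv (Poly as) X v)" using m by (simp add: lneg_def)
  then show ?case using Cons c by (simp add: act_neg mod.M.minus_add)
qed

text \<open>
  The map \<open>\<delta>\<close> of \<open>X + p Y\<close> as a function of \<open>Z = F \<circ> Y\<close>.
\<close>

definition obs_of :: "'p padic_int mat \<Rightarrow> ('p padic_int vec \<Rightarrow> 'm) \<Rightarrow> 'p mod_ring vec \<Rightarrow> 'm" where
  "obs_of X Z = (\<lambda>w\<in>carrier W. \<delta> X w \<oplus> dquot X (coeffs P) Z (lft w))"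

lemma obs_of_eq_\<delta>:
  assumes X: "compat F X" and Y: "Y \<in> carrier_mat n n" and X': "compat F (X + pM \<cdot>\<^sub>m Y)"
  shows "obs_of X (lcomp F Y) = \<delta> (X + pM \<cdot>\<^sub>m Y)"
  unfolding obs_of_def \<delta>_def using obs_vary[OF X Y X' lft_W_lift(1)] by (intro restrict_ext) simp

text \<open>
  As \<open>F\<close> is onto, each \<open>Z\<close> has the form \<open>F \<circ> Y\<close>, so this is the map \<open>\<delta>\<close> of the matrix
  \<open>X + p Y\<close>.
\<close>

lemma obs_of_hom:
  assumes X: "compat F X" and Z: "Z \<in> T.lin"
  shows "obs_of X Z \<in> WT.homs (carrier W)"
proof -
  obtain Y where Y: "Y \<in> carrier_mat n n" "lcomp F Y = Z"
    using lin_surj_lift[OF F_lin F_surj T_linD(1)[OF Z]] by blast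
  then have "compat F (X + pM \<cdot>\<^sub>m Y)" using compat_vary_iff[OF X Y(1)] Z by simp
  then show ?thesis using obs_of_eq_\<delta>[OF X Y(1)] \<delta>_hom Y(2) by simp
qed

lemma pres_vary_iff:
  assumes X: "compat F X" and Y: "Y \<in> carrier_mat n n"
  shows "F \<in> pres (X + pM \<cdot>\<^sub>m Y) (mat_image P (X + pM \<cdot>\<^sub>m Y)) \<longleftrightarrow>
    lcomp F Y \<in> T.lin \<and> obs_of X (lcomp F Y) \<in> WT.injs (carrier W)"
proof -
  let ?X = "X + pM \<cdot>\<^sub>m Y"
  have "?X \<in> carrier_mat n n" "rmat ?X = Xbar"
    using compatD(1)[OF X] Y rmat_p_add[OF compatD(1)[OF X] Y] compatD(2)[OF X] by auto
  then have "compat F ?X" if "F \<in> pres ?X (mat_image P ?X)"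
    using that by (auto simp: compat_def pres_def)
  then show ?thesis
    using compat_vary_iff[OF X Y] pres_iff_\<delta>[of ?X] obs_of_eq_\<delta>[OF X Y] by auto
qed

lemma residue_scalar_prod:
  assumes "c \<in> carrier_vec n" "v \<in> carrier_vec n"
  shows "residue (lft c \<bullet> v) = c \<bullet> rvec v"
  using assms by (simp add: scalar_prod_def residue.hom_sum residue_hom)

lemma sc_residue:
  assumes g: "g \<in> carrier tors"
  shows "residue a = 0 \<Longrightarrow> sc a g = \<zero>" "residue a = 1 \<Longrightarrow> sc a g = g"
proof -
  have gM: "g \<in> carrier M" "sc pM g = \<zero>" using g by (auto simp: tors_simps)
  have 0: "sc a g = \<zero>" if "residue a = 0" for a
  proof -
    obtain y where "a = pM * y" using \<open>residue a = 0\<close> unfolding residue_eq_0_iff dvd_def by blast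
    then have "a = y * pM" by simp
    then show ?thesis using gM by (simp only: sc_mult act_zero)
  qed
  then show "residue a = 0 \<Longrightarrow> sc a g = \<zero>" .
  assume "residue a = 1"
  then have "sc (a - 1) g = \<zero>" by (intro 0) (simp add: residue.hom_minus residue_hom)
  moreover have "sc ((a - 1) + 1) g = sc (a - 1) g \<oplus> sc 1 g" by (rule sc_add[OF gM(1)])
  ultimately show "sc a g = g" using gM by simp
qed

text \<open>
  The map \<open>v \<mapsto> (c v) g\<close>. The lift of \<open>c\<close> is irrelevant for \<open>g\<close> in \<open>M[p]\<close>.
\<close>

definition rank_one :: "'p mod_ring vec \<Rightarrow> 'm \<Rightarrow> 'p padic_int vec \<Rightarrow> 'm" where
  "rank_one c g = (\<lambda>v\<in>carrier_vec n. sc (lft c \<bullet> v) g)"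

lemma rank_one_lin:
  assumes c: "c \<in> carrier_vec n" and g: "g \<in> carrier tors"
  shows "rank_one c g \<in> T.lin"
proof -
  have gM: "g \<in> carrier M" "sc pM g = \<zero>" using g by (auto simp: tors_simps)
  have lc: "lft c \<in> carrier_vec n" using c by simp
  have "rank_one c g (v + w) = rank_one c g v \<oplus> rank_one c g w" if "v \<in> carrier_vec n" "w \<in> carrier_vec n" for v w
    using that sc_add[OF gM(1)] scalar_prod_add_distrib[OF lc that] by (simp add: rank_one_def)
  moreover have "rank_one c g (a \<cdot>\<^sub>v v) = sc a (rank_one c g v)" if "v \<in> carrier_vec n" for a v
    using that sc_mult[OF gM(1)] lc by (simp add: rank_one_def)
  moreover have "sc pM (rank_one c g v) = \<zero>" if "v \<in> carrier_vec n" for v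
    using that act_comm[OF gM(1), of "[:pM:]"] gM by (simp add: rank_one_def)
  moreover have "rank_one c g \<in> carrier_vec n \<rightarrow>\<^sub>E carrier M" using gM by (simp add: rank_one_def)
  ultimately show ?thesis unfolding T_lin lin_def by blast
qed

lemma rank_one_pmv:
  assumes X: "compat F X" and c: "c \<in> carrier_vec n" and g: "g \<in> carrier tors" and w: "w \<in> carrier W"
  shows "c \<bullet> pmv (poly_residue f) Xbar w = 0 \<Longrightarrow> rank_one c g (pmv f X (lft w)) = \<zero>"
    "c \<bullet> pmv (poly_residue f) Xbar w = 1 \<Longrightarrow> rank_one c g (pmv f X (lft w)) = g"
proof -
  have wc: "lft w \<in> carrier_vec n" using w by (simp add: W_simps)
  have m: "pmv f X (lft w) \<in> carrier_vec n" using compatD(1)[OF X] wc by simp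
  have "residue (lft c \<bullet> pmv f X (lft w)) = c \<bullet> pmv (poly_residue f) Xbar w"
    using residue_scalar_prod[OF c m] rvec_pmv[OF compatD(1)[OF X] wc, of f] compatD(2)[OF X] lft_W_lift(2)[OF w] by simp
  then show "c \<bullet> pmv (poly_residue f) Xbar w = 0 \<Longrightarrow> rank_one c g (pmv f X (lft w)) = \<zero>"
    "c \<bullet> pmv (poly_residue f) Xbar w = 1 \<Longrightarrow> rank_one c g (pmv f X (lft w)) = g"
    using sc_residue[OF g] m by (simp_all add: rank_one_def)
qed

lemma submodule_pmv:
  assumes U: "submodule K U W" and u: "u \<in> U"
  shows "u \<in> carrier W" "pmv f Xbar u \<in> U"
proof -
  show uW: "u \<in> carrier W" using U u by (auto simp: submodule_def)
  have "pcls Q f \<odot>\<^bsub>W\<^esub> u \<in> U" using U u by (simp add: submodule_def)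
  then show "pmv f Xbar u \<in> U" using W_smult[OF uW] by simp
qed

text \<open>
  Let \<open>d\<close> be the degree of \<open>P\<close>. A polynomial of degree below \<open>d\<close> that is not zero is
  invertible modulo \<open>P\<close>, so a nontrivial combination of \<open>e, t e, \<dots>, t^(d-1) e\<close> cannot lie in
  \<open>U\<close>, as otherwise \<open>e\<close> would. Hence some functional vanishes on \<open>U\<close> and on \<open>t^i e\<close> for
  \<open>i < d - 1\<close>, and is \<open>1\<close> on \<open>t^(d-1) e\<close>.
\<close>

lemma top_functional:
  assumes U: "submodule K U W" and e: "e \<in> carrier W" "e \<notin> U"
  obtains c where "c \<in> carrier_vec n" "\<And>u. u \<in> U \<Longrightarrow> c \<bullet> u = 0"
    "\<And>f. (\<And>k. k \<ge> degree P \<Longrightarrow> poly.coeff f k = 0) \<Longrightarrow> c \<bullet> pmv f Xbar e = poly.coeff f (degree P - 1)"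
proof -
  define d where "d = degree P - 1"
  have ec: "e \<in> carrier_vec n" using e by (simp add: W_simps)
  have Uc: "u \<in> carrier_vec n" if "u \<in> U" for u using submodule_pmv(1)[OF U that] by (simp add: W_simps)
  have U0: "0\<^sub>v n \<in> U" and Uadd: "\<And>u v. u \<in> U \<Longrightarrow> v \<in> U \<Longrightarrow> u + v \<in> U"
    using U by (auto simp: submodule_def W_simps)
  have Usm: "a \<cdot>\<^sub>v u \<in> U" if "u \<in> U" for a u
    using submodule_pmv(2)[OF U that, of "[:a:]"] pmv_const[OF Xbar Uc[OF that]] by simp
  (* low f: the degree of f is less than d, which is here the degree of P minus 1. *)
  define low where "low f \<longleftrightarrow> (\<forall>k\<ge>d. poly.coeff f k = 0)" for f :: "'p mod_ring poly"
  define U' where "U' = {u + pmv f Xbar e | u f. u \<in> U \<and> low f}"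
  have pc: "pmv f Xbar e \<in> carrier_vec n" for f using Xbar ec by simp
  let ?x = "pmv (Polynomial.monom 1 d) Xbar e"
  have "?x \<notin> U'"
  proof
    assume "?x \<in> U'"
    then obtain u f where uf: "?x = u + pmv f Xbar e" "u \<in> U" "low f" by (auto simp: U'_def)
    define h where "h = Polynomial.monom 1 d - f"
    have "Polynomial.monom 1 d = h + f" by (simp add: h_def)
    then have "?x = pmv h Xbar e + pmv f Xbar e" using pmv_add_poly[OF Xbar ec] by simp
    then have "pmv h Xbar e + pmv f Xbar e = u + pmv f Xbar e" using uf by simp
    then have hu: "pmv h Xbar e = u"
    proof -
      assume eq: "pmv h Xbar e + pmv f Xbar e = u + pmv f Xbar e"
      show ?thesis
      proof (rule eq_vecI)
        show "dim_vec (pmv h Xbar e) = dim_vec u" using Uc[OF uf(2)] Xbar by simp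
        fix i assume "i < dim_vec u"
        then have i: "i < n" using Uc[OF uf(2)] by simp
        have "(pmv h Xbar e + pmv f Xbar e) $ i = (u + pmv f Xbar e) $ i" by (simp only: eq)
        then have "pmv h Xbar e $ i + pmv f Xbar e $ i = u $ i + pmv f Xbar e $ i"
          using i pc[of h, THEN carrier_vecD] pc[of f, THEN carrier_vecD] Uc[OF uf(2), THEN carrier_vecD]
          by (simp only: index_add_vec)
        then show "pmv h Xbar e $ i = u $ i" by simp
      qed
    qed
    have hd: "poly.coeff h d = 1" using uf(3) by (simp add: h_def low_def)
    have "degree h \<le> d"
      by (rule degree_le) (use uf(3) in \<open>auto simp: h_def low_def\<close>)
    then have "degree h < degree Q" using degree_Q degree_pos by (simp add: d_def)
    moreover have "h \<noteq> 0" using hd by auto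
    ultimately have "\<not> Q dvd h" using dvd_imp_degree_le[of Q h] by auto
    then have "coprime Q h" using irr by (simp add: irreducible_imp_prime_elem prime_elem_imp_coprime)
    then obtain a b where ab: "a * Q + b * h = 1" by (metis bezout_coefficients_fst_snd coprime_imp_gcd_eq_1)
    have "e = pmv (a * Q + b * h) Xbar e" using pmv_1[OF Xbar ec] by (simp only: ab)
    also have "\<dots> = pmv a Xbar (pmv Q Xbar e) + pmv b Xbar (pmv h Xbar e)"
      by (simp only: pmv_add_poly[OF Xbar ec] pmv_mult[OF Xbar ec])
    also have "\<dots> = pmv a Xbar (0\<^sub>v n) + pmv b Xbar u" using e by (simp add: W_simps hu)
    also have "pmv a Xbar (0\<^sub>v n) = 0\<^sub>v n" by (rule mat_vec_zero[OF poly_mat_carrier[OF Xbar]])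
    also have "0\<^sub>v n + pmv b Xbar u = pmv b Xbar u" using Xbar Uc[OF uf(2)] by simp
    finally show False using submodule_pmv(2)[OF U uf(2), of b] e by simp
  qed
  have "\<exists>c \<in> carrier_vec n. (\<forall>u\<in>U'. c \<bullet> u = 0) \<and> c \<bullet> ?x = 1"
  proof (rule separating_functional)
    show "U' \<subseteq> carrier_vec n" using Uc pc by (auto simp: U'_def)
    have "low 0" by (simp add: low_def)
    moreover have "0\<^sub>v n = 0\<^sub>v n + pmv 0 Xbar e" using pmv_0[OF Xbar ec] by simp
    ultimately show "0\<^sub>v n \<in> U'" using U0 unfolding U'_def by blast
    show "?x \<in> carrier_vec n" by (rule pc)
    show "?x \<notin> U'" by fact
  next
    fix u v assume "u \<in> U'" "v \<in> U'"
    then obtain a f b g where h: "u = a + pmv f Xbar e" "a \<in> U" "low f" "v = b + pmv g Xbar e" "b \<in> U" "low g"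
      by (auto simp: U'_def)
    have "u + v = (a + b) + pmv (f + g) Xbar e"
      unfolding h(1,4) pmv_add_poly[OF Xbar ec] by (rule vec_add_swap[OF Uc[OF h(2)] Uc[OF h(5)] pc pc])
    moreover have "low (f + g)" using h by (simp add: low_def)
    ultimately show "u + v \<in> U'" using Uadd[OF h(2) h(5)] unfolding U'_def by blast
  next
    fix a u assume "u \<in> U'"
    then obtain b f where h: "u = b + pmv f Xbar e" "b \<in> U" "low f" by (auto simp: U'_def)
    have "a \<cdot>\<^sub>v u = a \<cdot>\<^sub>v b + pmv (Polynomial.smult a f) Xbar e"
      using h pc Uc by (simp add: pmv_smult_poly[OF Xbar ec] smult_add_distrib_vec[of _ n])
    moreover have "low (Polynomial.smult a f)" using h by (simp add: low_def)
    ultimately show "a \<cdot>\<^sub>v u \<in> U'" using Usm[OF h(2)] unfolding U'_def by blast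
  qed
  then obtain c where c: "c \<in> carrier_vec n" "\<And>u. u \<in> U' \<Longrightarrow> c \<bullet> u = 0" "c \<bullet> ?x = 1" by blast
  show ?thesis
  proof (rule that[OF c(1)])
    fix u assume u: "u \<in> U"
    have "u = u + pmv 0 Xbar e" using pmv_0[OF Xbar ec] Uc[OF u] by simp
    moreover have "low 0" by (simp add: low_def)
    ultimately have "u \<in> U'" using u unfolding U'_def by blast
    then show "c \<bullet> u = 0" by (rule c(2))
  next
    fix f :: "'p mod_ring poly" assume f: "\<And>k. k \<ge> degree P \<Longrightarrow> poly.coeff f k = 0"
    define a where "a = poly.coeff f d"
    define f' where "f' = f - Polynomial.smult a (Polynomial.monom 1 d)"
    have "low f'"
      unfolding low_def
    proof (intro allI impI)
      fix k assume k: "d \<le> k"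
      show "poly.coeff f' k = 0"
      proof (cases "k = d")
        case False
        then have "k \<ge> degree P" using k by (simp add: d_def)
        then show ?thesis using f False by (simp add: f'_def)
      qed (simp add: f'_def a_def)
    qed
    moreover have "pmv f' Xbar e = 0\<^sub>v n + pmv f' Xbar e" using pc by simp
    ultimately have "pmv f' Xbar e \<in> U'" using U0 unfolding U'_def by blast
    then have 0: "c \<bullet> pmv f' Xbar e = 0" by (rule c(2))
    have "f = f' + Polynomial.smult a (Polynomial.monom 1 d)" by (simp add: f'_def)
    then have "pmv f Xbar e = pmv (f' + Polynomial.smult a (Polynomial.monom 1 d)) Xbar e" by (rule arg_cong)
    then have "pmv f Xbar e = pmv f' Xbar e + a \<cdot>\<^sub>v ?x"
      unfolding pmv_add_poly[OF Xbar ec] pmv_smult_poly[OF Xbar ec] .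
    then have "c \<bullet> pmv f Xbar e = c \<bullet> pmv f' Xbar e + a * (c \<bullet> ?x)"
      using scalar_prod_add_distrib[OF c(1) pc, of "a \<cdot>\<^sub>v ?x" f'] pc c(1) by simp
    then show "c \<bullet> pmv f Xbar e = poly.coeff f (degree P - 1)" using 0 c(3) by (simp add: a_def d_def)
  qed
qed

end

context cok_pres
begin

lemma dquot_rank_one_zero:
  assumes X: "compat F X" and c: "c \<in> carrier_vec n" and g: "g \<in> carrier tors" and U: "submodule K U W"
    and cU: "\<And>u. u \<in> U \<Longrightarrow> c \<bullet> u = 0" and u: "u \<in> U"
  shows "dquot X as (rank_one c g) (lft u) = \<zero>"
proof (induction as)
  case Nil
  then show ?case by simp
next
  case (Cons a as)
  have uW: "u \<in> carrier W" by (rule submodule_pmv(1)[OF U u])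
  have "c \<bullet> pmv (poly_residue (Poly as)) Xbar u = 0" by (rule cU[OF submodule_pmv(2)[OF U u]])
  then have "rank_one c g (pmv (Poly as) X (lft u)) = \<zero>" by (rule rank_one_pmv(1)[OF X c g uW])
  then show ?case by (simp add: Cons)
qed

text \<open>
  In the difference quotient of \<open>P\<close>, the functional \<open>c\<close> detects, among the vectors \<open>X^j e\<close>
  with \<open>j < d\<close>, only the one for \<open>j = d - 1\<close>. This power occurs only in the term for \<open>k = d\<close>,
  together with \<open>t^0\<close> and with the leading coefficient \<open>1\<close>.
\<close>

lemma dquot_rank_one_top:
  assumes X: "compat F X" and c: "c \<in> carrier_vec n" and g: "g \<in> carrier tors" and e: "e \<in> carrier W"
    and ce: "\<And>f. (\<And>k. k \<ge> degree P \<Longrightarrow> poly.coeff f k = 0) \<Longrightarrow> c \<bullet> pmv f Xbar e = poly.coeff f (degree P - 1)"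
  shows "dquot X (coeffs P) (rank_one c g) (lft e) = g"
proof -
  have small: "dquot X as (rank_one c g) (lft e) = \<zero>" if "length as \<le> degree P" for as
    using that
  proof (induction as)
    case Nil
    then show ?case by simp
  next
    case (Cons a as)
    have "c \<bullet> pmv (poly_residue (Poly as)) Xbar e = poly.coeff (poly_residue (Poly as)) (degree P - 1)"
      by (rule ce) (use Cons.prems in \<open>simp add: nth_default_beyond\<close>)
    also have "\<dots> = 0" using Cons.prems by (simp add: nth_default_beyond)
    finally have "rank_one c g (pmv (Poly as) X (lft e)) = \<zero>" by (rule rank_one_pmv(1)[OF X c g e])
    then show ?case using Cons by simp
  qed
  have P0: "P \<noteq> 0" using degree_pos by auto
  have len: "length (coeffs P) = Suc (degree P)" using P0 by (simp add: length_coeffs)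
  obtain a as where as: "coeffs P = a # as" using len by (cases "coeffs P") auto
  have PP: "P = pCons a (Poly as)" using Poly_coeffs[of P] by (simp add: as)
  have la: "length as = degree P" using len as by simp
  have lc: "poly.coeff (Poly as) (degree P - 1) = 1"
  proof -
    have "poly.coeff P (Suc (degree P - 1)) = 1" using monic degree_pos by simp
    then show ?thesis by (subst (asm) (1) PP) simp
  qed
  have "c \<bullet> pmv (poly_residue (Poly as)) Xbar e = poly.coeff (poly_residue (Poly as)) (degree P - 1)"
    by (rule ce) (use la in \<open>simp add: nth_default_beyond\<close>)
  also have "\<dots> = 1" using lc by (simp add: residue_hom del: coeff_Poly_eq)
  finally have "rank_one c g (pmv (Poly as) X (lft e)) = g" by (rule rank_one_pmv(2)[OF X c g e])
  moreover have "dquot X as (rank_one c g) (lft e) = \<zero>" using la by (intro small) simp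
  moreover have "g \<in> carrier M" using g by (simp add: tors_simps)
  ultimately show ?thesis by (simp add: as)
qed

lemma obs_of_ladd:
  assumes X: "compat F X" and Z: "Z \<in> T.lin" "Z' \<in> T.lin" and w: "w \<in> carrier W"
  shows "obs_of X (ladd Z Z') w = obs_of X Z w \<oplus> dquot X (coeffs P) Z' (lft w)"
proof -
  have lw: "lft w \<in> carrier_vec n" using w by (simp add: W_simps)
  have "\<delta> X w \<in> carrier M" using WT.homs_D(5)[OF \<delta>_hom[OF X] w] by (simp add: T.desc_simps tors_simps)
  then show ?thesis
    using w dquot_ladd[OF compatD(1)[OF X] Z lw] dquot_closed[OF T_linD(1)[OF Z(1)] compatD(1)[OF X] lw]
      dquot_closed[OF T_linD(1)[OF Z(2)] compatD(1)[OF X] lw]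
    by (simp add: obs_of_def mod.M.a_assoc)
qed

lemma homs_agree_ext:
  assumes U: "submodule K U W" and e: "e \<in> carrier W"
    and \<phi>: "\<phi> \<in> WT.homs (carrier W)" and \<psi>: "\<psi> \<in> WT.homs (carrier W)"
    and eq: "\<And>u. u \<in> U \<Longrightarrow> \<phi> u = \<psi> u" "\<phi> e = \<psi> e" and w: "w \<in> WT.ext U e"
  shows "\<phi> w = \<psi> w"
proof -
  obtain u c where h: "w = u \<oplus>\<^bsub>W\<^esub> c \<odot>\<^bsub>W\<^esub> e" "u \<in> U" "c \<in> carrier K" using w by (auto simp: WT.ext_def)
  have uW: "u \<in> carrier W" by (rule submodule_pmv(1)[OF U h(2)])
  have ce: "c \<odot>\<^bsub>W\<^esub> e \<in> carrier W" using WT.V.smult_closed[OF h(3) e] .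
  show ?thesis
    unfolding h(1) WT.homs_D(3)[OF \<phi> uW ce] WT.homs_D(3)[OF \<psi> uW ce]
      WT.homs_D(4)[OF \<phi> h(3) e] WT.homs_D(4)[OF \<psi> h(3) e] using eq(1)[OF h(2)] eq(2) by simp
qed

text \<open>
  Along a complete flag of \<open>ker P(Xbar)\<close>, adding a map of rank one to \<open>Z\<close> corrects the value
  at the new vector \<open>e\<close> without affecting the values on the previous subspace \<open>U\<close>.
\<close>

lemma obs_of_surj:
  assumes X: "compat F X" and \<psi>: "\<psi> \<in> WT.homs (carrier W)"
  shows "\<exists>Z \<in> T.lin. obs_of X Z = \<psi>"
proof -
  have "\<exists>k. card (carrier W) = card (carrier K) ^ k \<and> (\<exists>Z\<in>T.lin. \<forall>w\<in>carrier W. obs_of X Z w = \<psi> w)"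
  proof (rule WT.flag_induct[where Q = "\<lambda>U k. \<exists>Z\<in>T.lin. \<forall>w\<in>U. obs_of X Z w = \<psi> w"])
    have g: "\<zero> \<in> carrier tors" by (simp add: tors_simps)
    have z: "rank_one (0\<^sub>v n) \<zero> \<in> T.lin" by (rule rank_one_lin[OF zero_carrier_vec g])
    have "obs_of X (rank_one (0\<^sub>v n) \<zero>) \<zero>\<^bsub>W\<^esub> = \<psi> \<zero>\<^bsub>W\<^esub>"
      using WT.hom_zero[OF WT.carrier_submodule obs_of_hom[OF X z]] WT.hom_zero[OF WT.carrier_submodule \<psi>] by simp
    then show "\<exists>Z\<in>T.lin. \<forall>w\<in>{\<zero>\<^bsub>W\<^esub>}. obs_of X Z w = \<psi> w" using z by blast
  next
    fix U e k
    assume U: "submodule K U W" and e: "e \<in> carrier W" "e \<notin> U" and "\<exists>Z\<in>T.lin. \<forall>w\<in>U. obs_of X Z w = \<psi> w"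
    then obtain Z where Z: "Z \<in> T.lin" "\<And>w. w \<in> U \<Longrightarrow> obs_of X Z w = \<psi> w" by blast
    obtain c where c: "c \<in> carrier_vec n" "\<And>u. u \<in> U \<Longrightarrow> c \<bullet> u = 0"
      "\<And>f. (\<And>k. k \<ge> degree P \<Longrightarrow> poly.coeff f k = 0) \<Longrightarrow> c \<bullet> pmv f Xbar e = poly.coeff f (degree P - 1)"
      by (rule top_functional[OF U e]) blast
    have t: "obs_of X Z e \<in> carrier tors" "\<psi> e \<in> carrier tors"
      using WT.homs_D(5)[OF obs_of_hom[OF X Z(1)] e(1)] WT.homs_D(5)[OF \<psi> e(1)] by (auto simp: T.desc_simps)
    then have tM: "obs_of X Z e \<in> carrier M" "\<psi> e \<in> carrier M" by (auto simp: tors_simps)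
    define g where "g = \<psi> e \<ominus> obs_of X Z e"
    have g: "g \<in> carrier tors"
      using t by (simp add: g_def tors_simps act_minus mod.M.add_minus_cancel(3))
    define Z' where "Z' = ladd Z (rank_one c g)"
    have fl: "rank_one c g \<in> T.lin" by (rule rank_one_lin[OF c(1) g])
    have Z': "Z' \<in> T.lin" unfolding Z'_def by (rule ladd_lin[OF Z(1) fl])
    have "obs_of X Z' u = \<psi> u" if u: "u \<in> U" for u
    proof -
      have uW: "u \<in> carrier W" by (rule submodule_pmv(1)[OF U u])
      have "\<psi> u \<in> carrier M" using WT.homs_D(5)[OF \<psi> uW] by (simp add: T.desc_simps tors_simps)
      then show ?thesis
        using obs_of_ladd[OF X Z(1) fl uW] dquot_rank_one_zero[OF X c(1) g U c(2) u] Z(2)[OF u] by (simp add: Z'_def)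
    qed
    moreover have "obs_of X Z' e = \<psi> e"
      using obs_of_ladd[OF X Z(1) fl e(1)] dquot_rank_one_top[OF X c(1) g e(1) c(3)] tM
      by (simp add: Z'_def g_def mod.M.add_minus_cancel)
    ultimately have "\<forall>w\<in>WT.ext U e. obs_of X Z' w = \<psi> w"
      using homs_agree_ext[OF U e(1) obs_of_hom[OF X Z'] \<psi>] by blast
    then show "\<exists>Z\<in>T.lin. \<forall>w\<in>WT.ext U e. obs_of X Z w = \<psi> w" using Z' by blast
  qed
  then obtain Z where Z: "Z \<in> T.lin" "\<forall>w\<in>carrier W. obs_of X Z w = \<psi> w" by blast
  have "obs_of X Z = \<psi>"
    by (rule extensionalityI[OF WT.homs_D(2)[OF obs_of_hom[OF X Z(1)]] WT.homs_D(2)[OF \<psi>]]) (use Z(2) in blast)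
  then show ?thesis using Z(1) by blast
qed

lemma ladd_cancel:
  assumes "Z \<in> T.lin" "Z' \<in> T.lin" "D \<in> T.lin" "ladd Z D = ladd Z' D"
  shows "Z = Z'"
proof (rule extensionalityI[OF linD(4)[OF T_linD(1)[OF assms(1)]] linD(4)[OF T_linD(1)[OF assms(2)]]])
  fix v :: "'p padic_int vec" assume v: "v \<in> carrier_vec n"
  have "ladd Z D v = ladd Z' D v" by (simp only: assms(4))
  then have "Z v \<oplus> D v = Z' v \<oplus> D v" using v by (simp add: ladd_def)
  then show "Z v = Z' v"
    using linD(1)[OF T_linD(1)[OF assms(1)] v] linD(1)[OF T_linD(1)[OF assms(2)] v] linD(1)[OF T_linD(1)[OF assms(3)] v]
    by simp
qed

text \<open>
  Adding a fixed map \<open>D\<close> to \<open>Z\<close> changes the value of \<open>obs_of X\<close> by a fixed amount, so it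
  carries one fibre into another.
\<close>

lemma obs_of_fibre_le:
  assumes X: "compat F X" and \<phi>: "\<phi> \<in> WT.homs (carrier W)" and \<psi>: "\<psi> \<in> WT.homs (carrier W)"
  shows "card {Z \<in> T.lin. obs_of X Z = \<phi>} \<le> card {Z \<in> T.lin. obs_of X Z = \<psi>}"
proof -
  obtain Z1 where Z1: "Z1 \<in> T.lin" "obs_of X Z1 = \<phi>" using obs_of_surj[OF X \<phi>] by blast
  obtain Z2 where Z2: "Z2 \<in> T.lin" "obs_of X Z2 = \<psi>" using obs_of_surj[OF X \<psi>] by blast
  define D where "D = ladd Z2 (lneg Z1)"
  have nl: "lneg Z1 \<in> T.lin" by (rule lneg_lin[OF Z1(1)])
  have D: "D \<in> T.lin" unfolding D_def by (rule ladd_lin[OF Z2(1) nl])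
  have img: "ladd Z D \<in> {Z \<in> T.lin. obs_of X Z = \<psi>}" if Z: "Z \<in> T.lin" "obs_of X Z = \<phi>" for Z
  proof -
    have "obs_of X (ladd Z D) = \<psi>"
    proof (rule extensionalityI[OF WT.homs_D(2)[OF obs_of_hom[OF X ladd_lin[OF Z(1) D]]] WT.homs_D(2)[OF \<psi>]])
      fix w assume w: "w \<in> carrier W"
      have lw: "lft w \<in> carrier_vec n" using w by (simp add: W_simps)
      define d a b where "d = \<delta> X w" and "a = dquot X (coeffs P) Z1 (lft w)" and "b = dquot X (coeffs P) Z2 (lft w)"
      have cl: "d \<in> carrier M" "a \<in> carrier M" "b \<in> carrier M"
        using WT.homs_D(5)[OF \<delta>_hom[OF X] w] dquot_closed[OF T_linD(1)[OF Z1(1)] compatD(1)[OF X] lw]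
          dquot_closed[OF T_linD(1)[OF Z2(1)] compatD(1)[OF X] lw]
        by (auto simp: T.desc_simps tors_simps d_def a_def b_def)
      have "\<phi> w = d \<oplus> a" "\<psi> w = d \<oplus> b"
        using Z1(2) Z2(2) w by (auto simp: obs_of_def d_def a_def b_def)
      moreover have "dquot X (coeffs P) D (lft w) = b \<oplus> \<ominus> a"
        unfolding D_def dquot_ladd[OF compatD(1)[OF X] Z2(1) nl lw] dquot_lneg[OF compatD(1)[OF X] Z1(1) lw]
        by (simp add: a_def b_def)
      ultimately have "obs_of X (ladd Z D) w = (d \<oplus> a) \<oplus> (b \<oplus> \<ominus> a)"
        using obs_of_ladd[OF X Z(1) D w] Z(2) by simp
      also have "\<dots> = d \<oplus> (a \<oplus> (b \<ominus> a))" using cl by (simp add: mod.M.a_assoc a_minus_def)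
      also have "\<dots> = \<psi> w" using cl \<open>\<psi> w = d \<oplus> b\<close> by (simp add: mod.M.add_minus_cancel)
      finally show "obs_of X (ladd Z D) w = \<psi> w" .
    qed
    then show ?thesis using ladd_lin[OF Z(1) D] by blast
  qed
  show ?thesis
  proof (rule card_inj_on_le[where f = "\<lambda>Z. ladd Z D"])
    show "inj_on (\<lambda>Z. ladd Z D) {Z \<in> T.lin. obs_of X Z = \<phi>}"
      by (rule inj_onI) (use ladd_cancel[OF _ _ D] in blast)
    show "(\<lambda>Z. ladd Z D) ` {Z \<in> T.lin. obs_of X Z = \<phi>} \<subseteq> {Z \<in> T.lin. obs_of X Z = \<psi>}" using img by blast
    show "finite {Z \<in> T.lin. obs_of X Z = \<psi>}" using T.finite_lin by simp
  qed
qed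

text \<open>
  All fibres have the same size, so the proportion of those \<open>Z\<close> whose obstruction is injective
  is the proportion of injective maps among the linear maps.
\<close>

lemma card_obs_of_injs:
  assumes X: "compat F X"
  shows "card {Z \<in> T.lin. obs_of X Z \<in> WT.injs (carrier W)} * card (WT.homs (carrier W)) =
    card (carrier tors) ^ n * card (WT.injs (carrier W))"
proof -
  obtain \<psi>0 where \<psi>0: "\<psi>0 \<in> WT.homs (carrier W)" using \<delta>_hom[OF X] by blast
  define k where "k = card {Z \<in> T.lin. obs_of X Z = \<psi>0}"
  have fib: "card {Z \<in> T.lin. obs_of X Z = \<psi>} = k" if "\<psi> \<in> WT.homs (carrier W)" for \<psi>
    unfolding k_def using obs_of_fibre_le[OF X that \<psi>0] obs_of_fibre_le[OF X \<psi>0 that] by simp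
  have surj: "WT.homs (carrier W) \<subseteq> obs_of X ` T.lin" using obs_of_surj[OF X] by blast
  have sub: "WT.injs (carrier W) \<subseteq> WT.homs (carrier W)" by (auto simp: WT.injs_def)
  have 1: "card {Z \<in> T.lin. obs_of X Z \<in> WT.injs (carrier W)} = card (WT.injs (carrier W)) * k"
    by (rule card_fibres[OF T.finite_lin order_trans[OF sub surj]]) (use fib sub in blast)
  have "card {Z \<in> T.lin. obs_of X Z \<in> WT.homs (carrier W)} = card (WT.homs (carrier W)) * k"
    by (rule card_fibres[OF T.finite_lin surj]) (use fib in blast)
  moreover have "{Z \<in> T.lin. obs_of X Z \<in> WT.homs (carrier W)} = T.lin" using obs_of_hom[OF X] by blast
  ultimately have "card (WT.homs (carrier W)) * k = card (carrier tors) ^ n" using T.card_lin by simp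
  then show ?thesis using 1 by (simp add: mult.commute mult.left_commute)
qed

end

section \<open>Haar measure of a congruence class\<close>

lemma haar_prob_open_measurable:
  fixes \<mu> :: "'p :: prime_card padic_int mat measure"
  assumes "haar_prob n \<mu>" "mat_open n U"
  shows "U \<in> sets \<mu>"
proof -
  have "{U. openin (mat_topology n :: 'p padic_int mat topology) U} \<subseteq> Pow (topspace (mat_topology n))"
    using openin_subset by blast
  then have "sets (mat_borel n :: 'p padic_int mat measure) = sigma_sets (topspace (mat_topology n)) {U. openin (mat_topology n) U}"
    unfolding mat_borel_def by (rule sets_measure_of)
  then show ?thesis using assms by (auto simp: haar_prob_def intro!: sigma_sets.Basic)
qed

text \<open>
  By invariance all \<open>S i\<close> have the same measure, and these measures add up to \<open>1\<close>.
\<close>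

lemma haar_prob_translates:
  fixes \<mu> :: "'p :: prime_card padic_int mat measure" and S :: "'i \<Rightarrow> 'p padic_int mat set"
  assumes \<mu>: "haar_prob n \<mu>" and I: "finite I" and meas: "\<And>i. i \<in> I \<Longrightarrow> S i \<in> sets \<mu>"
    and disj: "disjoint_family_on S I" and cover: "(\<Union>i\<in>I. S i) = carrier_mat n n"
    and tr: "\<And>i j. i \<in> I \<Longrightarrow> j \<in> I \<Longrightarrow> \<exists>A \<in> carrier_mat n n. S j = (\<lambda>B. A + B) ` S i"
    and i: "i \<in> I"
  shows "measure \<mu> (S i) = 1 / card I"
proof -
  interpret prob_space \<mu> using \<mu> by (simp add: haar_prob_def)
  have eq: "measure \<mu> (S j) = measure \<mu> (S i)" if j: "j \<in> I" for j
  proof -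
    obtain A where A: "A \<in> carrier_mat n n" "S j = (\<lambda>B. A + B) ` S i" using tr[OF i j] by blast
    then have "emeasure \<mu> (S j) = emeasure \<mu> (S i)" using \<mu> meas[OF i] by (simp add: haar_prob_def)
    then show ?thesis by (simp add: measure_def)
  qed
  have "1 = measure \<mu> (\<Union>i\<in>I. S i)" using prob_space \<mu> by (simp add: cover haar_prob_def)
  also have "\<dots> = (\<Sum>j\<in>I. measure \<mu> (S j))"
    by (rule finite_measure_finite_Union[OF I _ disj]) (use meas in auto)
  also have "\<dots> = card I * measure \<mu> (S i)" using eq by simp
  finally have m: "1 = card I * measure \<mu> (S i)" .
  have "card I > 0" using I i by (auto simp: card_gt_0_iff)
  then show ?thesis using m by (simp add: field_simps)
qed

lemma card_carrier_mat_square: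
  "card (carrier_mat n n :: 'a :: finite mat set) = CARD('a) ^ (n * n)" "finite (carrier_mat n n :: 'a :: finite mat set)"
proof -
  have b: "bij_betw (\<lambda>f. mat n n f) (({..<n} \<times> {..<n}) \<rightarrow>\<^sub>E (UNIV :: 'a set)) (carrier_mat n n)"
  proof (rule bij_betwI')
    fix f g :: "nat \<times> nat \<Rightarrow> 'a"
    assume f: "f \<in> ({..<n} \<times> {..<n}) \<rightarrow>\<^sub>E UNIV" and g: "g \<in> ({..<n} \<times> {..<n}) \<rightarrow>\<^sub>E UNIV"
    show "(mat n n f = mat n n g) = (f = g)"
    proof
      assume eq: "mat n n f = mat n n g"
      show "f = g"
      proof (rule PiE_ext[OF f g])
        fix x assume "x \<in> {..<n} \<times> {..<n}"
        then obtain i j where x: "x = (i, j)" "i < n" "j < n" by auto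
        have "mat n n f $$ (i, j) = mat n n g $$ (i, j)" by (simp only: eq)
        then show "f x = g x" using x by simp
      qed
    qed simp
  next
    fix A :: "'a mat" assume A: "A \<in> carrier_mat n n"
    have "A = mat n n (restrict (\<lambda>ij. A $$ ij) ({..<n} \<times> {..<n}))" using A by (intro eq_matI) auto
    then show "\<exists>f\<in>({..<n} \<times> {..<n}) \<rightarrow>\<^sub>E UNIV. A = mat n n f"
      by (intro bexI[of _ "restrict (\<lambda>ij. A $$ ij) ({..<n} \<times> {..<n})"]) auto
  qed auto
  show "card (carrier_mat n n :: 'a mat set) = CARD('a) ^ (n * n)"
    using bij_betw_same_card[OF b] by (simp add: card_PiE card_cartesian_product)
  show "finite (carrier_mat n n :: 'a mat set)"
    using bij_betw_finite[OF b] by (simp add: finite_PiE)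
qed

lemma (in padic_module) lcomp_add:
  assumes F: "F \<in> lin" and Y: "Y \<in> carrier_mat n n" "Y' \<in> carrier_mat n n" and v: "v \<in> carrier_vec n"
  shows "lcomp F (Y + Y') v = lcomp F Y v \<oplus> lcomp F Y' v"
proof -
  have "(Y + Y') *\<^sub>v v = Y *\<^sub>v v + Y' *\<^sub>v v" by (rule add_mult_distrib_mat_vec[OF Y v])
  then show ?thesis
    using linD(2)[OF F mult_mat_vec_carrier[OF Y(1) v] mult_mat_vec_carrier[OF Y(2) v]] v by (simp add: lcomp_def)
qed

text \<open>
  Translation by \<open>Y' - Y\<close> carries the matrices with composite \<open>F \<circ> Y\<close> to those with composite
  \<open>F \<circ> Y'\<close>.
\<close>

lemma (in padic_module) lcomp_shift:
  assumes F: "F \<in> lin" and C: "C \<in> carrier_mat n n" and Y: "Y \<in> carrier_mat n n" and Y': "Y' \<in> carrier_mat n n"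
    and eq: "lcomp F C = lcomp F Y"
  shows "lcomp F (C - Y + Y') = lcomp F Y'"
  unfolding lcomp_def
proof (rule restrict_ext)
  fix v :: "'p padic_int vec" assume v: "v \<in> carrier_vec n"
  have c: "C *\<^sub>v v \<in> carrier_vec n" "Y *\<^sub>v v \<in> carrier_vec n" "Y' *\<^sub>v v \<in> carrier_vec n"
    using mult_mat_vec_carrier[OF C v] mult_mat_vec_carrier[OF Y v] mult_mat_vec_carrier[OF Y' v] by auto
  have "lcomp F C v = lcomp F Y v" by (simp only: eq)
  then have "F (C *\<^sub>v v) = F (Y *\<^sub>v v)" using v by (simp add: lcomp_def)
  then have 0: "F (C *\<^sub>v v - Y *\<^sub>v v) = \<zero>" using lin_eq_iff[OF F c(1,2)] by blast
  have "(C - Y + Y') *\<^sub>v v = (C - Y) *\<^sub>v v + Y' *\<^sub>v v"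
    by (rule add_mult_distrib_mat_vec[OF minus_carrier_mat[OF Y] Y' v])
  also have "(C - Y) *\<^sub>v v = C *\<^sub>v v - Y *\<^sub>v v" by (rule minus_mult_distrib_mat_vec[OF C Y v])
  finally show "F ((C - Y + Y') *\<^sub>v v) = F (Y' *\<^sub>v v)"
    using linD(2)[OF F minus_carrier_vec[OF c(1,2)] c(3)] 0 linD(1)[OF F c(3)] by simp
qed

definition (in cok_setup) pres_event :: "('p padic_int vec \<Rightarrow> 'm) \<Rightarrow> 'p padic_int mat set" where
  "pres_event F = {X \<in> carrier_mat n n. rmat X = Xbar \<and> F \<in> pres X (mat_image P X)}"

context cok_pres
begin

text \<open>
  For a choice \<open>L\<close> of lifts of residue matrices, every matrix is \<open>L A + p Y\<close> for unique \<open>A\<close>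
  and \<open>Y\<close>. A cell collects the matrices with given \<open>A\<close> and given \<open>F \<circ> Y\<close>.
\<close>

definition cell :: "('p mod_ring mat \<Rightarrow> 'p padic_int mat) \<Rightarrow> 'p mod_ring mat \<times> ('p padic_int vec \<Rightarrow> 'm) \<Rightarrow> 'p padic_int mat set" where
  "cell L i = {L (fst i) + pM \<cdot>\<^sub>m Y | Y. Y \<in> carrier_mat n n \<and> lcomp F Y = snd i}"

lemma mat_p_cancel:
  assumes "B \<in> carrier_mat n n" "Y \<in> carrier_mat n n" "Y' \<in> carrier_mat n n"
    "B + pM \<cdot>\<^sub>m Y = B + pM \<cdot>\<^sub>m (Y' :: 'p padic_int mat)"
  shows "Y = Y'"
proof (rule eq_matI)
  fix i j assume "i < dim_row Y'" "j < dim_col Y'"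
  then have ij: "i < n" "j < n" using assms by auto
  have "(B + pM \<cdot>\<^sub>m Y) $$ (i, j) = (B + pM \<cdot>\<^sub>m Y') $$ (i, j)" by (simp only: assms(4))
  then have "pM * Y $$ (i, j) = pM * Y' $$ (i, j)" using assms(1-3) ij by simp
  then show "Y $$ (i, j) = Y' $$ (i, j)" by (rule p_mult_cancel)
qed (use assms in auto)

lemma mat_residue_split:
  assumes X: "X \<in> carrier_mat n n" and B: "B \<in> carrier_mat n n" and eq: "rmat X = rmat B"
  shows "\<exists>Y \<in> carrier_mat n n. X = B + pM \<cdot>\<^sub>m (Y :: 'p padic_int mat)"
proof -
  have "\<exists>y. X $$ (i, j) - B $$ (i, j) = pM * y" if ij: "i < n" "j < n" for i j
  proof -
    have "rmat X $$ (i, j) = rmat B $$ (i, j)" by (simp only: eq)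
    then have "residue (X $$ (i, j) - B $$ (i, j)) = 0" using X B ij by (simp add: residue.hom_minus)
    then show ?thesis unfolding residue_eq_0_iff dvd_def .
  qed
  then obtain y where y: "\<And>i j. i < n \<Longrightarrow> j < n \<Longrightarrow> X $$ (i, j) - B $$ (i, j) = pM * y i j" by metis
  show ?thesis
  proof (intro bexI[of _ "mat n n (\<lambda>(i, j). y i j)"] eq_matI)
    fix i j
    assume "i < dim_row (B + pM \<cdot>\<^sub>m mat n n (\<lambda>(i, j). y i j))" "j < dim_col (B + pM \<cdot>\<^sub>m mat n n (\<lambda>(i, j). y i j))"
    then have ij: "i < n" "j < n" using B by auto
    have "X $$ (i, j) = B $$ (i, j) + pM * y i j" using y[OF ij] by (simp add: algebra_simps)
    then show "X $$ (i, j) = (B + pM \<cdot>\<^sub>m mat n n (\<lambda>(i, j). y i j)) $$ (i, j)" using B ij by simp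
  qed (use X B in auto)
qed

text \<open>
  If \<open>p^N\<close> annihilates \<open>M\<close>, then adding a multiple of \<open>p^N\<close> to \<open>Y\<close> does not change \<open>F \<circ> Y\<close>.
\<close>

lemma cell_open:
  assumes L: "L (fst i) \<in> carrier_mat n n"
  shows "mat_open n (cell L i)"
  unfolding mat_open_def
proof (intro conjI ballI)
  show "cell L i \<subseteq> carrier_mat n n" using L by (auto simp: cell_def)
  obtain N where N: "\<And>x. x \<in> carrier M \<Longrightarrow> sc (pM ^ N) x = \<zero>" using sc_p_power_kills by blast
  fix A assume "A \<in> cell L i"
  then obtain Y where Y: "Y \<in> carrier_mat n n" "lcomp F Y = snd i" "A = L (fst i) + pM \<cdot>\<^sub>m Y" by (auto simp: cell_def)
  have A: "A \<in> carrier_mat n n" using Y L by simp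
  show "\<exists>k. \<forall>B\<in>carrier_mat n n. mat_cong k A B \<longrightarrow> B \<in> cell L i"
  proof (intro exI[of _ "Suc N"] ballI impI)
    fix B assume B: "B \<in> carrier_mat n n" and c: "mat_cong (Suc N) A B"
    have "\<exists>y. B $$ (r, s) - A $$ (r, s) = pM ^ Suc N * y" if "r < n" "s < n" for r s
      using c that A unfolding mat_cong_def dvd_def by auto
    then obtain y where y: "\<And>r s. r < n \<Longrightarrow> s < n \<Longrightarrow> B $$ (r, s) - A $$ (r, s) = pM ^ Suc N * y r s" by metis
    define E where "E = mat n n (\<lambda>(r, s). y r s)"
    define E' where "E' = pM ^ N \<cdot>\<^sub>m E"
    have E: "E \<in> carrier_mat n n" "E' \<in> carrier_mat n n" by (auto simp: E_def E'_def)
    have "B = L (fst i) + pM \<cdot>\<^sub>m (Y + E')"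
    proof (rule eq_matI)
      fix r s assume "r < dim_row (L (fst i) + pM \<cdot>\<^sub>m (Y + E'))" "s < dim_col (L (fst i) + pM \<cdot>\<^sub>m (Y + E'))"
      then have rs: "r < n" "s < n" using L E by auto
      have "B $$ (r, s) = A $$ (r, s) + pM ^ Suc N * y r s" using y[OF rs] by (simp add: algebra_simps)
      then show "B $$ (r, s) = (L (fst i) + pM \<cdot>\<^sub>m (Y + E')) $$ (r, s)"
        using rs L Y E by (simp add: E'_def) (simp add: E_def algebra_simps)
    qed (use B L E in auto)
    moreover have "lcomp F (Y + E') = snd i"
    proof -
      have "Y + E' \<in> carrier_mat n n" using Y(1) E(2) by simp
      then have l: "lcomp F (Y + E') \<in> lin" "lcomp F Y \<in> lin" using lcomp_lin[OF F_lin] Y(1) by blast+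
      have "lcomp F (Y + E') = lcomp F Y"
      proof (rule extensionalityI[OF linD(4)[OF l(1)] linD(4)[OF l(2)]])
        fix v :: "'p padic_int vec" assume v: "v \<in> carrier_vec n"
        have "E' *\<^sub>v v = pM ^ N \<cdot>\<^sub>v (E *\<^sub>v v)"
          using E v by (intro eq_vecI) (auto simp: E'_def scalar_prod_def sum_distrib_left mult.assoc)
        then have "lcomp F E' v = sc (pM ^ N) (F (E *\<^sub>v v))"
          using linD(3)[OF F_lin mult_mat_vec_carrier[OF E(1) v]] v by (simp add: lcomp_def)
        also have "\<dots> = \<zero>" using N linD(1)[OF F_lin mult_mat_vec_carrier[OF E(1) v]] by simp
        finally show "lcomp F (Y + E') v = lcomp F Y v"
          using lcomp_add[OF F_lin Y(1) E(2) v] linD(1)[OF l(2) v] by simp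
      qed
      then show ?thesis using Y(2) by simp
    qed
    ultimately show "B \<in> cell L i" using Y(1) E(2) by (auto simp: cell_def)
  qed
qed

text \<open>
  The cells partition the space of matrices and are translates of each other, so each has
  measure \<open>1\<close> divided by the number of cells.
\<close>

lemma measure_cell:
  assumes \<mu>: "haar_prob n \<mu>"
    and L: "\<And>A. A \<in> carrier_mat n n \<Longrightarrow> L A \<in> carrier_mat n n \<and> rmat (L A) = A"
    and A: "A \<in> carrier_mat n n" and Z: "Z \<in> lin"
  shows "cell L (A, Z) \<in> sets \<mu>" "measure \<mu> (cell L (A, Z)) = 1 / (real CARD('p) ^ (n * n) * real (card (carrier M)) ^ n)"
proof -
  let ?I = "(carrier_mat n n :: 'p mod_ring mat set) \<times> lin"
  have meas: "cell L i \<in> sets \<mu>" if "i \<in> ?I" for i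
    by (rule haar_prob_open_measurable[OF \<mu> cell_open]) (use L that in auto)
  then show "cell L (A, Z) \<in> sets \<mu>" using A Z by simp
  have lc: "L B \<in> carrier_mat n n" "rmat (L B) = B" if "B \<in> carrier_mat n n" for B using L[OF that] by auto
  have disj: "disjoint_family_on (cell L) ?I"
    unfolding disjoint_family_on_def
  proof (intro ballI impI)
    fix i j assume i: "i \<in> ?I" and j: "j \<in> ?I" and ne: "i \<noteq> j"
    show "cell L i \<inter> cell L j = {}"
    proof (rule ccontr)
      assume "cell L i \<inter> cell L j \<noteq> {}"
      then obtain Y Y' where Y: "Y \<in> carrier_mat n n" "lcomp F Y = snd i" "Y' \<in> carrier_mat n n" "lcomp F Y' = snd j"
        "L (fst i) + pM \<cdot>\<^sub>m Y = L (fst j) + pM \<cdot>\<^sub>m Y'"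
        by (auto simp: cell_def)
      have fi: "fst i \<in> carrier_mat n n" "fst j \<in> carrier_mat n n" using i j by auto
      have "rmat (L (fst i) + pM \<cdot>\<^sub>m Y) = rmat (L (fst j) + pM \<cdot>\<^sub>m Y')" by (simp only: Y(5))
      then have f: "fst i = fst j"
        unfolding rmat_p_add[OF lc(1)[OF fi(1)] Y(1)] rmat_p_add[OF lc(1)[OF fi(2)] Y(3)] lc(2)[OF fi(1)] lc(2)[OF fi(2)] .
      then have "Y = Y'" using mat_p_cancel[OF lc(1)[OF fi(1)] Y(1,3)] Y(5) by simp
      then have "snd i = snd j" using Y by simp
      then show False using f ne by (simp add: prod_eq_iff)
    qed
  qed
  have cover: "(\<Union>i\<in>?I. cell L i) = carrier_mat n n"
  proof (intro equalityI subsetI)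
    fix X :: "'p padic_int mat" assume X: "X \<in> carrier_mat n n"
    have rX: "rmat X \<in> carrier_mat n n" using X by simp
    obtain Y where Y: "Y \<in> carrier_mat n n" "X = L (rmat X) + pM \<cdot>\<^sub>m Y"
      using mat_residue_split[OF X lc(1)[OF rX]] lc(2)[OF rX] by auto
    then have "X \<in> cell L (rmat X, lcomp F Y)" by (auto simp: cell_def)
    moreover have "(rmat X, lcomp F Y) \<in> ?I" using rX lcomp_lin[OF F_lin Y(1)] by simp
    ultimately show "X \<in> (\<Union>i\<in>?I. cell L i)" by blast
  qed (use lc in \<open>auto simp: cell_def\<close>)
  have tr: "\<exists>B \<in> carrier_mat n n. cell L j = (\<lambda>C. B + C) ` cell L i" if ij: "i \<in> ?I" "j \<in> ?I" for i j
  proof -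
    have f: "L (fst i) \<in> carrier_mat n n" "L (fst j) \<in> carrier_mat n n" and s: "snd i \<in> lin" "snd j \<in> lin"
      using ij by (simp_all only: mem_Times_iff lc(1))
    obtain Y where Y: "Y \<in> carrier_mat n n" "lcomp F Y = snd i" using lin_surj_lift[OF F_lin F_surj s(1)] by blast
    obtain Y' where Y': "Y' \<in> carrier_mat n n" "lcomp F Y' = snd j" using lin_surj_lift[OF F_lin F_surj s(2)] by blast
    have shift: "lcomp F (C - Y + Y') = snd j" if "C \<in> carrier_mat n n" "lcomp F C = snd i" for C
      by (rule trans[OF lcomp_shift[OF F_lin that(1) Y(1) Y'(1) trans[OF that(2) Y(2)[symmetric]]] Y'(2)])
    have shift': "lcomp F (C - Y' + Y) = snd i" if "C \<in> carrier_mat n n" "lcomp F C = snd j" for C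
      by (rule trans[OF lcomp_shift[OF F_lin that(1) Y'(1) Y(1) trans[OF that(2) Y'(2)[symmetric]]] Y(2)])
    define B where "B = (L (fst j) - L (fst i)) + pM \<cdot>\<^sub>m (Y' - Y)"
    have B: "B \<in> carrier_mat n n"
      unfolding B_def by (intro add_carrier_mat smult_carrier_mat minus_carrier_mat Y(1) f(1))
    have BC: "B + (L (fst i) + pM \<cdot>\<^sub>m C) = L (fst j) + pM \<cdot>\<^sub>m (C - Y + Y')" if "C \<in> carrier_mat n n" for C
    proof (rule eq_matI)
      fix r s assume "r < dim_row (L (fst j) + pM \<cdot>\<^sub>m (C - Y + Y'))" "s < dim_col (L (fst j) + pM \<cdot>\<^sub>m (C - Y + Y'))"
      then have rs: "r < n" "s < n" using Y'(1) by auto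
      have d: "dim_row (L (fst i)) = n" "dim_col (L (fst i)) = n" "dim_row Y = n" "dim_col Y = n"
        "dim_row Y' = n" "dim_col Y' = n" "dim_row C = n" "dim_col C = n" "dim_row (L (fst j)) = n" "dim_col (L (fst j)) = n"
        using that f Y(1) Y'(1) by auto
      show "(B + (L (fst i) + pM \<cdot>\<^sub>m C)) $$ (r, s) = (L (fst j) + pM \<cdot>\<^sub>m (C - Y + Y')) $$ (r, s)"
        using rs by (simp add: B_def d right_diff_distrib distrib_left)
    qed (use that f Y(1) Y'(1) in \<open>auto simp: B_def\<close>)
    have "cell L j = (\<lambda>C. B + C) ` cell L i"
    proof (intro equalityI subsetI)
      fix X assume "X \<in> cell L j"
      then obtain C where C: "C \<in> carrier_mat n n" "lcomp F C = snd j" "X = L (fst j) + pM \<cdot>\<^sub>m C" by (auto simp: cell_def)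
      have m: "C - Y' + Y \<in> carrier_mat n n" using C Y Y' by simp
      have "C - Y' + Y - Y + Y' = C" using C Y Y' by (intro eq_matI) auto
      then have "X = B + (L (fst i) + pM \<cdot>\<^sub>m (C - Y' + Y))" using BC[OF m] C by simp
      moreover have "L (fst i) + pM \<cdot>\<^sub>m (C - Y' + Y) \<in> cell L i" using m shift'[OF C(1,2)] by (auto simp: cell_def)
      ultimately show "X \<in> (\<lambda>C. B + C) ` cell L i" by blast
    next
      fix X assume "X \<in> (\<lambda>C. B + C) ` cell L i"
      then obtain C where C: "C \<in> carrier_mat n n" "lcomp F C = snd i" "X = B + (L (fst i) + pM \<cdot>\<^sub>m C)" by (auto simp: cell_def)
      have m: "C - Y + Y' \<in> carrier_mat n n" using C Y Y' by simp
      show "X \<in> cell L j" using m shift[OF C(1,2)] BC[OF C(1)] C(3) by (auto simp: cell_def)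
    qed
    then show ?thesis using B by blast
  qed
  have "measure \<mu> (cell L (A, Z)) = 1 / card ?I"
    by (rule haar_prob_translates[OF \<mu> _ meas disj cover tr]) (use card_carrier_mat_square(2) finite_lin A Z in auto)
  moreover have "card ?I = CARD('p) ^ (n * n) * card (carrier M) ^ n"
    using card_carrier_mat_square(1)[of n, where 'a = "'p mod_ring"] card_lin
    by (simp add: card_cartesian_product)
  ultimately show "measure \<mu> (cell L (A, Z)) = 1 / (real CARD('p) ^ (n * n) * real (card (carrier M)) ^ n)"
    by simp
qed

text \<open>
  The event is a union of cells over \<open>Xbar\<close>, namely of those for which \<open>Z\<close> takes values in
  \<open>M[p]\<close> and yields an injective obstruction.
\<close>

lemma measure_pres_event:
  assumes \<mu>: "haar_prob n \<mu>"
  shows "pres_event F \<in> sets \<mu>"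
    "measure \<mu> (pres_event F) * card (WT.homs (carrier W)) * (real CARD('p) ^ (n * n) * real (card (carrier M)) ^ n) =
      card (carrier tors) ^ n * card (WT.injs (carrier W))"
proof -
  interpret prob_space \<mu> using \<mu> by (simp add: haar_prob_def)
  obtain X where X: "compat F X" using pres_lifts_compat[OF pres_lifts] by blast
  (* The lift of Xbar has to satisfy F X = t F for the obstruction to describe the cell. *)
  define L where "L A = (if A = Xbar then X else map_mat lift_res A)" for A
  have L: "L A \<in> carrier_mat n n \<and> rmat (L A) = A" if "A \<in> carrier_mat n n" for A
    using that compatD(1,2)[OF X] by (auto simp: L_def intro!: eq_matI)
  define G where "G = {Z \<in> T.lin. obs_of X Z \<in> WT.injs (carrier W)}"
  have G: "G \<subseteq> lin" using T_linD(1) by (auto simp: G_def)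
  have fG: "finite G" using G finite_lin finite_subset by blast
  have ev: "pres_event F = (\<Union>Z\<in>G. cell L (Xbar, Z))"
  proof (intro equalityI subsetI)
    fix Y assume "Y \<in> pres_event F"
    then have Y: "Y \<in> carrier_mat n n" "rmat Y = Xbar" "F \<in> pres Y (mat_image P Y)" by (auto simp: pres_event_def)
    obtain C where C: "C \<in> carrier_mat n n" "Y = X + pM \<cdot>\<^sub>m C"
      using mat_residue_split[OF Y(1) compatD(1)[OF X]] Y(2) compatD(2)[OF X] by auto
    then have "lcomp F C \<in> G" using pres_vary_iff[OF X C(1)] Y(3) by (simp add: G_def)
    moreover have "Y \<in> cell L (Xbar, lcomp F C)" using C by (auto simp: cell_def L_def)
    ultimately show "Y \<in> (\<Union>Z\<in>G. cell L (Xbar, Z))" by blast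
  next
    fix Y assume "Y \<in> (\<Union>Z\<in>G. cell L (Xbar, Z))"
    then obtain C where C: "C \<in> carrier_mat n n" "lcomp F C \<in> G" "Y = X + pM \<cdot>\<^sub>m C" by (auto simp: cell_def L_def)
    then show "Y \<in> pres_event F"
      using pres_vary_iff[OF X C(1)] rmat_p_add[OF compatD(1)[OF X] C(1)] compatD(1,2)[OF X]
      by (simp add: pres_event_def G_def)
  qed
  have mc: "cell L (Xbar, Z) \<in> sets \<mu>"
    "measure \<mu> (cell L (Xbar, Z)) = 1 / (real CARD('p) ^ (n * n) * real (card (carrier M)) ^ n)" if "Z \<in> G" for Z
    using measure_cell[OF \<mu> L Xbar] that G by blast+
  show "pres_event F \<in> sets \<mu>" unfolding ev using mc(1) fG by blast
  have dj: "disjoint_family_on (\<lambda>Z. cell L (Xbar, Z)) G"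
    unfolding disjoint_family_on_def
  proof (intro ballI impI)
    fix Z Z' assume "Z \<in> G" "Z' \<in> G" and ne: "Z \<noteq> Z'"
    show "cell L (Xbar, Z) \<inter> cell L (Xbar, Z') = {}"
    proof (rule ccontr)
      assume "cell L (Xbar, Z) \<inter> cell L (Xbar, Z') \<noteq> {}"
      then obtain Y Y' where Y: "Y \<in> carrier_mat n n" "lcomp F Y = Z" "Y' \<in> carrier_mat n n" "lcomp F Y' = Z'"
        "L Xbar + pM \<cdot>\<^sub>m Y = L Xbar + pM \<cdot>\<^sub>m Y'"
        by (auto simp: cell_def)
      have "L Xbar \<in> carrier_mat n n" using L[OF Xbar] by blast
      from mat_p_cancel[OF this Y(1,3,5)] show False using Y ne by simp
    qed
  qed
  have "measure \<mu> (pres_event F) = (\<Sum>Z\<in>G. measure \<mu> (cell L (Xbar, Z)))"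
    unfolding ev by (rule finite_measure_finite_Union[OF fG _ dj]) (use mc(1) in auto)
  also have "\<dots> = card G * (1 / (real CARD('p) ^ (n * n) * real (card (carrier M)) ^ n))"
    using mc(2) by simp
  finally have m: "measure \<mu> (pres_event F) = card G / (real CARD('p) ^ (n * n) * real (card (carrier M)) ^ n)" by simp
  have cM: "card (carrier M) > 0" using fin mod.M.zero_closed by (auto simp: card_gt_0_iff)
  have "card G * card (WT.homs (carrier W)) = card (carrier tors) ^ n * card (WT.injs (carrier W))"
    unfolding G_def by (rule card_obs_of_injs[OF X])
  then have "real (card G) * card (WT.homs (carrier W)) = card (carrier tors) ^ n * card (WT.injs (carrier W))"
    by (metis of_nat_mult)
  then show "measure \<mu> (pres_event F) * card (WT.homs (carrier W)) * (real CARD('p) ^ (n * n) * real (card (carrier M)) ^ n) =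
      card (carrier tors) ^ n * card (WT.injs (carrier W))"
    using cM unfolding m by (simp add: field_simps)
qed

end

section \<open>Counting presentations\<close>

context cok_setup
begin

definition iso_event :: "'p padic_int mat set" where
  "iso_event = {X \<in> carrier_mat n n. rmat X = Xbar \<and> pres X (mat_image P X) \<noteq> {}}"

lemma finite_pres_lifts: "finite pres_lifts"
  by (rule finite_subset[OF _ finite_lin]) (auto simp: pres_lifts_def)

text \<open>
  Every matrix in \<open>iso_event\<close> has as many presentations as \<open>M\<close> has automorphisms, so the sum
  of the measures of the sets \<open>pres_event F\<close> counts each matrix that often.
\<close>

lemma measure_iso_event:
  fixes c :: real
  assumes \<mu>: "haar_prob n \<mu>" and c: "\<And>F. F \<in> pres_lifts \<Longrightarrow> pres_event F \<in> sets \<mu> \<and> measure \<mu> (pres_event F) = c"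
  shows "iso_event \<in> sets \<mu>" "measure \<mu> iso_event * card (module_aut (poly_quot P) M) = card pres_lifts * c"
proof -
  interpret prob_space \<mu> using \<mu> by (simp add: haar_prob_def)
  have iso: "iso_event = (\<Union>F\<in>pres_lifts. pres_event F)"
    using pres_in_pres_lifts by (auto simp: iso_event_def pres_event_def)
  show S: "iso_event \<in> sets \<mu>" unfolding iso by (rule sets.finite_UN[OF finite_pres_lifts]) (use c in blast)
  let ?a = "real (card (module_aut (poly_quot P) M))"
  have pt: "(\<Sum>F\<in>pres_lifts. indicat_real (pres_event F) X) = ?a * indicat_real iso_event X" for X
  proof (cases "X \<in> iso_event")
    case True
    then obtain F0 where X: "X \<in> carrier_mat n n" "rmat X = Xbar" and F0: "F0 \<in> pres X (mat_image P X)"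
      by (auto simp: iso_event_def)
    have "(\<Sum>F\<in>pres_lifts. indicat_real (pres_event F) X) = (\<Sum>F\<in>{F \<in> pres_lifts. X \<in> pres_event F}. 1)"
      unfolding sum.inter_filter[OF finite_pres_lifts] by (intro sum.cong refl) (simp add: indicator_def)
    also have "\<dots> = real (card {F \<in> pres_lifts. X \<in> pres_event F})" by simp
    also have "{F \<in> pres_lifts. X \<in> pres_event F} = pres X (mat_image P X)"
      using X pres_in_pres_lifts[OF _ X] by (auto simp: pres_event_def)
    also have "card (pres X (mat_image P X)) = card (module_aut (poly_quot P) M)" by (rule card_pres[OF F0 X(1)])
    finally show ?thesis using True by simp
  next
    case False
    then have "indicat_real (pres_event F) X = 0" if "F \<in> pres_lifts" for F using that iso by auto
    then show ?thesis using False by simp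
  qed
  have int: "integrable \<mu> (indicat_real (pres_event F))" "(\<integral>x. indicat_real (pres_event F) x \<partial>\<mu>) = c" if F: "F \<in> pres_lifts" for F
  proof -
    have m: "pres_event F \<in> sets \<mu>" "measure \<mu> (pres_event F) = c" using c[OF F] by auto
    show "integrable \<mu> (indicat_real (pres_event F))" using m by (simp add: emeasure_eq_measure)
    show "(\<integral>x. indicat_real (pres_event F) x \<partial>\<mu>) = c" using m by simp
  qed
  have "(\<integral>x. (\<Sum>F\<in>pres_lifts. indicat_real (pres_event F) x) \<partial>\<mu>) = (\<Sum>F\<in>pres_lifts. \<integral>x. indicat_real (pres_event F) x \<partial>\<mu>)"
    by (rule Bochner_Integration.integral_sum) (rule int(1))
  also have "\<dots> = card pres_lifts * c" using int(2) by simp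
  also have "(\<integral>x. (\<Sum>F\<in>pres_lifts. indicat_real (pres_event F) x) \<partial>\<mu>) = (\<integral>x. ?a * indicat_real iso_event x \<partial>\<mu>)"
    by (simp only: pt)
  also have "\<dots> = ?a * measure \<mu> iso_event" using S by simp
  finally show "measure \<mu> iso_event * card (module_aut (poly_quot P) M) = card pres_lifts * c" by (simp add: mult.commute)
qed

lemma card_Mbar_dim: "card (carrier Mbar) = card (carrier K) ^ residue_dim P M"
proof -
  interpret D: vectorspace K V.desc by (rule finite_space.vectorspace[OF V.desc_space])
  have "card (carrier V.desc) = card (carrier K) ^ D.dim"
    by (rule D.card_eq_power_dim) (use finite_K Mbar_finite in \<open>simp_all add: V.desc_simps\<close>)
  moreover have "V.desc = descend_scalars (poly_quot P) quot_residue (quot_nat M CARD('p))"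
    unfolding V.desc_def by (simp only: Mbar_def)
  ultimately show ?thesis unfolding V.desc_simps by (simp only: residue_dim_def)
qed

lemma card_K_gt_1: "card (carrier K) > 1"
  unfolding card_K by (rule one_less_power[OF prime_gt_1_nat[OF prime_card] degree_pos])

text \<open>
  The left side is the order of the general linear group of rank \<open>r\<close> over a field with \<open>q\<close>
  elements.
\<close>

lemma gl_card_real:
  fixes q :: nat
  assumes q: "q > 1"
  shows "real (\<Prod>i<r. q ^ r - q ^ i) = real q ^ (r * r) * (\<Prod>i = 1..r. 1 - 1 / real q ^ i)"
proof -
  have "real (\<Prod>i<r. q ^ r - q ^ i) = (\<Prod>i<r. real q ^ r - real q ^ i)"
    unfolding of_nat_prod using q by (intro prod.cong refl) (simp add: of_nat_diff power_increasing)
  also have "\<dots> = (\<Prod>i<r. real q ^ r * (1 - 1 / real q ^ (r - i)))"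
  proof (rule prod.cong[OF refl])
    fix i assume "i \<in> {..<r}"
    then have "real q ^ r = real q ^ (r - i) * real q ^ i" by (simp add: power_add[symmetric])
    then show "real q ^ r - real q ^ i = real q ^ r * (1 - 1 / real q ^ (r - i))"
      using q by (simp add: right_diff_distrib)
  qed
  also have "\<dots> = real q ^ (r * r) * (\<Prod>i<r. 1 - 1 / real q ^ (r - i))"
    by (simp add: prod.distrib power_mult)
  also have "(\<Prod>i<r. 1 - 1 / real q ^ (r - i)) = (\<Prod>i = 1..r. 1 - 1 / real q ^ i)"
    by (rule prod.reindex_bij_witness[of _ "\<lambda>i. r - i" "\<lambda>i. r - i"]) auto
  finally show ?thesis .
qed

lemma iso_event_probability:
  assumes \<mu>: "haar_prob n \<mu>"
    and iso: "module_isomorphic (poly_quot P) (restrict_scalars quot_residue (cok Q Xbar)) (quot_nat M CARD('p))"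
  defines "r \<equiv> residue_dim P M" and "q \<equiv> real CARD('p) ^ degree P"
  shows "iso_event \<in> sets \<mu>"
    "measure \<mu> iso_event * card (module_aut (poly_quot P) M) =
      q ^ (r * r) * (\<Prod>i = 1..r. 1 - 1 / q ^ i) ^ 2 / real CARD('p) ^ (n * n)"
proof -
  let ?k = "card (carrier K)"
  have q: "q = real ?k" by (simp add: q_def card_K)
  have ne: "V.pres X1 (V.res_image Xbar) \<noteq> {}"
    using V.cok_residue_isomorphic_pres[OF Xbar X1] iso by (simp add: Mbar_def)
  define g where "g = (\<Prod>i<r. ?k ^ r - ?k ^ i)"
  have Mb: "card (carrier Mbar) = ?k ^ r" by (simp add: card_Mbar_dim r_def)
  have tr: "card (carrier tors) = ?k ^ r" using card_Mbar_tors Mb by simp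
  have autV: "card (module_aut (poly_quot P) Mbar) = g" unfolding g_def by (rule V.card_aut_killed[OF Mb])
  have cW: "card (carrier W) = ?k ^ r" using ne card_W[OF _ X1(1)] Mb by auto
  obtain l where l: "card (carrier W) = ?k ^ l" "card (WT.homs (carrier W)) = card (carrier T.desc) ^ l"
    "card (WT.injs (carrier W)) = (\<Prod>i<l. card (carrier T.desc) - ?k ^ i)"
    using WT.card_homs_injs by blast
  have "l = r" using l(1) cW card_K_gt_1 by simp
  then have homs: "card (WT.homs (carrier W)) = (?k ^ r) ^ r" and injs: "card (WT.injs (carrier W)) = g"
    using l(2,3) tr by (simp_all add: T.desc_simps g_def)
  let ?N = "real CARD('p) ^ (n * n)"
  have pos: "?N > 0" "real ?k > 0" "real (card pmult) > 0"
    using card_K_gt_1 card_pmult_pos zero_less_card_finite[where 'a = 'p] by auto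
  (* The common measure of all pres_event F, in which the factor (|G[p]| / |G|)^n has been
     simplified to 1 / |pG|^n. *)
  define c where "c = real g / ((real ?k ^ r) ^ r * ?N * real (card pmult) ^ n)"
  have cF: "pres_event F \<in> sets \<mu> \<and> measure \<mu> (pres_event F) = c" if F: "F \<in> pres_lifts" for F
  proof -
    interpret E: cok_pres P M n Xbar F by unfold_locales (rule F)
    have "measure \<mu> (pres_event F) * (real ?k ^ r) ^ r * (?N * (real (card pmult) * real ?k ^ r) ^ n) =
      (real ?k ^ r) ^ n * real g"
      using E.measure_pres_event(2)[OF \<mu>] unfolding homs injs tr card_tors by simp
    then have "measure \<mu> (pres_event F) = c"
      using pos by (simp add: c_def field_simps)
    then show ?thesis using E.measure_pres_event(1)[OF \<mu>] by simp
  qed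
  show "iso_event \<in> sets \<mu>" by (rule measure_iso_event(1)[OF \<mu> cF])
  have "measure \<mu> iso_event * card (module_aut (poly_quot P) M) = real (card pres_lifts) * c"
    by (rule measure_iso_event(2)[OF \<mu> cF])
  also have "\<dots> = real g * real g / ((real ?k ^ r) ^ r * ?N)"
    using pos by (simp add: card_pres_lifts[OF ne] autV c_def field_simps)
  also have "real g = q ^ (r * r) * (\<Prod>i = 1..r. 1 - 1 / q ^ i)"
    unfolding g_def q by (rule gl_card_real[OF card_K_gt_1])
  also have "(real ?k ^ r) ^ r = q ^ (r * r)" by (simp add: q power_mult)
  also have "q ^ (r * r) * (\<Prod>i = 1..r. 1 - 1 / q ^ i) * (q ^ (r * r) * (\<Prod>i = 1..r. 1 - 1 / q ^ i)) / (q ^ (r * r) * ?N)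
      = q ^ (r * r) * (\<Prod>i = 1..r. 1 - 1 / q ^ i) ^ 2 / ?N"
    using pos q by (simp add: power2_eq_square)
  finally show "measure \<mu> iso_event * card (module_aut (poly_quot P) M) =
      q ^ (r * r) * (\<Prod>i = 1..r. 1 - 1 / q ^ i) ^ 2 / ?N" .
qed

end

theorem corollary1p10:
  fixes P :: "('p :: prime_card) padic_int poly"
    and G :: "('p padic_int poly set, 'g) module"
    and n :: nat
    and Xbar :: "'p mod_ring mat"
    and \<Omega> :: "'w measure"
    and X :: "'w \<Rightarrow> 'p padic_int mat"
  assumes "lead_coeff P = 1"
    and "Factorial_Ring.irreducible (poly_residue P)"
    and "Module.module (poly_quot P) G"
    and "finite (carrier G)"
    and "n \<ge> 1"
    and "Xbar \<in> carrier_mat n n"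
    and "module_isomorphic (poly_quot P)
           (restrict_scalars quot_residue (cok (poly_residue P) Xbar)) (quot_nat G CARD('p))"
    and "prob_space \<Omega>"
    and "X \<in> measurable \<Omega> (mat_borel n)"
    and "haar_prob n (distr \<Omega> (mat_borel n) X)"
  shows "\<P>(\<omega> in \<Omega>. module_isomorphic (poly_quot P) (cok P (X \<omega>)) G \<and> map_mat residue (X \<omega>) = Xbar) =
    real CARD('p) powi (int (degree P) * int (residue_dim P G) ^ 2 - int n ^ 2)
      / real (card (module_aut (poly_quot P) G))
      * (\<Prod>i = 1..residue_dim P G. (1 - real CARD('p) powi (- int (i * degree P))) ^ 2)"
proof -
  interpret S: cok_setup P G n Xbar
    by (intro cok_setup.intro padic_prime.intro padic_module.intro cok_setup_axioms.intro assms)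
  let ?\<mu> = "distr \<Omega> (mat_borel n) X"
  let ?p = "real CARD('p)" and ?d = "degree P" and ?r = "residue_dim P G"
  let ?A = "real (card (module_aut (poly_quot P) G))"
  note main = S.iso_event_probability[OF assms(10,7)]
  have p0: "?p \<noteq> 0" using zero_less_card_finite[where 'a = 'p] by simp
  have Xc: "X \<omega> \<in> carrier_mat n n" if "\<omega> \<in> space \<Omega>" for \<omega>
  proof -
    have "space (mat_borel n) = (carrier_mat n n :: 'p padic_int mat set)"
      using assms(10) by (simp add: haar_prob_def)
    then show ?thesis using measurable_space[OF assms(9) that] by simp
  qed
  have "{\<omega> \<in> space \<Omega>. module_isomorphic (poly_quot P) (cok P (X \<omega>)) G \<and> map_mat residue (X \<omega>) = Xbar}
      = X -` S.iso_event \<inter> space \<Omega>"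
    using Xc S.cok_isomorphic_iff_pres by (auto simp: S.iso_event_def)
  then have "\<P>(\<omega> in \<Omega>. module_isomorphic (poly_quot P) (cok P (X \<omega>)) G \<and> map_mat residue (X \<omega>) = Xbar)
      = measure ?\<mu> S.iso_event"
    using measure_distr[OF assms(9), of S.iso_event] main(1) by simp
  also have "measure ?\<mu> S.iso_event = (?p ^ ?d) ^ (?r * ?r) * (\<Prod>i = 1..?r. 1 - 1 / (?p ^ ?d) ^ i) ^ 2 / ?p ^ (n * n) / ?A"
  proof -
    have "?A > 0"
    proof -
      have "module_aut (poly_quot P) G \<subseteq> carrier G \<rightarrow>\<^sub>E carrier G"
        by (auto simp: module_aut_def module_isos_def module_hom_def PiE_def)
      then have "finite (module_aut (poly_quot P) G)"
        by (rule finite_subset) (intro finite_PiE assms(4))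
      moreover have "restrict (\<lambda>x. x) (carrier G) \<in> module_aut (poly_quot P) G"
        using S.mod.smult_closed by (auto simp: module_aut_def module_isos_def module_hom_def bij_betw_def inj_on_def)
      ultimately show ?thesis by (auto simp: card_gt_0_iff)
    qed
    then show ?thesis using main(2) by (simp add: field_simps)
  qed
  also have "(?p ^ ?d) ^ (?r * ?r) = ?p powi (int ?d * int ?r ^ 2)"
  proof -
    have "int ?d * int ?r ^ 2 = int (?d * (?r * ?r))" by (simp add: power2_eq_square)
    then have "?p powi (int ?d * int ?r ^ 2) = ?p ^ (?d * (?r * ?r))" by (simp only: power_int_of_nat)
    then show ?thesis by (simp only: power_mult)
  qed
  also have "?p ^ (n * n) = ?p powi (int n ^ 2)"
  proof -
    have "int n ^ 2 = int (n * n)" by (simp add: power2_eq_square)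
    then show ?thesis by (simp only: power_int_of_nat)
  qed
  also have "(\<Prod>i = 1..?r. 1 - 1 / (?p ^ ?d) ^ i) ^ 2 = (\<Prod>i = 1..?r. (1 - ?p powi (- int (i * ?d))) ^ 2)"
  proof -
    have "?p powi (- int (i * ?d)) = 1 / (?p ^ ?d) ^ i" for i
      by (simp only: power_int_minus power_int_of_nat mult.commute[of i] power_mult inverse_eq_divide)
    then show ?thesis by (simp only: prod_power_distrib)
  qed
  also have "?p powi (int ?d * int ?r ^ 2) * (\<Prod>i = 1..?r. (1 - ?p powi (- int (i * ?d))) ^ 2) / ?p powi (int n ^ 2) / ?A
      = ?p powi (int ?d * int ?r ^ 2 - int n ^ 2) / ?A * (\<Prod>i = 1..?r. (1 - ?p powi (- int (i * ?d))) ^ 2)"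
    using p0 by (simp add: power_int_diff)
  finally show ?thesis .
qed

end
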